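(* Let $G$ be a braced polygonal circuit. Then $G$ is minimally 3-connected if and only if $G$ satisfies the unique interval property.
   Context: A braced polygon graph is a finite simple graph $G=(V,E)$ with a distinguished Hamilton cycle (the outer polygon), whose edges are called boundary edges; the other edges are called braces (interior edges). It is minimally 3-connected if it is 3-connected (as a graph) and removing any brace makes it no longer 3-connected. A graph with $n$ vertices and $m$ edges is a generic rigidity circuit if $m=2n-2$ and every subgraph on $k$ vertices with $2\le k<n$ has at most $2k-3$ edges. A braced polygonal circuit is a braced polygon graph that is a generic rigidity circuit. The vertices are thought of as placed in strictly convex position in the cyclic order of the Hamilton cycle. Two edges intersect in the interior of the polygon if they are braces with four distinct endpoints that alternate in the cyclic order. $G$ satisfies the unique interval property if the vertices can be labelled $v_1,\dots,v_n$ consecutively (counterclockwise) along the Hamilton cycle (indices modulo $n$) so that, for some $k\ge1$, the set $I=\{v_1,\dots,v_k\}$ of consecutive vertices satisfies: 1. $\deg(v_i)\ge4$ and $v_{i-1}v_{i+1}$ is an edge of $G$ for every $v_i\in I$; 2. $\deg(v_i)=3$ for every $v_i\in V\setminus I$, and no edges other than boundary edges exist between two vertices of $V\setminus I$, except $v_nv_2$ when $k=1$; 3. if two edges, each connecting a vertex of $I$ to a vertex of $V\setminus I$, intersect in the interior of the polygon, then their two endpoints in $I$ are connected by an edge of the outer polygon.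
   Formalization: The case n = 4 is excluded: the only braced polygonal circuit on four vertices is K4, which is minimally 3-connected but has all degrees 3, so it fails condition 1 of the unique interval property and the equivalence is false for it. *)

theory Defs
  imports Main
begin

text \<open>A finite simple graph is a finite vertex set together with a set of two-element subsets
  of it as edges.\<close>

definition simple_graph :: "'a set \<Rightarrow> 'a set set \<Rightarrow> bool" where
  "simple_graph V E \<longleftrightarrow> finite V \<and> (\<forall>e\<in>E. e \<subseteq> V \<and> card e = 2)"

definition subgraph :: "'a set \<Rightarrow> 'a set set \<Rightarrow> 'a set \<Rightarrow> 'a set set \<Rightarrow> bool" where
  "subgraph W F V E \<longleftrightarrow> simple_graph W F \<and> W \<subseteq> V \<and> F \<subseteq> E"

definition degree :: "'a set set \<Rightarrow> 'a \<Rightarrow> nat" where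
  "degree E x = card {e \<in> E. x \<in> e}"

definition connected_graph :: "'a set \<Rightarrow> 'a set set \<Rightarrow> bool" where
  "connected_graph V E \<longleftrightarrow>
     V \<noteq> {} \<and> (\<forall>x\<in>V. \<forall>y\<in>V. (x, y) \<in> {(p, q). {p, q} \<in> E}\<^sup>*)"

definition three_connected :: "'a set \<Rightarrow> 'a set set \<Rightarrow> bool" where
  "three_connected V E \<longleftrightarrow>
     3 < card V \<and>
     (\<forall>S. S \<subseteq> V \<and> card S < 3 \<longrightarrow> connected_graph (V - S) {e \<in> E. e \<subseteq> V - S})"

text \<open>A labelling \<open>v\<close> lists the vertices consecutively around the Hamilton cycle with edge set
  \<open>H\<close>. It is indexed by all integers with period \<open>n = card V\<close>, so that \<open>v 1, \<dots>, v n\<close> are the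
  vertices and indices are automatically taken modulo \<open>n\<close>. The cycle \<open>H\<close> carries no orientation,
  so the labellings of \<open>H\<close> are those running counterclockwise for either of the two ways of
  placing the vertices in convex position.\<close>

definition cyclic_labelling :: "'a set \<Rightarrow> 'a set set \<Rightarrow> (int \<Rightarrow> 'a) \<Rightarrow> bool" where
  "cyclic_labelling V H v \<longleftrightarrow>
     (\<forall>i. v (i + int (card V)) = v i) \<and>
     bij_betw v {1..int (card V)} V \<and>
     H = {{v i, v (i + 1)} | i. i \<in> {1..int (card V)}}"

definition hamilton_cycle :: "'a set \<Rightarrow> 'a set set \<Rightarrow> 'a set set \<Rightarrow> bool" where
  "hamilton_cycle V E H \<longleftrightarrow> 3 \<le> card V \<and> H \<subseteq> E \<and> (\<exists>v. cyclic_labelling V H v)"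

text \<open>The boundary edges are the elements of \<open>H\<close>, the braces those of \<open>E - H\<close>.\<close>

definition braced_polygon_graph :: "'a set \<Rightarrow> 'a set set \<Rightarrow> 'a set set \<Rightarrow> bool" where
  "braced_polygon_graph V E H \<longleftrightarrow> simple_graph V E \<and> hamilton_cycle V E H"

definition minimally_3_connected :: "'a set \<Rightarrow> 'a set set \<Rightarrow> 'a set set \<Rightarrow> bool" where
  "minimally_3_connected V E H \<longleftrightarrow>
     three_connected V E \<and> (\<forall>e \<in> E - H. \<not> three_connected V (E - {e}))"

definition generic_rigidity_circuit :: "'a set \<Rightarrow> 'a set set \<Rightarrow> bool" where
  "generic_rigidity_circuit V E \<longleftrightarrow>
     int (card E) = 2 * int (card V) - 2 \<and>
     (\<forall>W F. subgraph W F V E \<and> 2 \<le> card W \<and> card W < card V \<longrightarrow>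
        int (card F) \<le> 2 * int (card W) - 3)"

definition braced_polygonal_circuit :: "'a set \<Rightarrow> 'a set set \<Rightarrow> 'a set set \<Rightarrow> bool" where
  "braced_polygonal_circuit V E H \<longleftrightarrow>
     braced_polygon_graph V E H \<and> generic_rigidity_circuit V E"

text \<open>In strictly convex position two edges meet in the interior of the polygon iff they are
  braces with four distinct endpoints alternating in the cyclic order; the indices
  \<open>a < b < c < d < a + n\<close> say that these endpoints occur in this order within one turn.\<close>

definition intersect_in_interior ::
  "'a set \<Rightarrow> 'a set set \<Rightarrow> 'a set set \<Rightarrow> (int \<Rightarrow> 'a) \<Rightarrow> 'a set \<Rightarrow> 'a set \<Rightarrow> bool" where
  "intersect_in_interior V E H v e f \<longleftrightarrow>
     e \<in> E - H \<and> f \<in> E - H \<and>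
     (\<exists>a b c d. a < b \<and> b < c \<and> c < d \<and> d < a + int (card V) \<and>
        e = {v a, v c} \<and> f = {v b, v d})"

definition unique_interval_property :: "'a set \<Rightarrow> 'a set set \<Rightarrow> 'a set set \<Rightarrow> bool" where
  "unique_interval_property V E H \<longleftrightarrow>
     (\<exists>v k I. cyclic_labelling V H v \<and> 1 \<le> k \<and> k \<le> int (card V) \<and> I = v ` {1..k} \<and>
        (\<forall>i\<in>{1..k}. 4 \<le> degree E (v i) \<and> {v (i - 1), v (i + 1)} \<in> E) \<and>
        (\<forall>x \<in> V - I. degree E x = 3) \<and>
        (\<forall>e \<in> E - H. e \<subseteq> V - I \<longrightarrow> k = 1 \<and> e = {v (int (card V)), v 2}) \<and>
        (\<forall>x\<in>I. \<forall>y\<in>I. \<forall>p \<in> V - I. \<forall>q \<in> V - I.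
           intersect_in_interior V E H v {x, p} {y, q} \<longrightarrow> {x, y} \<in> H))"

end

theory Submission
  imports Defs
begin

text \<open>Three-connectivity of a braced polygon is a crossing condition: because the outer cycle
stays connected after the removal of one vertex, a separating pair must consist of two
non-adjacent vertices, i.e. span a diagonal of the polygon, and it separates exactly when
no brace crosses that diagonal. So the graph is 3-connected iff every diagonal is crossed by a
brace, and a brace is indispensable iff some diagonal is crossed by that brace only.
A set of braces with these two properties is called \<open>min_crossed\<close> below.

The rigidity hypothesis enters only through the number \<open>n - 2\<close> of braces, and the implication
from minimality follows from an extremal statement (\<open>extremal\<close>): a polygon with \<open>n \<ge> 4\<close> vertices
and minimally crossed braces has at most \<open>n - 2\<close> braces, and for \<open>n \<ge> 5\<close> equality forces the
unique interval property. It is proved by induction on \<open>n\<close>.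
Let a vertex be branched if it has at least two braces. If every brace has an end that is not
branched, braces are counted through these ends (\<open>star_case\<close>). Otherwise some brace \<open>uv\<close> has two
branched ends. Choose a diagonal \<open>pq\<close> crossed by \<open>uv\<close> only and contract either open side
of it to the end of \<open>uv\<close> lying there. The two contracted polygons have \<open>n + 4\<close> vertices
in total; if both are minimally crossed, they have one brace more than the original, or two
more if \<open>pq\<close> is a brace, so a bound of the right order is inherited. If the diagonal is chosen with
the side of \<open>u\<close> as small as possible, contracting the side of \<open>v\<close> preserves
the crossing conditions (\<open>min_jumped\<close>, \<open>min_crossed_part\<close>); the other contraction may
need \<open>pq\<close> as an additional brace (\<open>min_crossed_part'\<close>). The one case in which the
count is off by one, namely \<open>pq\<close> is no brace and no additional brace is needed, is settled by
\<open>not_tight\<close>: then neither contraction attains its bound. In the cases of equality both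
contractions have the interval structure, exactly one of \<open>p\<close>, \<open>q\<close> is branched (\<open>one_big\<close>),
and the two intervals are joined there (\<open>merge\<close>).

Conversely, under the unique interval property a diagonal ending in the interval is crossed by the
brace joining the two neighbours of that end, and a diagonal between two outer vertices by the brace of
an outer vertex between them. Counting \<open>n - 2\<close> braces shows that the braces inside the
interval are just those joining \<open>t - 1\<close> to \<open>t + 1\<close>, and the crossing condition yields a diagonal at
\<open>t\<close> which no other brace crosses (\<open>critical_chord\<close>).\<close>

section \<open>Cyclic order and polygons with braces\<close>

text \<open>This says that the chords \<open>pq\<close> and \<open>xy\<close> of a circle alternate. Vertices are integers in their
increasing cyclic order. For \<open>p < q\<close> the equation \<open>(p < x) = (x < q)\<close> means that \<open>x\<close> lies between,
and for \<open>q < p\<close> that it does not lie between, so comparing the two truth values gives a condition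
that is invariant under rotation and reflection of the polygon.\<close>
definition cross :: "int \<Rightarrow> int \<Rightarrow> int \<Rightarrow> int \<Rightarrow> bool" where
  "cross p q x y \<longleftrightarrow> x \<noteq> p \<and> x \<noteq> q \<and> y \<noteq> p \<and> y \<noteq> q \<and> ((p < x) = (x < q)) \<noteq> ((p < y) = (y < q))"

definition diagonal :: "int set \<Rightarrow> int \<Rightarrow> int \<Rightarrow> bool" where
  "diagonal P x y \<longleftrightarrow> x \<in> P \<and> y \<in> P \<and> (\<exists>a\<in>P. \<exists>b\<in>P. cross x y a b)"

definition adj :: "int set \<Rightarrow> int \<Rightarrow> int \<Rightarrow> bool" where
  "adj P x y \<longleftrightarrow> x \<in> P \<and> y \<in> P \<and> x \<noteq> y \<and> (\<forall>a\<in>P. \<forall>b\<in>P. \<not> cross x y a b)"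

text \<open>The crossing form of minimal 3-connectivity: every diagonal is crossed, and each brace is the
only one to cross some diagonal.\<close>
definition min_crossed :: "int set \<Rightarrow> int set set \<Rightarrow> bool" where
  "min_crossed P E \<longleftrightarrow> finite P \<and> (\<forall>e\<in>E. \<exists>x y. e = {x, y} \<and> diagonal P x y) \<and>
     (\<forall>p q. diagonal P p q \<longrightarrow> (\<exists>x y. {x, y} \<in> E \<and> cross p q x y)) \<and>
     (\<forall>x y. {x, y} \<in> E \<longrightarrow> (\<exists>p\<in>P. \<exists>q\<in>P. cross p q x y \<and>
        (\<forall>a b. {a, b} \<in> E \<longrightarrow> cross p q a b \<longrightarrow> {a, b} = {x, y})))"

definition branched :: "int set set \<Rightarrow> int \<Rightarrow> bool" where
  "branched E x \<longleftrightarrow> (\<exists>y z. y \<noteq> z \<and> {x, y} \<in> E \<and> {x, z} \<in> E)"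

definition short_chords :: "int set \<Rightarrow> int set set \<Rightarrow> bool" where
  "short_chords P E \<longleftrightarrow>
     (\<forall>x y z. branched E x \<longrightarrow> adj P x y \<longrightarrow> adj P x z \<longrightarrow> y \<noteq> z \<longrightarrow> {y, z} \<in> E)"

text \<open>The exception with a single branched vertex \<open>h\<close> is the wheel with hub \<open>h\<close>, one of whose rim edges is a brace.\<close>
definition small_inside :: "int set \<Rightarrow> int set set \<Rightarrow> bool" where
  "small_inside P E \<longleftrightarrow>
     (\<forall>x y. {x, y} \<in> E \<longrightarrow> \<not> branched E x \<longrightarrow> \<not> branched E y \<longrightarrow>
        (\<exists>h. (\<forall>z. branched E z \<longleftrightarrow> z = h) \<and> adj P h x \<and> adj P h y))"

definition crossing_adj :: "int set \<Rightarrow> int set set \<Rightarrow> bool" where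
  "crossing_adj P E \<longleftrightarrow>
     (\<forall>x y s t. {x, s} \<in> E \<longrightarrow> {y, t} \<in> E \<longrightarrow> cross x s y t \<longrightarrow> branched E x \<longrightarrow> branched E y \<longrightarrow>
        \<not> branched E s \<longrightarrow> \<not> branched E t \<longrightarrow> adj P x y)"

text \<open>A set of vertices of a polygon is a block of consecutive vertices iff no pair of its elements
alternates with a pair of elements of the complement. This avoids choosing a starting point.\<close>
definition branched_interval :: "int set \<Rightarrow> int set set \<Rightarrow> bool" where
  "branched_interval P E \<longleftrightarrow>
     (\<forall>a c. \<forall>b\<in>P. \<forall>d\<in>P. branched E a \<longrightarrow> branched E c \<longrightarrow> \<not> branched E b \<longrightarrow> \<not> branched E d \<longrightarrow> \<not> cross a c b d)"

definition interval_shape :: "int set \<Rightarrow> int set set \<Rightarrow> bool" where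
  "interval_shape P E \<longleftrightarrow> (\<exists>x\<in>P. branched E x) \<and> short_chords P E \<and> small_inside P E \<and> crossing_adj P E \<and>
     branched_interval P E"

lemma cross_flip: "cross q p x y = cross p q x y" unfolding cross_def by (smt (z3))
lemma cross_swap: "cross p q y x = cross p q x y" unfolding cross_def by (smt (z3))
lemma cross_dual: "cross x y p q = cross p q x y" unfolding cross_def by (smt (z3))

lemma cross_distinct: "cross p q x y \<Longrightarrow> p \<noteq> q \<and> p \<noteq> x \<and> p \<noteq> y \<and> q \<noteq> x \<and> q \<noteq> y \<and> x \<noteq> y"
  unfolding cross_def by (smt (z3))

lemma cross_step: "cross p q x y \<Longrightarrow> z \<noteq> p \<Longrightarrow> z \<noteq> q \<Longrightarrow> cross p q x z \<or> cross p q z y"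
  unfolding cross_def by (smt (z3))

lemma cross_not2: "cross p q x y \<Longrightarrow> cross p q y z \<Longrightarrow> \<not> cross p q x z"
  unfolding cross_def by (smt (z3))

lemma cross_ex: "p \<noteq> q \<Longrightarrow> p \<noteq> x \<Longrightarrow> p \<noteq> y \<Longrightarrow> q \<noteq> x \<Longrightarrow> q \<noteq> y \<Longrightarrow> x \<noteq> y \<Longrightarrow> cross p q x y \<or> cross p x q y \<or> cross p y q x"
  unfolding cross_def by (smt (z3))

text \<open>Chords with their ends on opposite closed sides of \<open>pq\<close> do not cross. All geometric facts of this kind
concern finitely many points of a linear order, so they are decided by linear arithmetic.\<close>
lemma cross_sides: "\<not> cross p q r u \<Longrightarrow> \<not> cross p q s u \<Longrightarrow> \<not> cross p q x v \<Longrightarrow> \<not> cross p q y v \<Longrightarrow> cross p q u v \<Longrightarrow> \<not> cross r s x y"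
  unfolding cross_def by (smt (z3))

lemma cross_tip: "\<not> cross p q a u \<Longrightarrow> \<not> cross p q b u \<Longrightarrow> cross p q u v \<Longrightarrow> \<not> cross v p a b"
  unfolding cross_def by (smt (z3))

lemma cross_near: "cross r s y b \<Longrightarrow> cross r y z s \<Longrightarrow> cross r s z b"
  unfolding cross_def by (smt (z3))

lemma cross_nearer: "cross r y z s \<Longrightarrow> cross r z w s \<Longrightarrow> cross r y w s"
  unfolding cross_def by (smt (z3))

lemma cross_ear: "\<not> cross r x y a \<Longrightarrow> \<not> cross r y x a \<Longrightarrow> r \<noteq> x \<Longrightarrow> r \<noteq> y \<Longrightarrow> r \<noteq> a \<Longrightarrow> x \<noteq> y \<Longrightarrow> x \<noteq> a \<Longrightarrow> y \<noteq> a \<Longrightarrow> cross x y r a"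
  unfolding cross_def by (smt (z3))

lemma adj_sym: "adj P x y = adj P y x"
  unfolding adj_def by (auto simp: cross_flip)

lemma diagonal_sym: "diagonal P x y = diagonal P y x"
  unfolding diagonal_def by (auto simp: cross_flip)

lemma diagonal_iff: "x \<in> P \<Longrightarrow> y \<in> P \<Longrightarrow> x \<noteq> y \<Longrightarrow> diagonal P x y \<longleftrightarrow> \<not> adj P x y"
  unfolding adj_def diagonal_def by auto

lemma adjD: "adj P x y \<Longrightarrow> a \<in> P \<Longrightarrow> b \<in> P \<Longrightarrow> \<not> cross x y a b"
  unfolding adj_def by auto

lemma adj_in: "adj P x y \<Longrightarrow> x \<in> P \<and> y \<in> P \<and> x \<noteq> y"
  unfolding adj_def by auto

lemma min_crossedD_fin: "min_crossed P E \<Longrightarrow> finite P" unfolding min_crossed_def by auto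

lemma min_crossedD_edge: "min_crossed P E \<Longrightarrow> {x, y} \<in> E \<Longrightarrow> diagonal P x y"
  unfolding min_crossed_def by (metis diagonal_sym doubleton_eq_iff)

lemma min_crossedD_form: "min_crossed P E \<Longrightarrow> e \<in> E \<Longrightarrow> \<exists>x y. e = {x, y} \<and> diagonal P x y"
  unfolding min_crossed_def by blast

lemma min_crossedD_conn: "min_crossed P E \<Longrightarrow> diagonal P p q \<Longrightarrow> \<exists>x y. {x, y} \<in> E \<and> cross p q x y"
  unfolding min_crossed_def by auto

lemma min_crossedD_crit: "min_crossed P E \<Longrightarrow> {x, y} \<in> E \<Longrightarrow> \<exists>p\<in>P. \<exists>q\<in>P. cross p q x y \<and>
        (\<forall>a b. {a, b} \<in> E \<longrightarrow> cross p q a b \<longrightarrow> {a, b} = {x, y})"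
  unfolding min_crossed_def by blast

lemma min_crossed_in: assumes "min_crossed P E" "{x, y} \<in> E" shows "x \<in> P \<and> y \<in> P \<and> x \<noteq> y"
  using min_crossedD_edge[OF assms] unfolding diagonal_def cross_def by auto

lemma min_crossed_edge_not_adj: assumes "min_crossed P E" "{x, y} \<in> E" shows "\<not> adj P x y"
  using min_crossedD_edge[OF assms] unfolding diagonal_def adj_def by auto

lemma min_crossed_fin_E: assumes "min_crossed P E" shows "finite E"
proof -
  have "E \<subseteq> Pow P"
    using min_crossedD_form[OF assms] unfolding diagonal_def by blast
  then show ?thesis using min_crossedD_fin[OF assms] by (meson finite_Pow_iff finite_subset)
qed

lemma min_crossedI:
  assumes "finite P" "\<And>e. e \<in> E \<Longrightarrow> \<exists>x y. e = {x, y} \<and> diagonal P x y"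
    "\<And>p q. diagonal P p q \<Longrightarrow> \<exists>x y. {x, y} \<in> E \<and> cross p q x y"
    "\<And>x y. {x, y} \<in> E \<Longrightarrow> \<exists>p\<in>P. \<exists>q\<in>P. cross p q x y \<and>
        (\<forall>a b. {a, b} \<in> E \<longrightarrow> cross p q a b \<longrightarrow> {a, b} = {x, y})"
  shows "min_crossed P E"
  unfolding min_crossed_def using assms by blast

lemma branched_edge: "branched E x \<Longrightarrow> \<exists>y. {x, y} \<in> E \<and> y \<noteq> w"
  unfolding branched_def by metis

lemma bigI: "{x, y} \<in> E \<Longrightarrow> {x, z} \<in> E \<Longrightarrow> y \<noteq> z \<Longrightarrow> branched E x"
  unfolding branched_def by blast

lemma branched_in: "min_crossed P E \<Longrightarrow> branched E x \<Longrightarrow> x \<in> P"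
  unfolding branched_def using min_crossed_in by blast

lemma interval_shape_ex: "interval_shape P E \<Longrightarrow> \<exists>x\<in>P. branched E x" unfolding interval_shape_def by blast
lemma interval_shape_short: "interval_shape P E \<Longrightarrow> branched E x \<Longrightarrow> adj P x y \<Longrightarrow> adj P x z \<Longrightarrow> y \<noteq> z \<Longrightarrow> {y, z} \<in> E"
  unfolding interval_shape_def short_chords_def by blast
lemma interval_shape_inside: "interval_shape P E \<Longrightarrow> {x, y} \<in> E \<Longrightarrow> \<not> branched E x \<Longrightarrow> \<not> branched E y \<Longrightarrow>
        \<exists>h. (\<forall>z. branched E z \<longleftrightarrow> z = h) \<and> adj P h x \<and> adj P h y"
  unfolding interval_shape_def small_inside_def by blast
lemma interval_shape_crossing: "interval_shape P E \<Longrightarrow> {x, s} \<in> E \<Longrightarrow> {y, t} \<in> E \<Longrightarrow> cross x s y t \<Longrightarrow> branched E x \<Longrightarrow> branched E y \<Longrightarrow>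
        \<not> branched E s \<Longrightarrow> \<not> branched E t \<Longrightarrow> adj P x y"
  unfolding interval_shape_def crossing_adj_def by blast
lemma interval_shape_block: "interval_shape P E \<Longrightarrow> b \<in> P \<Longrightarrow> d \<in> P \<Longrightarrow> branched E a \<Longrightarrow> branched E c \<Longrightarrow> \<not> branched E b \<Longrightarrow> \<not> branched E d \<Longrightarrow> \<not> cross a c b d"
  unfolding interval_shape_def branched_interval_def by blast

lemma adj_nearest:
  assumes fin: "finite P" and r: "r \<in> P" and x: "x \<in> P" "cross r s x b"
  shows "\<exists>y\<in>P. cross r s y b \<and> adj P r y" 
proof -
  let ?S = "{y \<in> P. cross r s y b}"
  let ?f = "\<lambda>y. card {z \<in> P. cross r y z s}"
  have "x \<in> ?S" using x by simp
  from ex_has_least_nat[of "\<lambda>y. y \<in> ?S", OF this, of ?f]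
  obtain y where y: "y \<in> ?S" "\<forall>z. z \<in> ?S \<longrightarrow> ?f y \<le> ?f z"
    by (elim exE conjE)
  have "adj P r y"
  proof (rule ccontr)
    assume "\<not> adj P r y"
    then obtain c d where cd: "c \<in> P" "d \<in> P" "cross r y c d"
      using y r unfolding adj_def by (auto simp: cross_def)
    then obtain z where z: "z \<in> P" "cross r y z s"
      using cross_step[of r y c d s] y(1) cross_distinct cross_swap by blast
    have zS: "z \<in> ?S" using z y(1) cross_near by blast
    have "{z' \<in> P. cross r z z' s} \<subset> {z \<in> P. cross r y z s}"
    proof
      show "{z' \<in> P. cross r z z' s} \<subseteq> {z \<in> P. cross r y z s}"
        using z(2) cross_nearer by blast
      show "{z' \<in> P. cross r z z' s} \<noteq> {z \<in> P. cross r y z s}"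
        using z cross_distinct by blast
    qed
    then have "?f z < ?f y" using fin by (simp add: psubset_card_mono)
    then show False using y(2) zS by (simp add: not_less[symmetric])
  qed
  then show ?thesis using y(1) by auto
qed

lemma two_nbrs:
  assumes fin: "finite P" and c: "diagonal P r s"
  obtains r1 r2 where "adj P r r1" "adj P r r2" "cross r s r1 r2"
proof -
  obtain a b where ab: "a \<in> P" "b \<in> P" "cross r s a b" and r: "r \<in> P"
    using c unfolding diagonal_def by auto
  obtain r1 where r1: "r1 \<in> P" "cross r s r1 b" "adj P r r1"
    using adj_nearest[OF fin r ab(1,3)] by auto
  obtain r2 where r2: "cross r s r2 r1" "adj P r r2"
    using adj_nearest[OF fin r ab(2)] r1 cross_swap by metis
  show ?thesis using that[OF r1(3) r2(2)] r2(1) cross_swap by blast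
qed

lemma adj3: "adj P r x \<Longrightarrow> adj P r y \<Longrightarrow> adj P r z \<Longrightarrow> x = y \<or> x = z \<or> y = z"
  using cross_ex[of r x y z] adj_in[of P r x] adj_in[of P r y] adj_in[of P r z]
    adjD[of P r x y z] adjD[of P r y x z] adjD[of P r z x y] by blast

lemma diagonal_at:
  assumes "finite P" "4 \<le> card P" "r \<in> P"
  shows "\<exists>s. diagonal P r s"
proof -
  have "3 \<le> card (P - {r})" using assms by simp
  then obtain C where "C \<subseteq> P - {r}" "card C = 3"
    by (meson obtain_subset_with_card_n)
  then obtain a b c where abc: "a \<in> P" "b \<in> P" "c \<in> P"
      "r \<noteq> a" "r \<noteq> b" "r \<noteq> c" "a \<noteq> b" "a \<noteq> c" "b \<noteq> c"
    by (auto simp: card_3_iff)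
  from cross_ex[OF this(4,5,6,7,8,9)] abc(1-3) assms(3) show ?thesis unfolding diagonal_def by blast
qed

lemma nbrs_chord:
  assumes "finite P" "4 \<le> card P" "adj P r x" "adj P r y" "x \<noteq> y"
  shows "diagonal P x y" and "\<And>a b. a \<in> P \<Longrightarrow> b \<in> P \<Longrightarrow> cross x y a b \<Longrightarrow> a = r \<or> b = r"
proof -
  have "card {r,x,y} \<le> 3" by (simp add: card_insert_if)
  then have "\<not> P \<subseteq> {r,x,y}" using assms(1,2) card_mono[of "{r,x,y}" P] by fastforce
  then obtain w where w: "w \<in> P" "w \<noteq> r" "w \<noteq> x" "w \<noteq> y" by blast
  have far: "cross x y r a" if "a \<in> P" "a \<notin> {r, x, y}" for a
    using cross_ear[of r x y a] that adjD[OF assms(3), of y a] adjD[OF assms(4), of x a]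
      adj_in[OF assms(3)] adj_in[OF assms(4)] assms(5) by auto
  then have "cross x y r w" using w by simp
  then show "diagonal P x y" using w adj_in[OF assms(3)] adj_in[OF assms(4)] unfolding diagonal_def by blast
  fix a b assume ab: "a \<in> P" "b \<in> P" "cross x y a b"
  then show "a = r \<or> b = r"
    using far[of a] far[of b] cross_distinct[OF ab(3)] cross_not2 cross_swap by blast
qed

lemma min_crossed_deg1:
  assumes "min_crossed P E" "4 \<le> card P" "r \<in> P"
  shows "\<exists>z. {r, z} \<in> E"
proof -
  note fin = min_crossedD_fin[OF assms(1)]
  obtain s where s: "diagonal P r s" using diagonal_at[OF fin assms(2,3)] by auto
  then obtain x y where xy: "adj P r x" "adj P r y" "cross r s x y" using two_nbrs[OF fin] by metis
  then have "x \<noteq> y" unfolding cross_def by auto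
  note nc = nbrs_chord[OF fin assms(2) xy(1,2) this]
  obtain a b where ab: "{a,b} \<in> E" "cross x y a b" using min_crossedD_conn[OF assms(1) nc(1)] by auto
  have "a = r \<or> b = r" using nc(2)[OF _ _ ab(2)] min_crossed_in[OF assms(1) ab(1)] by auto
  then show ?thesis using ab(1) by (metis insert_commute)
qed

section \<open>Splitting along a diagonal that a single brace crosses\<close>

definition closed_side :: "int set \<Rightarrow> int \<Rightarrow> int \<Rightarrow> int \<Rightarrow> int set" where
  "closed_side P p q u = {x \<in> P. \<not> cross p q x u}"

text \<open>The open side of \<open>pq\<close> containing \<open>v\<close> is contracted to the point \<open>v\<close>. Since the cyclic order is inherited
from the integers, no relabelling is needed and crossing keeps its meaning.\<close>
definition contraction :: "int set \<Rightarrow> int \<Rightarrow> int \<Rightarrow> int \<Rightarrow> int \<Rightarrow> int set" where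
  "contraction P p q u v = insert v (closed_side P p q u)"

definition kept_edges :: "int set \<Rightarrow> int set set \<Rightarrow> int \<Rightarrow> int \<Rightarrow> int \<Rightarrow> int \<Rightarrow> int set set" where
  "kept_edges P E p q u v = insert {u, v} {f \<in> E. f \<subseteq> closed_side P p q u}"

text \<open>After the contraction, \<open>v\<close> and \<open>r\<close> span a diagonal for every \<open>r\<close> strictly on the side of \<open>u\<close>, and the
brace \<open>uv\<close> does not cross it. So this is the crossing condition for the new diagonals.\<close>
definition jumped :: "int set \<Rightarrow> int set set \<Rightarrow> int \<Rightarrow> int \<Rightarrow> int \<Rightarrow> int \<Rightarrow> bool" where
  "jumped P E p q u v \<longleftrightarrow> (\<forall>r\<in>P. cross p q r v \<longrightarrow>
     (\<exists>x\<in>closed_side P p q u. \<exists>y\<in>closed_side P p q u. {x, y} \<in> E \<and> cross v r x y))"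

text \<open>The two nontriviality assumptions make both contractions smaller than the polygon.\<close>
locale critical_split =
  fixes P :: "int set" and E :: "int set set" and p q u v :: int
  assumes mc: "min_crossed P E" and p: "p \<in> P" and q: "q \<in> P" and uv: "{u, v} \<in> E" and sep: "cross p q u v"
    and only: "\<And>a b. {a, b} \<in> E \<Longrightarrow> cross p q a b \<Longrightarrow> {a, b} = {u, v}"
    and Anontriv: "\<exists>a\<in>P. cross p q a v \<and> a \<noteq> u"
    and Bnontriv: "\<exists>b\<in>P. cross p q b u \<and> b \<noteq> v"

lemma critical_split_swap: "critical_split P E p q u v \<Longrightarrow> critical_split P E p q v u"
  by (simp add: critical_split_def cross_swap insert_commute)

lemma critical_split_flip: "critical_split P E p q u v \<Longrightarrow> critical_split P E q p u v"
  by (simp add: critical_split_def cross_flip)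

lemma closed_side_flip: "closed_side P q p u = closed_side P p q u"
  unfolding closed_side_def using cross_flip by simp
lemma contraction_flip: "contraction P q p u v = contraction P p q u v"
  unfolding contraction_def using closed_side_flip by simp
lemma kept_edges_flip: "kept_edges P E q p u v = kept_edges P E p q u v"
  unfolding kept_edges_def using closed_side_flip by simp
lemma jumped_flip: "jumped P E q p u v = jumped P E p q u v"
  unfolding jumped_def using cross_flip closed_side_flip by simp

lemma cross_far: "cross x y a b \<Longrightarrow> \<not> cross x y a v \<Longrightarrow> v \<noteq> x \<Longrightarrow> v \<noteq> y \<Longrightarrow> cross x y v b"
  unfolding cross_def by (smt (z3))

lemma cross_doubleton: "{x, y} = {u, v} \<Longrightarrow> cross p q x y = cross p q u v"
  by (auto simp: doubleton_eq_iff cross_swap)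

context critical_split
begin

abbreviation "CA \<equiv> closed_side P p q u"
abbreviation "CB \<equiv> closed_side P p q v"
abbreviation "PA \<equiv> contraction P p q u v"
abbreviation "EA \<equiv> kept_edges P E p q u v"
abbreviation "PB \<equiv> contraction P p q v u"
abbreviation "EB \<equiv> kept_edges P E p q v u"

lemma u: "u \<in> P" and v: "v \<in> P" and pq_ne: "p \<noteq> q" "p \<noteq> u" "p \<noteq> v" "q \<noteq> u" "q \<noteq> v" "u \<noteq> v"
  using min_crossed_in[OF mc uv] cross_distinct[OF sep] by auto

lemma CA_iff: "x \<in> CA \<longleftrightarrow> x \<in> P \<and> (x = p \<or> x = q \<or> cross p q x v)"
  unfolding closed_side_def using sep unfolding cross_def by (smt (z3) mem_Collect_eq)

lemma CB_iff: "x \<in> CB \<longleftrightarrow> x \<in> P \<and> (x = p \<or> x = q \<or> cross p q x u)"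
  unfolding closed_side_def using sep unfolding cross_def by (smt (z3) mem_Collect_eq)

lemma CA_not: "x \<in> CA \<Longrightarrow> \<not> cross p q x u" and CB_not: "x \<in> CB \<Longrightarrow> \<not> cross p q x v"
  unfolding closed_side_def by auto

lemma notCA: "x \<in> P \<Longrightarrow> x \<notin> CA \<Longrightarrow> x \<in> CB \<and> cross p q x u"
  unfolding CB_iff unfolding closed_side_def by blast

lemma pCA: "p \<in> CA" "q \<in> CA" "u \<in> CA" "v \<notin> CA" "p \<in> CB" "q \<in> CB" "v \<in> CB" "u \<notin> CB"
  unfolding CA_iff CB_iff using p q u v sep pq_ne cross_def by auto

lemma CAP: "x \<in> CA \<Longrightarrow> x \<in> P" and CBP: "x \<in> CB \<Longrightarrow> x \<in> P"
  unfolding closed_side_def by auto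

lemma CAB: "x \<in> CA \<Longrightarrow> x \<in> CB \<Longrightarrow> x = p \<or> x = q"
  unfolding CA_iff CB_iff using sep cross_not2 cross_swap by blast

lemma edge_cases: assumes "{x, y} \<in> E"
  shows "{x, y} = {u, v} \<or> (x \<in> CA \<and> y \<in> CA) \<or> (x \<in> CB \<and> y \<in> CB)"
proof -
  have xy: "x \<in> P" "y \<in> P" using min_crossed_in[OF mc assms] by auto
  show ?thesis
  proof (rule ccontr)
    assume a: "\<not> ?thesis"
    then have nc: "\<not> cross p q x y" using only[OF assms] by blast
    from a consider "x \<notin> CA" "y \<notin> CB" | "x \<notin> CB" "y \<notin> CA"
      using notCA xy by blast
    then show False
    proof cases
      case 1
      then have "cross p q x u" "cross p q y v" using xy notCA unfolding closed_side_def by auto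
      then show False using nc sep unfolding cross_def by (smt (z3))
    next
      case 2
      then have "cross p q y u" "cross p q x v" using xy notCA unfolding closed_side_def by auto
      then show False using nc sep unfolding cross_def by (smt (z3))
    qed
  qed
qed

lemma sides: assumes "r \<in> CA" "s \<in> CA" "x \<in> CB" "y \<in> CB" shows "\<not> cross r s x y"
  using cross_sides[OF _ _ _ _ sep] assms CA_not CB_not by blast

text \<open>A crossing of a chord on the side of \<open>u\<close> is insensitive to moving points about the other side.\<close>
lemma to_v: assumes "x \<in> CA" "y \<in> CA" "a \<in> CB" "cross x y a b" shows "cross x y v b"
proof -
  have "\<not> cross x y a v" using sides[OF assms(1,2,3)] pCA by blast
  moreover have "v \<noteq> x" "v \<noteq> y" using assms pCA by auto
  ultimately show ?thesis using cross_far assms(4) by blast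
qed

lemma from_v: assumes "x \<in> CA" "y \<in> CA" "a \<in> CB" "a \<noteq> p" "a \<noteq> q" "cross x y v b" shows "cross x y a b"
proof -
  have "\<not> cross x y v a" using sides[OF assms(1,2) _ assms(3)] pCA by blast
  moreover have "a \<noteq> x" "a \<noteq> y" using assms CAB by blast+
  ultimately show ?thesis using cross_far assms(6) by blast
qed

lemma PAP: "x \<in> PA \<Longrightarrow> x \<in> P"
  unfolding contraction_def using v CAP by auto

lemma PA_iff: "x \<in> PA \<longleftrightarrow> x = v \<or> x \<in> CA"
  unfolding contraction_def by auto

lemma finP: "finite P" using min_crossedD_fin[OF mc] .

lemma finCA: "finite CA" "finite CB" unfolding closed_side_def using finP by auto

lemma EA_iff: "{x, y} \<in> EA \<longleftrightarrow> {x, y} = {u, v} \<or> ({x, y} \<in> E \<and> x \<in> CA \<and> y \<in> CA)"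
  unfolding kept_edges_def by auto

lemma EA_E: "f \<in> EA \<Longrightarrow> f \<in> E" unfolding kept_edges_def using uv by auto

lemma v_edge: "{v, x} \<in> EA \<longleftrightarrow> x = u"
  unfolding EA_iff using pCA pq_ne by (auto simp: doubleton_eq_iff)

lemma diagonal_PA: assumes "x \<in> CA" "y \<in> CA" "diagonal P x y" shows "diagonal PA x y"
proof -
  obtain a b where ab: "a \<in> P" "b \<in> P" "cross x y a b" using assms(3) unfolding diagonal_def by auto
  have a': "\<exists>a\<in>PA. cross x y a b"
  proof (cases "a \<in> CA")
    case True then show ?thesis using ab PA_iff by blast
  next
    case False
    then show ?thesis using to_v[OF assms(1,2) _ ab(3)] notCA[OF ab(1)] PA_iff by blast
  qed
  from a' obtain a where a: "a \<in> PA" "cross x y a b" by auto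
  have b': "\<exists>b\<in>PA. cross x y a b"
  proof (cases "b \<in> CA")
    case True then show ?thesis using a PA_iff by blast
  next
    case False
    then have "cross x y v a" using to_v[OF assms(1,2), of b a] a(2) notCA[OF ab(2)] cross_swap by blast
    then show ?thesis using a PA_iff cross_swap by blast
  qed
  then show ?thesis using a(1) assms PA_iff unfolding diagonal_def by blast
qed

lemma diagonal_P: assumes "diagonal PA x y" shows "diagonal P x y"
  using assms PAP unfolding diagonal_def by blast

lemma adj_PA: assumes "x \<in> CA" "y \<in> CA" shows "adj PA x y \<longleftrightarrow> adj P x y"
proof (cases "x = y")
  case True then show ?thesis unfolding adj_def by auto
next
  case False
  then show ?thesis using diagonal_iff[of x P y] diagonal_iff[of x PA y] diagonal_PA[OF assms] diagonal_P[of x y]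
    assms CAP PA_iff by blast
qed

lemma adj_v: "adj PA v x \<longleftrightarrow> x = p \<or> x = q"
proof
  assume a: "adj PA v x"
  show "x = p \<or> x = q"
  proof (rule ccontr)
    assume n: "\<not> ?thesis"
    then have "cross p q x v" using adj_in[OF a] PA_iff CA_iff by auto
    then show False using adjD[OF a, of p q] PA_iff pCA cross_dual cross_flip by blast
  qed
next
  have "adj PA v p" 
    unfolding adj_def using PA_iff pCA pq_ne CA_not sep cross_tip[of p q _ u _ v]
    by (metis cross_distinct)
  moreover have "adj PA v q"
    unfolding adj_def using PA_iff pCA pq_ne CA_not sep cross_tip[of q p _ u _ v]
    by (metis cross_distinct cross_flip)
  ultimately show "x = p \<or> x = q \<Longrightarrow> adj PA v x" by auto
qed

lemma cross_v: assumes "r \<in> CA" "x \<in> CA" "y \<in> CA" "s \<in> CB" "cross r s x y" shows "cross r v x y"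
  using to_v[OF assms(2,3,4), of r] assms(5) cross_dual cross_swap cross_flip by metis

lemma cross_v': assumes "r \<in> CA" "x \<in> CA" "y \<in> CA" "s \<in> CB" "s \<noteq> p" "s \<noteq> q" "cross r v x y" shows "cross r s x y"
  using from_v[OF assms(2,3,4,5,6), of r] assms(7) cross_dual cross_swap cross_flip by metis

lemma kept_edges_conn:
  assumes F: "EA \<subseteq> F" 
    and j: "\<And>r. r \<in> CA \<Longrightarrow> r \<noteq> p \<Longrightarrow> r \<noteq> q \<Longrightarrow> \<exists>x y. {x, y} \<in> F \<and> cross v r x y"
    and c: "diagonal PA r s"
  shows "\<exists>x y. {x, y} \<in> F \<and> cross r s x y"
proof -
  have rs: "r \<in> PA" "s \<in> PA" "r \<noteq> s" using c unfolding diagonal_def by (auto simp: cross_def)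
  consider "r \<in> CA" "s \<in> CA" | "r = v" "s \<in> CA" | "s = v" "r \<in> CA"
    using rs PA_iff by auto
  then show ?thesis
  proof cases
    case 1
    obtain x y where xy: "{x, y} \<in> E" "cross r s x y" using min_crossedD_conn[OF mc diagonal_P[OF c]] by auto
    then have "{x, y} \<in> EA" using edge_cases[OF xy(1)] sides[OF 1] EA_iff by blast
    then show ?thesis using xy F by blast
  next
    case 2
    then have "s \<noteq> p" "s \<noteq> q" using c adj_v[of s] diagonal_iff[of v PA s] rs by auto
    then show ?thesis using j[OF 2(2)] 2(1) by auto
  next
    case 3
    then have "r \<noteq> p" "r \<noteq> q" using c adj_v[of r] diagonal_iff[of v PA r] rs diagonal_sym by auto
    then obtain x y where "{x, y} \<in> F" "cross v r x y" using j[OF 3(2)] by auto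
    then show ?thesis using 3 cross_flip by blast
  qed
qed

lemma kept_edges_form: assumes "e \<in> EA" shows "\<exists>x y. e = {x, y} \<and> diagonal PA x y"
proof (cases "e = {u, v}")
  case True
  have "diagonal PA u v" unfolding diagonal_def using PA_iff pCA sep cross_dual by blast
  then show ?thesis using True by blast
next
  case False
  then have e: "e \<in> E" "e \<subseteq> CA" using assms unfolding kept_edges_def by auto
  obtain x y where "e = {x, y}" "diagonal P x y" using min_crossedD_form[OF mc e(1)] by auto
  then show ?thesis using e diagonal_PA by blast
qed

text \<open>In the contraction the brace \<open>uv\<close> is still indispensable because of \<open>pq\<close>; the diagonal \<open>pq\<close>, if added to the
braces, does not cross itself.\<close>
lemma kept_edges_crit_uv: 
  assumes F: "F \<subseteq> insert {p, q} EA"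
  shows "\<exists>p'\<in>PA. \<exists>q'\<in>PA. cross p' q' u v \<and>
   (\<forall>a b. {a, b} \<in> F \<longrightarrow> cross p' q' a b \<longrightarrow> {a, b} = {u, v})"
proof -
  have "{a, b} = {u, v}" if "{a, b} \<in> F" "cross p q a b" for a b
  proof -
    have "{a, b} \<in> E"
      using that F EA_E cross_distinct[OF that(2)] by (auto simp: doubleton_eq_iff)
    then show ?thesis using only that(2) by blast
  qed
  moreover have "p \<in> PA" "q \<in> PA" using pCA PA_iff by auto
  ultimately show ?thesis using sep by blast
qed

text \<open>The diagonal that makes a brace on the side of \<open>u\<close> indispensable has at most one end beyond
\<open>pq\<close>; in the contraction that end is replaced by \<open>v\<close>.\<close>
lemma crit_move:
  assumes "{x, y} \<in> E" "x \<in> CA" "y \<in> CA"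
  obtains r s where "r \<in> CA" "s \<in> CA" "cross r s x y" "\<And>a b. {a, b} \<in> E \<Longrightarrow> cross r s a b \<Longrightarrow> {a, b} = {x, y}"
  | r s where "r \<in> CA" "s \<in> CB" "r \<notin> CB" "s \<notin> CA" "cross r s x y" "\<And>a b. {a, b} \<in> E \<Longrightarrow> cross r s a b \<Longrightarrow> {a, b} = {x, y}"
proof -
  obtain r s where rs: "r \<in> P" "s \<in> P" "cross r s x y" "\<And>a b. {a, b} \<in> E \<Longrightarrow> cross r s a b \<Longrightarrow> {a, b} = {x, y}"
    using min_crossedD_crit[OF mc assms(1)] by blast
  have n: "\<not> (r \<in> CB \<and> s \<in> CB)" using sides[OF assms(2,3), of r s] rs(3) cross_dual by blast
  consider "r \<in> CA" "s \<in> CA" | "r \<in> CA" "s \<notin> CA" | "s \<in> CA" "r \<notin> CA"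
    using n notCA rs by blast
  then show thesis
  proof cases
    case 1 then show thesis using that(1) rs by blast
  next
    case 2 then show thesis using that(2)[of r s] rs n notCA by blast
  next
    case 3
    have "cross s r x y" using rs(3) cross_flip by blast
    moreover have "\<And>a b. {a, b} \<in> E \<Longrightarrow> cross s r a b \<Longrightarrow> {a, b} = {x, y}" using rs(4) cross_flip by blast
    ultimately show thesis using that(2)[of s r] rs(1,2) 3 n notCA by blast
  qed
qed

lemma min_crossed_part:
  assumes j: "jumped P E p q u v"
  shows "min_crossed PA EA"
proof (rule min_crossedI)
  show "finite PA" unfolding contraction_def using finCA by auto
  show "\<And>e. e \<in> EA \<Longrightarrow> \<exists>x y. e = {x, y} \<and> diagonal PA x y" by (rule kept_edges_form)
  have jj: "\<exists>x y. {x, y} \<in> EA \<and> cross v r x y" if "r \<in> CA" "r \<noteq> p" "r \<noteq> q" for r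
    using j that unfolding jumped_def EA_iff by (metis CA_iff)
  show "\<And>r s. diagonal PA r s \<Longrightarrow> \<exists>x y. {x, y} \<in> EA \<and> cross r s x y"
    using kept_edges_conn[of EA] jj by blast
  fix x y assume xy: "{x, y} \<in> EA"
  show "\<exists>p'\<in>PA. \<exists>q'\<in>PA. cross p' q' x y \<and> (\<forall>a b. {a, b} \<in> EA \<longrightarrow> cross p' q' a b \<longrightarrow> {a, b} = {x, y})"
  proof (cases "{x, y} = {u, v}")
    case True
    show ?thesis unfolding True cross_doubleton[OF True] by (rule kept_edges_crit_uv) blast
  next
    case False
    then have e: "{x, y} \<in> E" "x \<in> CA" "y \<in> CA" using xy EA_iff by auto
    from e show ?thesis
    proof (cases rule: crit_move)
      case (1 r s)
      then show ?thesis using EA_E PA_iff by blast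
    next
      case (2 r s)
      have "cross r v x y" using cross_v[OF 2(1) e(2,3) 2(2,5)] .
      moreover have "{a, b} = {x, y}" if "{a, b} \<in> EA" "cross r v a b" for a b
      proof -
        have "{a, b} \<noteq> {u, v}" using cross_distinct[OF that(2)] by (auto simp: doubleton_eq_iff)
        then have ab: "{a, b} \<in> E" "a \<in> CA" "b \<in> CA" using that EA_iff by auto
        have "cross r s a b" using cross_v'[OF 2(1) ab(2,3) 2(2) _ _ that(2)] 2(4) pCA by blast
        then show ?thesis using 2(6)[OF ab(1)] by blast
      qed
      ultimately show ?thesis using 2 PA_iff by blast
    qed
  qed
qed

text \<open>If some \<open>r\<close> is not jumped, the brace \<open>pq\<close> is added: it crosses every diagonal at \<open>v\<close> and is the only
one to cross \<open>vr\<close>. The other braces stay indispensable, since a diagonal that passes from one side to the other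
is also crossed by a jump on the opposite side and cannot witness the necessity of a brace here.\<close>
lemma min_crossed_part':
  assumes j: "\<not> jumped P E p q u v" and j': "jumped P E p q v u" and n: "{p, q} \<notin> E"
  shows "min_crossed PA (insert {p, q} EA)"
proof (rule min_crossedI)
  let ?F = "insert {p, q} EA"
  show "finite PA" unfolding contraction_def using finCA by auto
  have "diagonal PA p q" unfolding diagonal_def using PA_iff pCA sep by blast
  then show "\<And>e. e \<in> ?F \<Longrightarrow> \<exists>x y. e = {x, y} \<and> diagonal PA x y" using kept_edges_form by blast
  have pqr: "cross v r p q" if "r \<in> CA" "r \<noteq> p" "r \<noteq> q" for r
    using that CA_iff cross_dual cross_flip by metis
  show "\<And>r s. diagonal PA r s \<Longrightarrow> \<exists>x y. {x, y} \<in> ?F \<and> cross r s x y"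
    using kept_edges_conn[of ?F] pqr by blast
  fix x y assume xy: "{x, y} \<in> ?F"
  show "\<exists>p'\<in>PA. \<exists>q'\<in>PA. cross p' q' x y \<and> (\<forall>a b. {a, b} \<in> ?F \<longrightarrow> cross p' q' a b \<longrightarrow> {a, b} = {x, y})"
  proof -
    consider "{x, y} = {u, v}" | "{x, y} = {p, q}" | "{x, y} \<in> E" "x \<in> CA" "y \<in> CA" 
      using xy EA_iff by auto
    then show ?thesis
    proof cases
      case 1
      show ?thesis unfolding 1 cross_doubleton[OF 1] by (rule kept_edges_crit_uv) blast
    next
      case 2
      obtain r where r: "r \<in> P" "cross p q r v" and
        nj: "\<And>x y. x \<in> CA \<Longrightarrow> y \<in> CA \<Longrightarrow> {x, y} \<in> E \<Longrightarrow> \<not> cross v r x y"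
        using j unfolding jumped_def by blast
      have "{a, b} = {x, y}" if "{a, b} \<in> ?F" "cross v r a b" for a b
      proof -
        have "{a, b} \<noteq> {u, v}" using cross_distinct[OF that(2)] by (auto simp: doubleton_eq_iff)
        moreover have "\<not> ({a, b} \<in> E \<and> a \<in> CA \<and> b \<in> CA)" using nj that(2) by blast
        ultimately have "{a, b} \<notin> EA" by (simp only: EA_iff) simp
        then show ?thesis using that(1) 2 by (metis insertE)
      qed
      moreover have "cross v r x y"
        using pqr[of r] r CA_iff cross_distinct[OF r(2)] unfolding cross_doubleton[OF 2] by blast
      moreover have "r \<in> PA" "v \<in> PA" using r PA_iff CA_iff by blast+
      ultimately show ?thesis by blast
    next
      case 3
      from 3 show ?thesis
      proof (cases rule: crit_move)
        case (1 r s)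
        have "\<not> cross r s p q" using sides[OF 1(1,2)] pCA by blast
        then have "\<not> cross r s a b" if "{a, b} = {p, q}" for a b
          using that cross_swap by (auto simp: doubleton_eq_iff)
        then show ?thesis using 1 EA_E PA_iff by blast
      next
        case (2 r s)
        have "cross p q s u" using notCA 2 CBP by blast
        then obtain a b where ab: "a \<in> CB" "b \<in> CB" "{a, b} \<in> E" "cross u s a b"
          using j' 2 CBP unfolding jumped_def by blast
        interpret sw: critical_split P E p q v u using critical_split_swap critical_split_axioms .
        have "cross r s a b" 
          using sw.cross_v'[OF 2(2) ab(1,2) 2(1)] ab(4) 2(3) pCA cross_flip by metis
        then have "{a, b} = {x, y}" using 2(6) ab by blast
        then have "{a, b} \<subseteq> {p, q}" using ab 3 CAB by (auto simp: doubleton_eq_iff)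
        then have "{a, b} = {p, q}" using min_crossed_in[OF mc ab(3)] by auto
        then show ?thesis using n ab by simp
      qed
    qed
  qed
qed

lemma pq_jumped: assumes "{p, q} \<in> E" shows "jumped P E p q u v"
  unfolding jumped_def
proof (intro ballI impI)
  fix r assume "r \<in> P" "cross p q r v"
  then have "cross v r p q" using cross_dual cross_flip by metis
  then show "\<exists>x\<in>CA. \<exists>y\<in>CA. {x, y} \<in> E \<and> cross v r x y" using assms pCA by blast
qed

text \<open>If \<open>r\<close> is not jumped, then \<open>rp\<close> is crossed by \<open>uv\<close> only, and it cuts off a smaller set.\<close>
lemma min_aux:
  assumes r: "r \<in> P" "cross p q r v" "cross v r u q \<or> u = r" and w: "w \<in> P" "cross r p w v"
    and nj: "\<And>x y. x \<in> CA \<Longrightarrow> y \<in> CA \<Longrightarrow> {x, y} \<in> E \<Longrightarrow> \<not> cross v r x y"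
    and min: "\<And>p' q'. p' \<in> P \<Longrightarrow> q' \<in> P \<Longrightarrow> cross p' q' u v \<Longrightarrow>
      (\<forall>a b. {a, b} \<in> E \<longrightarrow> cross p' q' a b \<longrightarrow> {a, b} = {u, v}) \<Longrightarrow>
      card {x \<in> P. cross p q x v} \<le> card {x \<in> P. cross p' q' x v}"
  shows False
proof -
  have rCA: "r \<in> CA" using r CA_iff by blast
  have "diagonal P r p" using r p w v unfolding diagonal_def by blast
  then obtain x y where xy: "{x, y} \<in> E" "cross r p x y" using min_crossedD_conn[OF mc] by blast
  have uvonly: "{a, b} = {u, v}" if ab: "{a, b} \<in> E" "cross r p a b" for a b
  proof (rule ccontr)
    assume n: "{a, b} \<noteq> {u, v}"
    have "\<not> (a \<in> CB \<and> b \<in> CB)" using sides[OF rCA pCA(1)] ab(2) by blast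
    then have abA: "a \<in> CA" "b \<in> CA" using edge_cases[OF ab(1)] n by auto
    have "\<not> cross p q a u" "\<not> cross p q b u" "\<not> cross v r a b" using CA_not abA nj ab(1) by auto
    then show False using ab(2) r(2) sep unfolding cross_def by (smt (z3))
  qed
  have e: "{x, y} = {u, v}" using uvonly xy by blast
  then have cuv: "cross r p u v" using xy(2) cross_swap by (auto simp: doubleton_eq_iff)
  then have "card {x \<in> P. cross p q x v} \<le> card {x \<in> P. cross r p x v}"
    using min[of r p] r(1) p uvonly by blast
  moreover have sub: "{x \<in> P. cross r p x v} \<subset> {x \<in> P. cross p q x v}"
  proof -
    have "cross p q a v" if "cross r p a v" for a
      using that r(2) sep cuv unfolding cross_def by (smt (z3))
    moreover have "\<not> cross r p r v" unfolding cross_def by simp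
    ultimately show ?thesis using r by blast
  qed
  have "card {x \<in> P. cross r p x v} < card {x \<in> P. cross p q x v}"
    by (rule psubset_card_mono[OF _ sub]) (simp add: finP)
  ultimately show False by simp
qed

end

lemma (in critical_split) min_jumped:
  assumes min: "\<And>p' q'. p' \<in> P \<Longrightarrow> q' \<in> P \<Longrightarrow> cross p' q' u v \<Longrightarrow>
      (\<forall>a b. {a, b} \<in> E \<longrightarrow> cross p' q' a b \<longrightarrow> {a, b} = {u, v}) \<Longrightarrow>
      card {x \<in> P. cross p q x v} \<le> card {x \<in> P. cross p' q' x v}"
  shows "jumped P E p q u v"
proof (rule ccontr)
  assume "\<not> ?thesis"
  then obtain r where r: "r \<in> P" "cross p q r v" and
    nj: "\<And>x y. x \<in> CA \<Longrightarrow> y \<in> CA \<Longrightarrow> {x, y} \<in> E \<Longrightarrow> \<not> cross v r x y"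
    unfolding jumped_def by blast
  interpret fl: critical_split P E q p u v using critical_split_flip critical_split_axioms .
  have vr: "cross v r p q" using r(2) cross_dual cross_flip by metis
  have nj': "\<And>x y. x \<in> closed_side P q p u \<Longrightarrow> y \<in> closed_side P q p u \<Longrightarrow> {x, y} \<in> E \<Longrightarrow> \<not> cross v r x y"
    using nj closed_side_flip by blast
  have min': "\<And>p' q'. p' \<in> P \<Longrightarrow> q' \<in> P \<Longrightarrow> cross p' q' u v \<Longrightarrow>
      (\<forall>a b. {a, b} \<in> E \<longrightarrow> cross p' q' a b \<longrightarrow> {a, b} = {u, v}) \<Longrightarrow>
      card {x \<in> P. cross q p x v} \<le> card {x \<in> P. cross p' q' x v}"
    using min cross_flip by simp
  have r': "cross q p r v" using r cross_flip by blast
  have "\<exists>w. w \<in> P \<and> cross p q w v \<and> w \<noteq> r \<and> (u \<noteq> r \<longrightarrow> w = u)"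
  proof (cases "u = r")
    case True then show ?thesis using Anontriv by blast
  next
    case False then show ?thesis using u sep by blast
  qed
  then obtain w where w: "w \<in> P" "cross p q w v" "w \<noteq> r" "u \<noteq> r \<longrightarrow> w = u" by blast
  have wv: "w \<noteq> v" using w(2) cross_def by blast
  have "cross v r p w \<or> cross v r w q" using cross_step[OF vr, of w] w(3) wv by blast
  then consider "cross v r w q" | "cross v r w p" using cross_swap by blast
  then show False
  proof cases
    case 1
    have "cross r p w v" using 1 w(2) r(2) unfolding cross_def by (smt (z3))
    then show False using min_aux[OF r _ w(1) _ nj min] 1 w(4) by blast
  next
    case 2
    have "cross r q w v" using 2 w(2) r(2) unfolding cross_def by (smt (z3))
    then show False using fl.min_aux[OF r(1) r' _ w(1) _ nj' min'] 2 w(4) by blast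
  qed
qed

section \<open>The structure forced by equality, and how it is glued\<close>

lemma cross_interval: "cross r s q w \<Longrightarrow> cross r s u w \<Longrightarrow> q \<noteq> u \<Longrightarrow> \<not> cross r q u s \<Longrightarrow> cross r u q s"
  unfolding cross_def by (smt (z3))

lemma cross_tip2: "cross r s q w \<Longrightarrow> cross r s u w \<Longrightarrow> q \<noteq> u \<Longrightarrow> cross r q u s \<or> cross s q u r"
  unfolding cross_def by (smt (z3))

lemma critical_nbr_aux:
  assumes mc: "min_crossed P E" and U: "interval_shape P E" and n4: "4 \<le> card P"
    and t: "t \<in> P" "t' \<in> P" "branched E t" "cross t t' q w" "q \<in> P" "w \<in> P"
    and only: "\<And>a b. {a, b} \<in> E \<Longrightarrow> cross t t' a b \<Longrightarrow> {a, b} = {q, w}"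
  shows "adj P t q \<and> adj P t w"
proof -
  have "diagonal P t t'" using t unfolding diagonal_def by blast
  then obtain t1 t2 where tt: "adj P t t1" "adj P t t2" "cross t t' t1 t2"
    using two_nbrs[OF min_crossedD_fin[OF mc]] by metis
  then have "{t1, t2} \<in> E" using interval_shape_short[OF U t(3)] cross_distinct by blast
  then have "{t1, t2} = {q, w}" using only tt(3) by blast
  then show ?thesis using tt by (auto simp: doubleton_eq_iff)
qed

text \<open>Here \<open>q\<close> and \<open>v\<close> are adjacent vertices with one brace each, and the brace \<open>qw\<close> is the only one to cross a
diagonal \<open>rs\<close> that avoids \<open>v\<close>. If an end of \<open>rs\<close> is branched, the brace between its neighbours crosses \<open>rs\<close>
and must be \<open>qw\<close>. Such an end exists, since otherwise \<open>r\<close>, \<open>s\<close> would separate the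
branched vertices \<open>u\<close> and \<open>w\<close>; the interval structure then identifies it with \<open>u\<close>.\<close>
lemma critical_at_small_nbr:
  assumes mc: "min_crossed P E" and U: "interval_shape P E" and n4: "4 \<le> card P"
    and v: "\<not> branched E v" "adj P v q" "{v, u} \<in> E" and q: "\<not> branched E q" "{q, w} \<in> E"
    and rs: "r \<in> P" "s \<in> P" "r \<noteq> v" "s \<noteq> v" "cross r s q w"
    and only: "\<And>a b. {a, b} \<in> E \<Longrightarrow> cross r s a b \<Longrightarrow> {a, b} = {q, w}"
  shows "adj P q u \<and> adj P u w \<and> branched E u"
proof -
  have P: "v \<in> P" "u \<in> P" "q \<in> P" "w \<in> P" "v \<noteq> q" "v \<noteq> u" "q \<noteq> w"
    using min_crossed_in[OF mc v(3)] min_crossed_in[OF mc q(2)] adj_in[OF v(2)] by auto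
  have nqv: "{q, v} \<notin> E" "{v, q} \<notin> E" using min_crossed_edge_not_adj[OF mc] v(2) adj_sym by blast+
  have "w \<noteq> v" using nqv q(2) by auto
  have qv: "\<not> cross r s q v" using adjD[OF v(2) rs(1,2)] cross_dual cross_swap by blast
  have vw: "cross r s v w" using cross_step[OF rs(5), of v] rs(3,4) qv by auto
  have bu: "branched E u"
  proof (rule ccontr)
    assume nu: "\<not> branched E u"
    obtain h where h: "\<And>z. branched E z \<longleftrightarrow> z = h" "adj P h v" "adj P h u"
      using interval_shape_inside[OF U v(3) v(1) nu] by blast
    show False
    proof (cases "w = h")
      case True
      then show False using adjD[OF h(2) rs(1,2)] vw cross_dual cross_swap by blast
    next
      case False
      then have nw: "\<not> branched E w" using h by blast
      obtain h' where h': "\<And>z. branched E z \<longleftrightarrow> z = h'" "adj P h' q" "adj P h' w"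
        using interval_shape_inside[OF U q(2) q(1) nw] by blast
      have "h' = h" using h(1) h'(1) by blast
      then have "q = u" using adj3[OF h(2,3), of q] adj3[OF h(2,3), of w] h' P \<open>w \<noteq> v\<close> v(3) nqv by auto
      then show False using v(3) nqv by auto
    qed
  qed
  show ?thesis
  proof (cases "branched E w")
    case False
    obtain h where h: "\<And>z. branched E z \<longleftrightarrow> z = h" "adj P h q" "adj P h w"
      using interval_shape_inside[OF U q(2) q(1) False] by blast
    then have "h = u" using bu h(1)[of u] by simp
    then show ?thesis using h adj_sym bu by blast
  next
    case bw: True
    have rn: "adj P r q \<and> adj P r w" if "branched E r"
      using critical_nbr_aux[OF mc U n4 rs(1,2) that rs(5) P(3,4) only] by blast
    have sn: "adj P s q \<and> adj P s w" if "branched E s"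
      using critical_nbr_aux[OF mc U n4 rs(2,1) that _ P(3,4)] only rs(5) cross_flip by blast
    have vu: "\<not> cross r s v u"
    proof
      assume "cross r s v u"
      then have "{v, u} = {q, w}" using only v(3) by blast
      then show False using P \<open>w \<noteq> v\<close> by (auto simp: doubleton_eq_iff)
    qed
    consider "u = r" | "u = s" | "u \<noteq> r" "u \<noteq> s" by blast
    then show ?thesis
    proof cases
      case 1 then show ?thesis using rn bu adj_sym by blast
    next
      case 2 then show ?thesis using sn bu adj_sym by blast
    next
      case 3
      have uw: "cross r s u w" using cross_step[OF vw, of u] 3 vu by blast
      have uq: "q \<noteq> u" using bu q(1) by blast
      have "False"
      proof (cases "branched E r")
        case True
        note rq = rn[OF True]
        show False
        proof (cases "branched E s")
          case s: True
          show False using cross_tip2[OF rs(5) uw uq] adjD[of P r q u s] adjD[of P s q u r] rq sn[OF s] P rs by blast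
        next
          case False
          have "cross r u q s" using cross_interval[OF rs(5) uw uq] adjD[of P r q u s] rq P rs by blast
          then show False using interval_shape_block[OF U P(3) rs(2) True bu q(1) False] by blast
        qed
      next
        case nr: False
        show False
        proof (cases "branched E s")
          case True
          note sq = sn[OF True]
          have "cross s u q r" using cross_interval[of s r q w u] rs(5) uw uq cross_flip adjD[of P s q u r] sq P rs by blast
          then show False using interval_shape_block[OF U P(3) rs(1) True bu q(1) nr] by blast
        next
          case False
          show False using interval_shape_block[OF U rs(1,2) bu bw nr False] uw cross_dual by blast
        qed
      qed
      then show ?thesis ..
    qed
  qed
qed

text \<open>What each side contributes to the interval structure of the whole polygon when \<open>p\<close> is the vertex
at which two intervals are joined. Being branched refers to the whole polygon,
except that the contracted vertex \<open>v\<close> counts as not branched.\<close>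
definition half :: "int set \<Rightarrow> int set set \<Rightarrow> int \<Rightarrow> int \<Rightarrow> int \<Rightarrow> int \<Rightarrow> bool" where
  "half P E p q u v \<longleftrightarrow> adj P p u \<and>
    (\<forall>x\<in>closed_side P p q u. x \<noteq> p \<longrightarrow> x \<noteq> q \<longrightarrow> branched E x \<longrightarrow>
       (\<forall>y z. adj P x y \<longrightarrow> adj P x z \<longrightarrow> y \<noteq> z \<longrightarrow> {y, z} \<in> E)) \<and>
    (\<forall>x\<in>closed_side P p q u. \<forall>y\<in>closed_side P p q u. {x, y} \<in> E \<longrightarrow> branched E x \<or> branched E y) \<and>
    (\<forall>x\<in>closed_side P p q u. \<forall>y\<in>closed_side P p q u. \<forall>s\<in>closed_side P p q u. \<forall>t\<in>closed_side P p q u.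
       {x, s} \<in> E \<longrightarrow> {y, t} \<in> E \<longrightarrow> cross x s y t \<longrightarrow> branched E x \<longrightarrow> branched E y \<longrightarrow>
        \<not> branched E s \<longrightarrow> \<not> branched E t \<longrightarrow> adj P x y) \<and>
    (\<forall>a\<in>closed_side P p q u. \<forall>c\<in>closed_side P p q u. \<forall>b\<in>contraction P p q u v. \<forall>d\<in>contraction P p q u v.
       branched E a \<longrightarrow> branched E c \<longrightarrow> \<not> branched E b \<or> b = v \<longrightarrow> \<not> branched E d \<or> d = v \<longrightarrow> \<not> cross a c b d)"

lemma cross_merge: "cross p q a c \<Longrightarrow> cross a c b q \<Longrightarrow> cross p q b c \<Longrightarrow> cross a p b q"
  unfolding cross_def by (smt (z3))

context critical_split
begin

lemma half_adj: "half P E p q u v \<Longrightarrow> adj P p u" unfolding half_def by (elim conjE)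
lemma half_short: "half P E p q u v \<Longrightarrow> x \<in> CA \<Longrightarrow> x \<noteq> p \<Longrightarrow> x \<noteq> q \<Longrightarrow> branched E x \<Longrightarrow>
   adj P x y \<Longrightarrow> adj P x z \<Longrightarrow> y \<noteq> z \<Longrightarrow> {y, z} \<in> E" unfolding half_def by (elim conjE) metis
lemma half_inside: "half P E p q u v \<Longrightarrow> x \<in> CA \<Longrightarrow> y \<in> CA \<Longrightarrow> {x, y} \<in> E \<Longrightarrow> branched E x \<or> branched E y"
  unfolding half_def by (elim conjE) metis
lemma half_crossing: "half P E p q u v \<Longrightarrow> x \<in> CA \<Longrightarrow> y \<in> CA \<Longrightarrow> s \<in> CA \<Longrightarrow> t \<in> CA \<Longrightarrow>
   {x, s} \<in> E \<Longrightarrow> {y, t} \<in> E \<Longrightarrow> cross x s y t \<Longrightarrow> branched E x \<Longrightarrow> branched E y \<Longrightarrow> \<not> branched E s \<Longrightarrow> \<not> branched E t \<Longrightarrow> adj P x y"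
  unfolding half_def by (elim conjE) metis
lemma half_block: "half P E p q u v \<Longrightarrow> a \<in> CA \<Longrightarrow> c \<in> CA \<Longrightarrow> b \<in> PA \<Longrightarrow> d \<in> PA \<Longrightarrow>
   branched E a \<Longrightarrow> branched E c \<Longrightarrow> \<not> branched E b \<or> b = v \<Longrightarrow> \<not> branched E d \<or> d = v \<Longrightarrow> \<not> cross a c b d"
  unfolding half_def by (elim conjE) metis

lemma card_parts: "card PA + card PB = card P + 4"
proof -
  have un: "CA \<union> CB = P" using notCA CAP CBP by blast
  have int: "CA \<inter> CB = {p, q}" using CAB pCA by blast
  have "card CA + card CB = card P + 2"
    using card_Un_Int[OF finCA] un int pq_ne by simp
  then show ?thesis unfolding contraction_def using finCA pCA by simp
qed

lemma card_PA: "5 \<le> card PA" 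
proof -
  obtain a where a: "a \<in> P" "cross p q a v" "a \<noteq> u" using Anontriv by auto
  then have "a \<in> CA" using CA_iff by blast
  have "{p, q, u, v, a} \<subseteq> PA" using pCA PA_iff \<open>a \<in> CA\<close> by auto
  moreover have "card {p, q, u, v, a} = 5" using pq_ne a cross_distinct[OF a(2)] by auto
  moreover have "finite PA" unfolding contraction_def using finCA by auto
  ultimately show ?thesis by (metis card_mono)
qed

lemma card_eparts: "card EA + card EB = card E + (if {p, q} \<in> E then 2 else 1)"
proof -
  have fin: "finite E" using min_crossed_fin_E[OF mc] .
  have sub: "EA \<subseteq> E" "EB \<subseteq> E" unfolding kept_edges_def using uv by (auto simp: insert_commute)
  have un: "EA \<union> EB = E"
  proof
    show "EA \<union> EB \<subseteq> E" using sub by blast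
    show "E \<subseteq> EA \<union> EB"
    proof
      fix f assume f: "f \<in> E"
      then obtain x y where xy: "f = {x, y}" using min_crossedD_form[OF mc] by blast
      show "f \<in> EA \<union> EB" using edge_cases[of x y] f unfolding xy kept_edges_def by auto
    qed
  qed
  have int: "EA \<inter> EB = {{u, v}} \<union> ({{p, q}} \<inter> E)"
  proof -
    have "f = {p, q}" if f: "f \<in> E" "f \<subseteq> CA" "f \<subseteq> CB" for f
    proof -
      obtain x y where xy: "f = {x, y}" using min_crossedD_form[OF mc f(1)] by blast
      have "x \<noteq> y" using min_crossed_in[OF mc] f(1) xy by blast
      then show ?thesis using f(2,3) CAB[of x] CAB[of y] unfolding xy by auto
    qed
    moreover have "{p, q} \<subseteq> CA" "{p, q} \<subseteq> CB" using pCA by auto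
    ultimately have "{f \<in> E. f \<subseteq> CA} \<inter> {f \<in> E. f \<subseteq> CB} = {{p, q}} \<inter> E" by blast
    moreover have "\<not> {u, v} \<subseteq> CA" "\<not> {u, v} \<subseteq> CB" using pCA by auto
    moreover have "{v, u} = {u, v}" by auto
    ultimately show ?thesis unfolding kept_edges_def by auto
  qed
  have ne: "{p, q} \<noteq> {u, v}" using pq_ne by (auto simp: doubleton_eq_iff)
  have "card EA + card EB = card E + card (EA \<inter> EB)"
    using card_Un_Int[of EA EB] un fin sub finite_subset by metis
  also have "card (EA \<inter> EB) = (if {p, q} \<in> E then 2 else 1)"
    unfolding int using ne by (auto simp: insert_commute)
  finally show ?thesis .
qed

lemma EA_inner: assumes "x \<in> CA" "x \<noteq> p" "x \<noteq> q" shows "{x, y} \<in> EA \<longleftrightarrow> {x, y} \<in> E"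
  using edge_cases[of x y] CAB[of x] assms EA_iff uv by metis

text \<open>The brace \<open>uv\<close> joins the two neighbours of \<open>p\<close>, so it crosses braces at \<open>p\<close> only, and it is the
short chord that \<open>p\<close> requires. Pairs that alternate across \<open>pq\<close> give, with \<open>p\<close> and \<open>q\<close> in
place of the far ends, a pair that alternates on one side.\<close>
lemma merge:
  assumes hA: "half P E p q u v" and hB: "half P E p q v u" and bp: "branched E p" and nq: "\<not> branched E q"
  shows "interval_shape P E"
proof -
  interpret sw: critical_split P E p q v u using critical_split_swap critical_split_axioms .
  have n4: "4 \<le> card P"
    using card_PA card_mono[OF finP, of PA] PAP by fastforce
  note pu = half_adj[OF hA] and pv = sw.half_adj[OF hB]
  have 1: "\<exists>x\<in>P. branched E x" using bp p by blast
  have 2: "short_chords P E"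
    unfolding short_chords_def
  proof (intro allI impI)
    fix x y z assume x: "branched E x" and yz: "adj P x y" "adj P x z" "y \<noteq> z"
    show "{y, z} \<in> E"
    proof (cases "x = p")
      case True
      have "{y, z} = {u, v}"
        using adj3[OF pu pv, of y] adj3[OF pu pv, of z] yz True pq_ne by auto
      then show ?thesis using uv by simp
    next
      case False
      have "x \<noteq> q" using x nq by blast
      then show ?thesis
        using half_short[OF hA _ False _ x yz] sw.half_short[OF hB _ False _ x yz] notCA branched_in[OF mc x] by blast
    qed
  qed
  have only_p: "z = p" if "\<not> branched E u" "\<not> branched E v" "branched E z" for z
  proof (rule ccontr)
    assume zp: "z \<noteq> p"
    have z: "z \<in> P" "z \<noteq> q" "z \<noteq> u" "z \<noteq> v" using branched_in[OF mc that(3)] that nq by auto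
    show False
    proof (cases "z \<in> CA")
      case True
      have "cross p u z q \<or> cross p z u q \<or> cross p q u z"
        by (rule cross_ex) (use z zp pq_ne in auto)
      then have "cross p z u q" using adjD[OF pu z(1) q] CA_not[OF True] cross_swap by blast
      then have "cross z p u q" by (simp only: cross_flip)
      then show False using half_block[OF hA True pCA(1) _ _ that(3) bp] that(1) nq PA_iff pCA by blast
    next
      case False
      then have zB: "z \<in> CB" using notCA z by blast
      have "cross p v z q \<or> cross p z v q \<or> cross p q v z"
        by (rule cross_ex) (use z zp pq_ne in auto)
      then have "cross p z v q" using adjD[OF pv z(1) q] CB_not[OF zB] cross_swap by blast
      then have "cross z p v q" by (simp only: cross_flip)
      then show False using sw.half_block[OF hB zB pCA(5) _ _ that(3) bp] that(2) nq sw.PA_iff pCA by blast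
    qed
  qed
  have 3: "small_inside P E"
    unfolding small_inside_def
  proof (intro allI impI)
    fix x y assume xy: "{x, y} \<in> E" "\<not> branched E x" "\<not> branched E y"
    then have e: "{x, y} = {u, v}"
      using edge_cases[OF xy(1)] half_inside[OF hA _ _ xy(1)] sw.half_inside[OF hB _ _ xy(1)] by blast
    then have "(x = u \<and> y = v) \<or> (x = v \<and> y = u)" by (simp add: doubleton_eq_iff)
    then show "\<exists>h. (\<forall>z. branched E z \<longleftrightarrow> z = h) \<and> adj P h x \<and> adj P h y"
      using xy only_p bp pu pv by metis
  qed
  have near_p: "adj P x y" if "{x, s} = {u, v}" "{y, t} \<in> E" "cross x s y t" "\<not> branched E t" for x y s t
  proof -
    have "cross u v y t" using that(1,3) cross_doubleton cross_dual by metis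
    then have "y = p" using nbrs_chord(2)[OF finP n4 pu pv pq_ne(6), of y t] min_crossed_in[OF mc that(2)] bp that(4) by blast
    then show ?thesis using that(1) pu pv adj_sym by (metis doubleton_eq_iff)
  qed
  have 4: "crossing_adj P E"
    unfolding crossing_adj_def
  proof (intro allI impI)
    fix x y s t assume a: "{x, s} \<in> E" "{y, t} \<in> E" "cross x s y t" "branched E x" "branched E y" "\<not> branched E s" "\<not> branched E t"
    have r: "cross y t x s" using a(3) cross_dual by blast
    consider "{x, s} = {u, v}" | "{y, t} = {u, v}" | "x \<in> CA" "s \<in> CA" "y \<in> CA" "t \<in> CA"
      | "x \<in> CB" "s \<in> CB" "y \<in> CB" "t \<in> CB" | "x \<in> CA" "s \<in> CA" "y \<in> CB" "t \<in> CB"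
      | "x \<in> CB" "s \<in> CB" "y \<in> CA" "t \<in> CA"
      using edge_cases[OF a(1)] edge_cases[OF a(2)] by metis
    then show "adj P x y"
    proof cases
      case 1 then show ?thesis using near_p a by blast
    next
      case 2 then show ?thesis using near_p[OF 2 a(1) r a(6)] adj_sym by blast
    next
      case 3 then show ?thesis using half_crossing[OF hA _ _ _ _ a] by blast
    next
      case 4 then show ?thesis using sw.half_crossing[OF hB _ _ _ _ a] by blast
    next
      case 5 then show ?thesis using sides a(3) by blast
    next
      case 6 then show ?thesis using sides r by blast
    qed
  qed
  have sepAB: False if x: "branched E a" "branched E c" "\<not> branched E b" "b \<in> P" and
      c: "a \<in> CA" "a \<notin> CB" "c \<in> CB" "c \<notin> CA" and k: "cross a c b q" for a b c
  proof -
    have ap: "a \<noteq> p" "a \<noteq> q" "c \<noteq> p" "c \<noteq> q" "b \<noteq> p" using c pCA x bp by auto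
    have av: "cross p q a v" "cross p q c u" using c CA_iff CB_iff ap by auto
    then have ac: "cross p q a c" using sep unfolding cross_def by (smt (z3))
    have bq: "b \<noteq> q" "b \<noteq> a" "b \<noteq> c" using cross_distinct[OF k] by auto
    show False
    proof (cases "b \<in> CA")
      case True
      then have "cross p q b v" using CA_iff bq ap by auto
      then have "cross p q b c" using av sep unfolding cross_def by (smt (z3))
      then have "cross a p b q" using cross_merge[OF ac k] by blast
      then show False using half_block[OF hA c(1) pCA(1) _ _ x(1) bp] True PA_iff pCA x(3) nq by blast
    next
      case False
      then have bB: "b \<in> CB" "cross p q b u" using notCA x(4) by auto
      have "cross p q b a" using bB(2) av sep unfolding cross_def by (smt (z3))
      then have "cross c p b q" using cross_merge[of p q c a b] ac k cross_swap cross_flip by blast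
      then show False using sw.half_block[OF hB c(3) pCA(5) _ _ x(2) bp] bB sw.PA_iff pCA x(3) nq by blast
    qed
  qed
  have sepAB': False if x: "branched E a" "branched E c" "\<not> branched E b" "b \<in> P" "\<not> branched E d" "d \<in> P" and
      c: "a \<in> CA" "a \<notin> CB" "c \<in> CB" "c \<notin> CA" and k: "cross a c b d" for a b c d
  proof -
    have "a \<noteq> q" "c \<noteq> q" using c pCA by auto
    then have "cross a c b q \<or> cross a c d q" using cross_step[OF k, of q] cross_swap by blast
    then show False using sepAB[OF x(1,2) _ _ c] x by blast
  qed
  have 5: "branched_interval P E"
    unfolding branched_interval_def
  proof (intro allI ballI impI notI)
    fix a c b d assume bd: "b \<in> P" "d \<in> P" and x: "branched E a" "branched E c" "\<not> branched E b" "\<not> branched E d" and k: "cross a c b d"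
    have ac: "a \<in> P" "c \<in> P" using branched_in[OF mc] x by auto
    consider "a \<in> CA" "c \<in> CA" | "a \<in> CB" "c \<in> CB" | "a \<in> CA" "a \<notin> CB" "c \<in> CB" "c \<notin> CA"
      | "c \<in> CA" "c \<notin> CB" "a \<in> CB" "a \<notin> CA" using notCA ac by blast
    then show False
    proof cases
      case 1
      show False
      proof (cases "b \<in> CA")
        case b: True
        show False
        proof (cases "d \<in> CA")
          case True then show False using half_block[OF hA 1 _ _ x(1,2)] b k x PA_iff by blast
        next
          case False
          then have "cross a c b v" using to_v[OF 1, of d b] notCA bd k cross_swap by blast
          then show False using half_block[OF hA 1 _ _ x(1,2), of b v] b x PA_iff by blast
        qed
      next
        case False
        then have k2: "cross a c v d" using to_v[OF 1, of b d] notCA bd k by blast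
        have "d \<in> CA" using sides[OF 1, of b d] False notCA bd k by blast
        then show False using half_block[OF hA 1 _ _ x(1,2), of v d] k2 x PA_iff by blast
      qed
    next
      case 2
      show False
      proof (cases "b \<in> CB")
        case b: True
        show False
        proof (cases "d \<in> CB")
          case True then show False using sw.half_block[OF hB 2 _ _ x(1,2)] b k x sw.PA_iff by blast
        next
          case False
          then have "cross a c b u" using sw.to_v[OF 2, of d b] sw.notCA bd k cross_swap by blast
          then show False using sw.half_block[OF hB 2 _ _ x(1,2), of b u] b x sw.PA_iff by blast
        qed
      next
        case False
        then have k2: "cross a c u d" using sw.to_v[OF 2, of b d] sw.notCA bd k by blast
        have "d \<in> CB" using sw.sides[OF 2, of b d] False sw.notCA bd k by blast
        then show False using sw.half_block[OF hB 2 _ _ x(1,2), of u d] k2 x sw.PA_iff by blast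
      qed
    next
      case 3 then show False using sepAB'[OF x(1,2,3) bd(1) x(4) bd(2)] k by blast
    next
      case 4 
      have "cross c a b d" using k cross_flip by blast
      then show False using sepAB'[OF x(2,1,3) bd(1) x(4) bd(2)] 4 by blast
    qed
  qed
  show ?thesis unfolding interval_shape_def using 1 2 3 4 5 by blast
qed

end

section \<open>Gluing along a diagonal that is itself a brace\<close>

lemma cross_between: "cross p q r v \<Longrightarrow> cross v r u q \<Longrightarrow> \<not> cross q u r v \<Longrightarrow> r = u"
  unfolding cross_def by (smt (z3))

lemma cross_between': "cross p q r v \<Longrightarrow> cross v r u q \<Longrightarrow> cross p q u v \<Longrightarrow> cross r p u v"
  unfolding cross_def by (smt (z3))

lemma cross_jump_tip: "cross p q u s \<Longrightarrow> cross p q w s \<Longrightarrow> w \<noteq> u \<Longrightarrow> \<not> cross p u w q \<Longrightarrow> cross u s p w"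
  unfolding cross_def by (smt (z3))

lemma cross_twist: "cross p q r s \<Longrightarrow> cross p q u v \<Longrightarrow> cross p q r v \<Longrightarrow> r \<noteq> u \<Longrightarrow> s \<noteq> v \<Longrightarrow>
   \<not> cross p u r q \<Longrightarrow> \<not> cross q v s p \<Longrightarrow> cross r s u v"
  unfolding cross_def by (smt (z3))

lemma cross_beyond: "cross p q r s \<Longrightarrow> cross p q u v \<Longrightarrow> cross p q r v \<Longrightarrow> s \<noteq> v \<Longrightarrow> r \<noteq> u \<Longrightarrow>
   \<not> cross p v s q \<Longrightarrow> \<not> cross r s u v \<Longrightarrow> cross v r u q"
  unfolding cross_def by (smt (z3))

lemma cross_last: "cross r v p x \<Longrightarrow> cross v r u q \<Longrightarrow> cross p q r v \<Longrightarrow> cross p q u v \<Longrightarrow> cross r v u x"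
  unfolding cross_def by (smt (z3))

context critical_split
begin

lemma finPA: "finite PA" unfolding contraction_def using finCA by auto

lemma A_edge: "x \<in> CA \<Longrightarrow> x \<noteq> p \<Longrightarrow> x \<noteq> q \<Longrightarrow> cross p q x v"
  unfolding CA_iff by blast

text \<open>Such an \<open>h\<close> would be the only vertex strictly on its side of \<open>pq\<close>.\<close>
lemma no_tip: assumes h: "h \<in> CA" "h \<noteq> p" "h \<noteq> q" and a: "adj PA p h" "adj PA q h" shows False
proof -
  have "\<exists>z. z \<in> P \<and> cross p q z v \<and> z \<noteq> h"
  proof (cases "h = u")
    case True then show ?thesis using Anontriv by blast
  next
    case False then show ?thesis using u sep by blast
  qed
  then obtain z where z: "z \<in> P" "cross p q z v" "z \<noteq> h" by blast
  have zA: "z \<in> PA" using z CA_iff PA_iff by blast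
  have pq: "p \<in> PA" "q \<in> PA" using pCA PA_iff by auto
  have zn: "z \<noteq> p" "z \<noteq> q" using cross_distinct[OF z(2)] by auto
  have "cross p q h z"
    by (rule cross_ear) (use h z zn pq_ne adjD[OF a(1) pq(2) zA] adjD[OF a(2) pq(1) zA] cross_flip in auto)
  moreover have "cross p q h v" using A_edge[OF h] .
  ultimately show False using z(2) cross_not2 by blast
qed

text \<open>The neighbours of \<open>p\<close> are \<open>v\<close> and some other vertex, and the only brace at \<open>v\<close> goes to \<open>u\<close>.
In the following lemmas \<open>F\<close> is the set of braces of the contraction, possibly enlarged by \<open>pq\<close>.\<close>
lemma branched_pq:
  assumes U: "interval_shape PA F" and F: "\<And>x. {v, x} \<in> F \<longleftrightarrow> x = u" and b: "branched F p"
  shows "adj PA p u"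
proof -
  have "diagonal PA p q" unfolding diagonal_def using PA_iff pCA sep by blast
  then obtain a b where ab: "adj PA p a" "adj PA p b" "cross p q a b" using two_nbrs[OF finPA] by metis
  have pv: "adj PA p v" using adj_v[of p] adj_sym by blast
  have ne: "a \<noteq> b" using cross_distinct[OF ab(3)] by blast
  have "v = a \<or> v = b" using adj3[OF pv ab(1,2)] ne by auto
  then show ?thesis
  proof
    assume "v = a"
    then have "{v, b} \<in> F" using interval_shape_short[OF U b ab(1,2) ne] by simp
    then show ?thesis using F ab by auto
  next
    assume "v = b"
    then have "{v, a} \<in> F" using interval_shape_short[OF U b ab(2,1)] ne by auto
    then show ?thesis using F ab by auto
  qed
qed

lemma v_not_big: assumes F: "\<And>x. {v, x} \<in> F \<longleftrightarrow> x = u" shows "\<not> branched F v"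
  unfolding branched_def using F by auto

lemma Fv: assumes "F = EA \<or> F = insert {p, q} EA" shows "{v, x} \<in> F \<longleftrightarrow> x = u"
proof -
  have "{v, x} \<noteq> {p, q}" using pq_ne by (auto simp: doubleton_eq_iff)
  then show ?thesis using assms v_edge[of x] by auto
qed

lemma one_big:
  assumes U: "interval_shape PA F" and F: "F = EA \<or> F = insert {p, q} EA" and pq: "{p, q} \<in> F"
  shows "(branched F p \<and> \<not> branched F q) \<or> (branched F q \<and> \<not> branched F p)"
proof (rule ccontr)
  interpret fl: critical_split P E q p u v using critical_split_flip critical_split_axioms .
  assume "\<not> ?thesis"
  then consider "branched F p" "branched F q" | "\<not> branched F p" "\<not> branched F q" by blast
  then show False
  proof cases
    case 1
    have "adj PA p u" using branched_pq[OF U Fv[OF F] 1(1)] .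
    moreover have "adj PA q u" using fl.branched_pq[of F] U Fv[OF F] 1(2) contraction_flip by metis
    ultimately show False using no_tip pCA pq_ne by blast
  next
    case 2
    obtain h where h: "\<And>z. branched F z \<longleftrightarrow> z = h" "adj PA h p" "adj PA h q"
      using interval_shape_inside[OF U pq 2] by blast
    have "h \<noteq> v" using v_not_big[OF Fv[OF F]] h(1)[of v] by auto
    then have "h \<in> CA" using adj_in[OF h(2)] PA_iff by blast
    then show False using no_tip[of h] h adj_in[OF h(2)] adj_in[OF h(3)] adj_sym by blast
  qed
qed

text \<open>The last assumption covers the case that \<open>p\<close> is branched in the polygon, but not in this contraction. Then \<open>p\<close>
extends the interval of the contraction, next to its end \<open>u\<close>.\<close>
lemma half_part:
  assumes F: "F = EA \<or> F = insert {p, q} EA" and mcF: "min_crossed PA F" and U: "interval_shape PA F"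
    and bp: "branched E p" and nq: "\<not> branched E q" "\<not> branched F q" and pu: "adj PA p u"
    and pc: "\<not> branched F p \<Longrightarrow> branched F u \<and> (\<forall>x. {p, x} \<in> F \<longrightarrow> adj PA u x)"
  shows "half P E p q u v"
proof -
  note vF = Fv[OF F]
  have nv: "\<not> branched F v" using v_not_big[OF vF] .
  have EF: "{x, y} \<in> F" if "{x, y} \<in> E" "x \<in> CA" "y \<in> CA" for x y using that EA_iff F by blast
  have bigF: "branched F x \<longleftrightarrow> branched E x" if "x \<in> CA" "x \<noteq> p" for x
  proof (cases "x = q")
    case True then show ?thesis using nq by blast
  next
    case False
    have "{x, y} \<in> F \<longleftrightarrow> {x, y} \<in> E" for y
    proof -
      have "{x, y} \<noteq> {p, q}" using that False by (auto simp: doubleton_eq_iff)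
      then show ?thesis using EA_inner[OF that False, of y] F by auto
    qed
    then show ?thesis unfolding branched_def by simp
  qed
  have up: "adj PA u p" "adj PA p v" using pu adj_sym adj_v by blast+
  have 1: "{y, z} \<in> E" if x: "x \<in> CA" "x \<noteq> p" "x \<noteq> q" "branched E x" "adj P x y" "adj P x z" "y \<noteq> z" for x y z
  proof -
    have inA: "y \<in> CA" if "adj P x y" for y
    proof (rule ccontr)
      assume "y \<notin> CA"
      then have "cross p q y u" using notCA adj_in[OF that] by blast
      then have "cross p q x y" using A_edge[OF x(1-3)] sep unfolding cross_def by (smt (z3))
      then show False using adjD[OF that p q] cross_dual by blast
    qed
    have yz: "y \<in> CA" "z \<in> CA" using inA x by auto
    have a: "adj PA x y" "adj PA x z" using adj_PA[OF x(1)] yz x by auto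
    have "{y, z} \<in> F" using interval_shape_short[OF U _ a x(7)] bigF x by blast
    moreover have "{y, z} \<noteq> {p, q}"
    proof
      assume "{y, z} = {p, q}"
      then have "adj PA p x \<and> adj PA q x" using a adj_sym by (metis doubleton_eq_iff)
      then show False using no_tip[OF x(1-3)] by blast
    qed
    ultimately have "{y, z} \<in> EA" using F by auto
    then show ?thesis using EA_E by blast
  qed
  have 2: "branched E x \<or> branched E y" if xy: "x \<in> CA" "y \<in> CA" "{x, y} \<in> E" for x y
  proof (rule ccontr)
    assume n: "\<not> ?thesis"
    then have np: "x \<noteq> p" "y \<noteq> p" using bp by auto
    then have nb: "\<not> branched F x" "\<not> branched F y" using bigF xy n by auto
    obtain h where h: "\<And>z. branched F z \<longleftrightarrow> z = h" "adj PA h x" "adj PA h y"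
      using interval_shape_inside[OF U EF[OF xy(3,1,2)] nb] by blast
    have ne: "x \<noteq> y" using min_crossed_in[OF mc xy(3)] by blast
    have nv: "x \<noteq> v" "y \<noteq> v" using xy pCA by auto
    show False
    proof (cases "branched F p")
      case True
      then have "h = p" using h(1)[of p] by simp
      then show False using adj3[of PA p x y v] h(2,3) up ne nv by auto
    next
      case False
      then have "h = u" using pc h(1)[of u] by simp
      then show False using adj3[of PA u x y p] h(2,3) up ne np by auto
    qed
  qed
  have pf: "adj P p y" if x: "\<not> branched F p" "y \<in> CA" "s \<in> CA" "{p, s} \<in> E" 
    "p \<noteq> y" "branched E y" "\<not> branched E s" for y s
  proof -
    have ps: "{p, s} \<in> F" using EF[OF x(4) pCA(1) x(3)] .
    have bu: "branched F u" using pc[OF x(1)] by blast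
    have "s \<noteq> p" using x(7) bp by auto
    then have "\<not> branched F s" using bigF x by blast
    then obtain h where h: "\<And>z. branched F z \<longleftrightarrow> z = h" using interval_shape_inside[OF U ps x(1)] by blast
    have "branched F y" using bigF[of y] x by blast
    then have "y = u" using h[of y] h[of u] bu by simp
    then show ?thesis using pu adj_PA[of p u] pCA by blast
  qed
  have 3: "adj P x y" if a: "x \<in> CA" "y \<in> CA" "s \<in> CA" "t \<in> CA" "{x, s} \<in> E" "{y, t} \<in> E" "cross x s y t"
     "branched E x" "branched E y" "\<not> branched E s" "\<not> branched E t" for x y s t
  proof -
    have ne: "s \<noteq> p" "t \<noteq> p" "x \<noteq> y" using a bp cross_distinct[OF a(7)] by auto
    have nst: "\<not> branched F s" "\<not> branched F t" using bigF a ne by auto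
    consider "branched F x" "branched F y" | "\<not> branched F x" | "\<not> branched F y" by blast
    then show ?thesis
    proof cases
      case 1
      have "adj PA x y" using interval_shape_crossing[OF U EF[OF a(5,1,3)] EF[OF a(6,2,4)] a(7) 1 nst] .
      then show ?thesis using adj_PA a by blast
    next
      case 2
      then have "x = p" using bigF a by blast
      then show ?thesis using pf[of y s] 2 a ne by blast
    next
      case 3
      then have "y = p" using bigF a by blast
      then show ?thesis using pf[of x t] 3 a ne adj_sym by blast
    qed
  qed
  have pg: False if x: "\<not> branched F p" "branched F c" "b \<in> PA" "d \<in> PA" "\<not> branched F b" "\<not> branched F d" "cross p c b d" for b c d
  proof -
    have bu: "branched F u" using pc[OF x(1)] by blast
    have ne: "u \<noteq> b" "u \<noteq> d" using bu x by auto
    have "cross b d p c" using x(7) cross_dual by blast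
    then have "cross b d p u \<or> cross b d u c" using cross_step ne by blast
    moreover have "\<not> cross b d p u" using adjD[OF pu x(3,4)] cross_dual by blast
    ultimately have "cross u c b d" using cross_dual by blast
    then show False using interval_shape_block[OF U x(3,4) bu x(2,5,6)] by blast
  qed
  have 4: "\<not> cross a c b d" if x: "a \<in> CA" "c \<in> CA" "b \<in> PA" "d \<in> PA" "branched E a" "branched E c"
    "\<not> branched E b \<or> b = v" "\<not> branched E d \<or> d = v" for a b c d
  proof
    assume k: "cross a c b d"
    have "b \<noteq> p" "d \<noteq> p" using x bp pq_ne by auto
    have "\<not> branched F z" if "z \<in> PA" "z \<noteq> p" "\<not> branched E z \<or> z = v" for z
    proof (cases "z = v")
      case True then show ?thesis using nv by simp
    next
      case False then show ?thesis using that bigF[of z] PA_iff[of z] by blast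
    qed
    then have nb: "\<not> branched F b" "\<not> branched F d" using x(3,4,7,8) \<open>b \<noteq> p\<close> \<open>d \<noteq> p\<close> by simp_all
    have ac: "a \<noteq> c" using cross_distinct[OF k] by auto
    consider "branched F a" "branched F c" | "\<not> branched F a" | "\<not> branched F c" by blast
    then show False
    proof cases
      case 1 then show False using interval_shape_block[OF U x(3,4) 1 nb] k by blast
    next
      case 2
      then have "a = p" using bigF x by blast
      then show False using pg[of c b d] 2 bigF[of c] x nb k ac by blast
    next
      case 3
      then have "c = p" using bigF x by blast
      moreover have "cross c a b d" using k cross_flip by blast
      ultimately show False using pg[of a b d] 3 bigF[of a] x nb ac by blast
    qed
  qed
  have 5: "adj P p u" using pu adj_PA[of p u] pCA by blast
  show ?thesis unfolding half_def
    apply (intro conjI)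
    subgoal by (rule 5)
    subgoal using 1 by blast
    subgoal using 2 by blast
    subgoal using 3 by blast
    subgoal using 4 by blast
    done
qed

lemma small_q:
  assumes "\<not> branched EA q" "\<not> branched EB q" "{q, p} \<in> E" shows "\<not> branched E q"
proof
  interpret sw: critical_split P E p q v u using critical_split_swap critical_split_axioms .
  assume "branched E q"
  then obtain x where x: "{q, x} \<in> E" "x \<noteq> p" using branched_edge by metis
  have ne: "{q, x} \<noteq> {u, v}" using pq_ne by (auto simp: doubleton_eq_iff)
  show False
  proof (cases "x \<in> CA")
    case True
    then have "{q, x} \<in> EA" "{q, p} \<in> EA" using x assms(3) pCA EA_iff by auto
    then show False using assms(1) bigI x(2) by blast
  next
    case False
    then have "x \<in> CB" using edge_cases[OF x(1)] ne by blast
    then have "{q, x} \<in> EB" "{q, p} \<in> EB" using x assms(3) pCA sw.EA_iff by auto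
    then show False using assms(2) bigI x(2) by blast
  qed
qed

lemma branched_EA: "branched EA x \<Longrightarrow> branched E x" unfolding branched_def using EA_E by blast

text \<open>If the two sides disagreed about which of \<open>p\<close>, \<open>q\<close> is branched, the brace \<open>pq\<close> would be superfluous: every
diagonal that it crosses is crossed by \<open>uv\<close> or by another brace at \<open>p\<close> or \<open>q\<close>.\<close>
lemma no_twist:
  assumes pqE: "{p, q} \<in> E" and bA: "branched EA p" and bB: "branched EB q"
   and pu: "adj P p u" and qv: "adj P q v"
  shows False
proof -
  interpret sw: critical_split P E p q v u using critical_split_swap critical_split_axioms .
  have key: False if rs: "r \<in> P" "s \<in> P" "cross p q r v" "cross p q s u"
     and only: "\<And>a b. {a, b} \<in> E \<Longrightarrow> cross r s a b \<Longrightarrow> {a, b} = {p, q}" for r s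
  proof -
    have prs: "cross p q r s" using rs sep unfolding cross_def by (smt (z3))
    have c1: "\<not> cross p u z q" if "z \<in> P" for z using adjD[OF pu that q] .
    have c2: "\<not> cross q v z p" if "z \<in> P" for z using adjD[OF qv that p] .
    consider "r = u" | "s = v" | "r \<noteq> u" "s \<noteq> v" by blast
    then show False
    proof cases
      case 1
      obtain w where w: "{p, w} \<in> EA" "w \<noteq> q" using branched_edge[OF bA] by blast
      have "{p, w} \<noteq> {u, v}" using pq_ne by (auto simp: doubleton_eq_iff)
      then have wE: "{p, w} \<in> E" "w \<in> CA" using w EA_iff by auto
      have "w \<noteq> p" "w \<noteq> u" using min_crossed_in[OF mc wE(1)] min_crossed_edge_not_adj[OF mc wE(1)] pu by auto
      then have "cross p q w v" using A_edge wE w by blast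
      then have "cross p q w s" using rs sep unfolding cross_def by (smt (z3))
      then have "cross u s p w" using cross_jump_tip[of p q u s w] prs 1 \<open>w \<noteq> u\<close> c1[of w] CAP[OF wE(2)] by blast
      then have "{p, w} = {p, q}" using only[OF wE(1)] 1 by blast
      then show False using w(2) by (auto simp: doubleton_eq_iff)
    next
      case 2
      obtain w where w: "{q, w} \<in> EB" "w \<noteq> p" using branched_edge[OF bB] by blast
      have "{q, w} \<noteq> {v, u}" using pq_ne by (auto simp: doubleton_eq_iff)
      then have wE: "{q, w} \<in> E" "w \<in> CB" using w sw.EA_iff by auto
      have "w \<noteq> q" "w \<noteq> v" using min_crossed_in[OF mc wE(1)] min_crossed_edge_not_adj[OF mc wE(1)] qv by auto
      then have "cross p q w u" using sw.A_edge wE w by blast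
      then have "cross q p w r" using rs sep unfolding cross_def by (smt (z3))
      moreover have "cross q p v r" using rs sep unfolding cross_def by (smt (z3))
      ultimately have "cross v r q w" using cross_jump_tip[of q p v r w] \<open>w \<noteq> v\<close> c2[of w] CBP[OF wE(2)] by blast
      then have "{q, w} = {p, q}" using only[OF wE(1)] 2 cross_flip by blast
      then show False using w(2) by (auto simp: doubleton_eq_iff)
    next
      case 3
      have "cross r s u v" using cross_twist[OF prs sep rs(3) 3 c1[OF rs(1)] c2[OF rs(2)]] .
      then have "{u, v} = {p, q}" using only[OF uv] by blast
      then show False using pq_ne by (auto simp: doubleton_eq_iff)
    qed
  qed
  obtain r s where rs: "r \<in> P" "s \<in> P" "cross r s p q"
     and only: "\<And>a b. {a, b} \<in> E \<Longrightarrow> cross r s a b \<Longrightarrow> {a, b} = {p, q}"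
    using min_crossedD_crit[OF mc pqE] by blast
  have prs: "cross p q r s" using rs(3) cross_dual by blast
  have rsn: "r \<noteq> p" "r \<noteq> q" "s \<noteq> p" "s \<noteq> q" using cross_distinct[OF rs(3)] by auto
  have "r \<in> CA \<or> r \<in> CB" "s \<in> CA \<or> s \<in> CB" using notCA rs by auto
  then consider "cross p q r v" "cross p q s u" | "cross p q s v" "cross p q r u"
    using prs rsn sep unfolding CA_iff CB_iff cross_def by (smt (z3))
  then show False
  proof cases
    case 1 then show False using key rs only by blast
  next
    case 2 then show False using key[OF rs(2,1) 2] only cross_flip by blast
  qed
qed

lemma interval_shape_glue_pq_aux:
  assumes pqE: "{p, q} \<in> E" and mcA: "min_crossed PA EA" "interval_shape PA EA"
    and mcB: "min_crossed PB EB" "interval_shape PB EB"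
    and bp: "branched EA p" "\<not> branched EA q"
  shows "interval_shape P E"
proof -
  interpret sw: critical_split P E p q v u using critical_split_swap critical_split_axioms .
  interpret sf: critical_split P E q p v u using critical_split_swap critical_split_flip critical_split_axioms by blast
  have pqB: "{p, q} \<in> EB" using pqE sw.EA_iff pCA by blast
  have pu: "adj PA p u" using branched_pq[OF mcA(2) _ bp(1)] v_edge by blast
  have "branched EB p \<and> \<not> branched EB q"
  proof (rule ccontr)
    assume "\<not> ?thesis"
    then have b: "branched EB q" using sw.one_big[OF mcB(2) _ pqB] by blast
    have "adj (contraction P q p v u) q v"
      using sf.branched_pq[of EB] mcB(2) b sw.v_edge contraction_flip by metis
    then have "adj P q v" using sw.adj_PA[of q v] pCA contraction_flip by metis
    moreover have "adj P p u" using pu adj_PA[of p u] pCA by blast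
    ultimately show False using no_twist[OF pqE bp(1) b] by blast
  qed
  then have bB: "branched EB p" "\<not> branched EB q" by auto
  have pv: "adj PB p v" using sw.branched_pq[OF mcB(2) _ bB(1)] sw.v_edge by blast
  have bE: "branched E p" "\<not> branched E q"
    using branched_EA[OF bp(1)] small_q[OF bp(2) bB(2)] pqE by (auto simp: insert_commute)
  have "half P E p q u v" using half_part[OF _ mcA bE bp(2) pu] bp(1) by blast
  moreover have "half P E p q v u" using sw.half_part[OF _ mcB bE bB(2) pv] bB(1) by blast
  ultimately show ?thesis using merge bE by blast
qed

end

lemma interval_shape_glue_pq:
  assumes sp: "critical_split P E p q u v" and pqE: "{p, q} \<in> E"
    and mcA: "min_crossed (contraction P p q u v) (kept_edges P E p q u v)" "interval_shape (contraction P p q u v) (kept_edges P E p q u v)"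
    and mcB: "min_crossed (contraction P p q v u) (kept_edges P E p q v u)" "interval_shape (contraction P p q v u) (kept_edges P E p q v u)"
  shows "interval_shape P E"
proof -
  have pqA: "{p, q} \<in> kept_edges P E p q u v" using critical_split.EA_iff[OF sp] critical_split.pCA[OF sp] pqE by blast
  consider "branched (kept_edges P E p q u v) p" "\<not> branched (kept_edges P E p q u v) q"
    | "branched (kept_edges P E p q u v) q" "\<not> branched (kept_edges P E p q u v) p"
    using critical_split.one_big[OF sp mcA(2) _ pqA] by blast
  then show ?thesis
  proof cases
    case 1 then show ?thesis using critical_split.interval_shape_glue_pq_aux[OF sp pqE mcA mcB] by blast
  next
    case 2
    have "{q, p} \<in> E" using pqE by (simp add: insert_commute)
    then show ?thesis
      using critical_split.interval_shape_glue_pq_aux[OF critical_split_flip[OF sp]] mcA mcB 2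
      unfolding contraction_flip[of P q p] kept_edges_flip[of P E q p] by blast
  qed
qed

context critical_split
begin

lemma not_tight_aux:
  assumes n: "{p, q} \<notin> E" and jA: "jumped P E p q u v" and jB: "jumped P E p q v u" and U: "interval_shape PA EA"
  shows "adj PA p u"
proof (cases "branched EA p")
  case True
  then show ?thesis using branched_pq[OF U v_edge] by blast
next
  case False
  interpret sw: critical_split P E p q v u using critical_split_swap critical_split_axioms .
  have mcA: "min_crossed PA EA" using min_crossed_part[OF jA] .
  have n4: "4 \<le> card PA" using card_PA by simp
  have pPA: "p \<in> PA" using pCA PA_iff by blast
  obtain w where w: "{p, w} \<in> EA" using min_crossed_deg1[OF mcA n4 pPA] by blast
  have "{p, w} \<noteq> {u, v}" using pq_ne by (auto simp: doubleton_eq_iff)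
  then have wE: "{p, w} \<in> E" "w \<in> CA" using w EA_iff by auto
  have vu: "{v, u} \<in> EA" using v_edge by blast
  have vp: "adj PA v p" using adj_v by blast
  have nv: "\<not> branched EA v" using v_not_big v_edge by blast
  from wE(1) pCA(1) wE(2) show ?thesis
  proof (cases rule: crit_move)
    case (1 r s)
    have "r \<noteq> v" "s \<noteq> v" "r \<in> PA" "s \<in> PA" using 1 pCA PA_iff by auto
    then show ?thesis using critical_at_small_nbr[OF mcA U n4 nv vp vu False w _ _ _ _ 1(3)] 1(4) EA_E by blast
  next
    case (2 r s)
    have rn: "r \<noteq> p" "r \<noteq> q" "s \<noteq> p" "s \<noteq> q" using 2 pCA by auto
    have r: "cross p q r v" and s: "cross p q s u" using A_edge[OF 2(1)] sw.A_edge[OF 2(2)] rn by auto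
    obtain a b where ab: "a \<in> CA" "b \<in> CA" "{a, b} \<in> E" "cross v r a b"
      using jA r CAP[OF 2(1)] unfolding jumped_def by blast
    obtain c d where cd: "c \<in> CB" "d \<in> CB" "{c, d} \<in> E" "cross u s c d"
      using jB s CBP[OF 2(2)] unfolding jumped_def by blast
    have "cross r s a b" using cross_v'[OF 2(1) ab(1,2) 2(2) rn(3,4)] ab(4) cross_flip by blast
    then have e1: "{a, b} = {p, w}" using 2(6) ab by blast
    have "cross s r c d" using sw.cross_v'[OF 2(2) cd(1,2) 2(1) rn(1,2)] cd(4) cross_flip by blast
    then have "{c, d} = {p, w}" using 2(6) cd cross_flip by blast
    then have "w \<in> CB" using cd by (auto simp: doubleton_eq_iff)
    then have "w = q" using CAB wE min_crossed_in[OF mc wE(1)] by blast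
    then show ?thesis using n wE by blast
  qed
qed

text \<open>When all vertices on both sides are jumped and \<open>pq\<close> is no brace, the witnesses for the braces of a side stay on that
side. So if \<open>p\<close> has only one brace in the contraction, \<open>critical_at_small_nbr\<close> makes \<open>u\<close> adjacent to it; if \<open>p\<close> is branched, its
short chord does. The same holds for \<open>q\<close>, and \<open>no_tip\<close> applies.\<close>
lemma not_tight:
  assumes n: "{p, q} \<notin> E" and jA: "jumped P E p q u v" and jB: "jumped P E p q v u"
  shows "\<not> interval_shape PA EA"
proof
  assume U: "interval_shape PA EA"
  interpret fl: critical_split P E q p u v using critical_split_flip critical_split_axioms .
  have "adj PA p u" using not_tight_aux[OF assms U] .
  moreover have "adj PA q u"
    using fl.not_tight_aux n jA jB U
    unfolding contraction_flip[of P q p] kept_edges_flip[of P E q p] jumped_flip[of P E q p] insert_commute[of q p "{}"]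
    by blast
  ultimately show False using no_tip pCA pq_ne by blast
qed

end

section \<open>Gluing when one side needs the extra diagonal\<close>

context critical_split
begin

text \<open>The brace \<open>pw\<close> crosses every chord from \<open>v\<close> to the side of \<open>u\<close>, hence \<open>s\<close> is not \<open>v\<close>, and \<open>v\<close> lies between \<open>p\<close> and \<open>s\<close>.
As \<open>uv\<close> does not cross \<open>rs\<close>, the vertex \<open>u\<close> is \<open>r\<close> or lies between \<open>r\<close> and \<open>p\<close>.\<close>
lemma unjumped_end:
  assumes n: "{p, q} \<notin> E" and pv: "adj P p v" and w: "{p, w} \<in> E" "w \<in> CB" "w \<noteq> q"
   and xy: "{x, y} \<in> E" "x \<in> CA" "y \<in> CA"
   and rs: "r \<in> CA" "s \<in> CB" "r \<notin> CB" "s \<notin> CA" "cross r s x y"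
   and only: "\<And>a b. {a, b} \<in> E \<Longrightarrow> cross r s a b \<Longrightarrow> {a, b} = {x, y}"
  shows "r = u \<or> cross v r u q"
proof (rule ccontr)
  interpret sw: critical_split P E p q v u using critical_split_swap critical_split_axioms .
  assume a: "\<not> ?thesis"
  have rn: "r \<noteq> p" "r \<noteq> q" "s \<noteq> p" "s \<noteq> q" using rs pCA by auto
  have r: "cross p q r v" and s: "cross p q s u" using A_edge[OF rs(1)] sw.A_edge[OF rs(2)] rn by auto
  have "s \<noteq> v"
  proof
    assume sv: "s = v"
    have "w \<noteq> p" "w \<noteq> v" using min_crossed_in[OF mc w(1)] min_crossed_edge_not_adj[OF mc w(1)] pv by auto
    then have "cross p q w u" using sw.A_edge w by blast
    then have pw: "cross p q w r" "cross p q v r" using r sep unfolding cross_def by (smt (z3))+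
    have "cross v r p w" 
      using cross_jump_tip[OF pw(2,1) \<open>w \<noteq> v\<close>] adjD[OF pv CBP[OF w(2)] q] by blast
    then have "{p, w} = {x, y}" using only[OF w(1)] sv cross_flip by blast
    then have "w \<in> CA" using xy by (auto simp: doubleton_eq_iff)
    then show False using CAB w \<open>w \<noteq> p\<close> by blast
  qed
  moreover have "\<not> cross r s u v"
  proof
    assume "cross r s u v"
    then have "{u, v} = {x, y}" using only[OF uv] by blast
    then show False using xy pCA by (auto simp: doubleton_eq_iff)
  qed
  moreover have "cross p q r s" using r s sep unfolding cross_def by (smt (z3))
  moreover have "\<not> cross p v s q" using adjD[OF pv CBP[OF rs(2)] q] .
  ultimately show False using cross_beyond[of p q r s u v] sep r a by blast
qed

text \<open>In the other contraction \<open>p\<close> is branched and adjacent to \<open>v\<close>. On this side either \<open>p\<close> is branched, or the witness for its only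
brace shows that \<open>u\<close> is adjacent to \<open>p\<close> and that this brace passes just over \<open>u\<close>.\<close>
lemma asym_side:
  assumes n: "{p, q} \<notin> E" and jA: "jumped P E p q u v" and U: "interval_shape PA EA"
   and pv: "adj P p v" and w: "{p, w} \<in> E" "w \<in> CB" "w \<noteq> q"
  shows "adj PA p u \<and> \<not> branched EA q \<and> (\<not> branched EA p \<longrightarrow> branched EA u \<and> (\<forall>x. {p, x} \<in> EA \<longrightarrow> adj PA u x))"
proof -
  interpret fl: critical_split P E q p u v using critical_split_flip critical_split_axioms .
  have mcA: "min_crossed PA EA" using min_crossed_part[OF jA] .
  have n4: "4 \<le> card PA" using card_PA by simp
  have inPA: "p \<in> PA" "q \<in> PA" "u \<in> PA" "v \<in> PA" using pCA PA_iff by blast+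
  have vu: "{v, u} \<in> EA" using v_edge by blast
  have vp: "adj PA v p" using adj_v by blast
  have nv: "\<not> branched EA v" using v_not_big v_edge by blast
  have qu: "adj PA q u" if "branched EA q"
    using fl.branched_pq[of EA] U v_edge that unfolding contraction_flip[of P q p] by blast
  have nq: "\<not> branched EA q" if "adj PA p u"
    using no_tip[OF pCA(3) _ _ that] qu pq_ne by blast
  show ?thesis
  proof (cases "branched EA p")
    case True
    then have "adj PA p u" using branched_pq[OF U v_edge] by blast
    then show ?thesis using nq True by blast
  next
    case np: False
    obtain x where x: "{p, x} \<in> EA" using min_crossed_deg1[OF mcA n4 inPA(1)] by blast
    have x': "x' = x" if "{p, x'} \<in> EA" for x' using np x that bigI by blast
    have "{p, x} \<noteq> {u, v}" using pq_ne by (auto simp: doubleton_eq_iff)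
    then have xE: "{p, x} \<in> E" "x \<in> CA" using x EA_iff by auto
    have fin: ?thesis if "adj PA p u" "adj PA u x" "branched EA u"
      using that nq x' by blast
    from xE(1) pCA(1) xE(2) show ?thesis
    proof (cases rule: crit_move)
      case (1 r s)
      have "r \<noteq> v" "s \<noteq> v" "r \<in> PA" "s \<in> PA" using 1 pCA PA_iff by auto
      then show ?thesis
        using critical_at_small_nbr[OF mcA U n4 nv vp vu np x _ _ _ _ 1(3)] 1(4) EA_E fin by blast
    next
      case (2 r s)
      have rn: "r \<noteq> p" "r \<noteq> q" "s \<noteq> p" "s \<noteq> q" "r \<noteq> v" using 2 pCA by auto
      have r: "cross p q r v" using A_edge[OF 2(1)] rn by auto
      have rPA: "r \<in> PA" using 2 PA_iff by blast
      have ru: "r = u \<or> cross v r u q" using unjumped_end[OF n pv w xE(1) pCA(1) xE(2) 2] .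
      have rv: "cross r v p x" using cross_v[OF 2(1) pCA(1) xE(2) 2(2,5)] .
      have onlyA: "{a, b} = {p, x}" if "{a, b} \<in> EA" "cross r v a b" for a b
      proof -
        have "{a, b} \<noteq> {u, v}" using cross_distinct[OF that(2)] by (auto simp: doubleton_eq_iff)
        then have ab: "{a, b} \<in> E" "a \<in> CA" "b \<in> CA" using that EA_iff by auto
        have "cross r s a b" using cross_v'[OF 2(1) ab(2,3) 2(2) rn(3,4) that(2)] .
        then show ?thesis using 2(6)[OF ab(1)] by blast
      qed
      show ?thesis
      proof (cases "branched EA r")
        case True
        have "adj PA r p \<and> adj PA r x"
          using critical_nbr_aux[OF mcA U n4 rPA inPA(4) True rv inPA(1)] PA_iff xE(2) onlyA by blast
        then have rp: "adj PA r p" "adj PA r x" by auto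
        have "r = u"
        proof (rule ccontr)
          assume "r \<noteq> u"
          then have "cross r p u v" using ru cross_between'[OF r _ sep] by blast
          then show False using adjD[OF rp(1) inPA(3,4)] by blast
        qed
        then show ?thesis using fin rp True adj_sym by blast
      next
        case nr: False
        have nbq: "\<not> branched EA q"
        proof
          assume bq: "branched EA q"
          note qu' = qu[OF this]
          have "r = u" using ru cross_between[OF r] adjD[OF qu' rPA inPA(4)] by blast
          obtain a where a: "{q, a} \<in> EA" "a \<noteq> p" using branched_edge[OF bq] by blast
          have "{q, a} \<noteq> {u, v}" using pq_ne by (auto simp: doubleton_eq_iff)
          then have aE: "{q, a} \<in> E" "a \<in> CA" using a EA_iff by auto
          have "a \<noteq> q" using min_crossed_in[OF mc aE(1)] by auto
          have "\<not> adj PA q a" using min_crossed_edge_not_adj[OF mcA a(1)] .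
          then have "a \<noteq> u" using qu' by auto
          have "cross q p a v" using A_edge[OF aE(2) a(2) \<open>a \<noteq> q\<close>] cross_flip by blast
          moreover have "cross q p u v" using sep cross_flip by blast
          ultimately have "cross u v q a"
            using cross_jump_tip[of q p u v a] \<open>a \<noteq> u\<close> adjD[OF qu', of a p] aE PA_iff inPA by blast
          then have "{q, a} = {p, x}" using onlyA[OF a(1)] \<open>r = u\<close> by blast
          then show False using a(2) pq_ne by (auto simp: doubleton_eq_iff)
        qed
        have bu: "branched EA u"
        proof (rule ccontr)
          assume nu: "\<not> branched EA u"
          obtain h where h: "\<And>z. branched EA z \<longleftrightarrow> z = h" "adj PA h v"
            using interval_shape_inside[OF U vu nv nu] by blast
          have "h = p \<or> h = q" using h(2) adj_v adj_sym by blast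
          then show False using h(1)[of h] np nbq by auto
        qed
        then have vr: "cross v r u q" using ru nr by auto
        have k: "cross r v u x" using cross_last[OF rv vr r sep] .
        have False
        proof (cases "branched EA x")
          case True
          show False using interval_shape_block[OF U rPA inPA(4) bu True nr nv] k cross_dual by blast
        next
          case False
          obtain h where h: "\<And>z. branched EA z \<longleftrightarrow> z = h" "adj PA h x"
            using interval_shape_inside[OF U x np False] by blast
          have "h = u" using h(1)[of u] bu by simp
          then show False using adjD[OF h(2) rPA inPA(4)] k cross_dual by blast
        qed
        then show ?thesis ..
      qed
    qed
  qed
qed

lemma interval_shape_glue_asym_aux:
  assumes n: "{p, q} \<notin> E" and jA: "jumped P E p q u v" and U: "interval_shape PA EA"
    and mcB: "min_crossed PB (insert {p, q} EB)"
      "interval_shape PB (insert {p, q} EB)"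
    and bp: "branched (insert {p, q} EB) p" "\<not> branched (insert {p, q} EB) q"
  shows "interval_shape P E"
proof -
  interpret sw: critical_split P E p q v u using critical_split_swap critical_split_axioms .
  let ?F = "insert {p, q} EB"
  have FB: "?F = EB \<or> ?F = insert {p, q} EB" by blast
  have pv: "adj PB p v" using sw.branched_pq[OF mcB(2) sw.Fv[OF FB] bp(1)] .
  have pv': "adj P p v" using pv sw.adj_PA[of p v] pCA by blast
  obtain w where w: "{p, w} \<in> ?F" "w \<noteq> q" using branched_edge[OF bp(1)] by blast
  then have "{p, w} \<noteq> {p, q}" "{p, w} \<noteq> {v, u}" using pq_ne by (auto simp: doubleton_eq_iff)
  then have wE: "{p, w} \<in> E" "w \<in> CB" using w sw.EA_iff by auto
  have side: "adj PA p u" "\<not> branched EA q" "\<not> branched EA p \<Longrightarrow> branched EA u \<and> (\<forall>x. {p, x} \<in> EA \<longrightarrow> adj PA u x)"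
    using asym_side[OF n jA U pv' wE w(2)] by auto
  have mcA: "min_crossed PA EA" using min_crossed_part[OF jA] .
  have n4: "4 \<le> card PA" using card_PA by simp
  have pPA: "p \<in> PA" using pCA PA_iff by blast
  obtain x where x: "{p, x} \<in> EA" using min_crossed_deg1[OF mcA n4 pPA] by blast
  have "{p, x} \<noteq> {u, v}" using pq_ne by (auto simp: doubleton_eq_iff)
  then have xE: "{p, x} \<in> E" "x \<in> CA" using x EA_iff by auto
  have "x \<noteq> p" "x \<noteq> q" using min_crossed_in[OF mc xE(1)] xE(1) n by auto
  then have "x \<noteq> w" using CAB xE wE by blast
  then have bE: "branched E p" using bigI xE wE by blast
  have nq: "\<not> branched E q"
  proof
    assume "branched E q"
    then obtain y z where yz: "y \<noteq> z" "{q, y} \<in> E" "{q, z} \<in> E" unfolding branched_def by blast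
    have inEA: "{q, y} \<in> EA" if qy: "{q, y} \<in> E" for y
    proof -
      have ne: "{q, y} \<noteq> {u, v}" using pq_ne by (auto simp: doubleton_eq_iff)
      have "y \<noteq> p" using qy n by (auto simp: insert_commute)
      have "\<not> (y \<in> CB)"
      proof
        assume "y \<in> CB"
        then have "{q, y} \<in> ?F" using qy pCA sw.EA_iff by blast
        moreover have "{q, p} \<in> ?F" by (simp add: insert_commute)
        ultimately have "branched ?F q" using \<open>y \<noteq> p\<close> by (rule bigI)
        then show False using bp(2) by simp
      qed
      then show ?thesis using edge_cases[OF qy] ne qy EA_iff by blast
    qed
    then show False using side(2) bigI yz by blast
  qed
  have "half P E p q u v" using half_part[OF _ mcA U bE nq side(2,1)] side(3) by blast
  moreover have "half P E p q v u" using sw.half_part[OF FB mcB bE nq bp(2) pv] bp(1) by blast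
  ultimately show ?thesis using merge bE nq by blast
qed

end

lemma interval_shape_glue_asym:
  assumes sp: "critical_split P E p q u v" and n: "{p, q} \<notin> E" and jA: "jumped P E p q u v"
    and U: "interval_shape (contraction P p q u v) (kept_edges P E p q u v)"
    and mcB: "min_crossed (contraction P p q v u) (insert {p, q} (kept_edges P E p q v u))"
      "interval_shape (contraction P p q v u) (insert {p, q} (kept_edges P E p q v u))"
  shows "interval_shape P E"
proof -
  let ?F = "insert {p, q} (kept_edges P E p q v u)"
  consider "branched ?F p" "\<not> branched ?F q" | "branched ?F q" "\<not> branched ?F p"
    using critical_split.one_big[OF critical_split_swap[OF sp] mcB(2)] by blast
  then show ?thesis
  proof cases
    case 1 then show ?thesis using critical_split.interval_shape_glue_asym_aux[OF sp n jA U mcB] by blast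
  next
    case 2
    have "{q, p} \<notin> E" using n by (simp add: insert_commute)
    then show ?thesis
      using critical_split.interval_shape_glue_asym_aux[OF critical_split_flip[OF sp]] jA U mcB 2
      unfolding contraction_flip[of P q p] kept_edges_flip[of P E q p] jumped_flip[of P E q p] insert_commute[of q p "{}"]
      by blast
  qed
qed

section \<open>At most n - 2 braces\<close>

lemma adj_diff: assumes "min_crossed P E" "4 \<le> card P" "h \<in> P"
  obtains y z where "adj P h y" "adj P h z" "y \<noteq> z"
  using diagonal_at[OF min_crossedD_fin[OF assms(1)] assms(2,3)] two_nbrs[OF min_crossedD_fin[OF assms(1)]] cross_distinct by metis

text \<open>Sending a vertex with one brace to that brace maps the set of these vertices onto the braces, so with three or more branched
vertices the bound is strict. With two, equality makes the map injective, and no brace joins two vertices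
of degree three. With one, the neighbours of the hub have braces that avoid the hub, which costs one. With
none, the braces form a perfect matching.\<close>
lemma star_case:
  assumes mc: "min_crossed P E" and n4: "4 \<le> card P" and star: "\<And>x y. {x, y} \<in> E \<Longrightarrow> \<not> branched E x \<or> \<not> branched E y"
  shows "card E + 2 \<le> card P \<and> (card E + 2 = card P \<longrightarrow> 5 \<le> card P \<longrightarrow> interval_shape P E)"
proof -
  define T where "T = {x \<in> P. \<not> branched E x}"
  define I where "I = {x \<in> P. branched E x}"
  define g where "g t = {t, SOME z. {t, z} \<in> E}" for t
  note fin = min_crossedD_fin[OF mc]
  have finT: "finite T" "finite I" using fin unfolding T_def I_def by auto
  have cT: "card T + card I = card P"
  proof -
    have "T \<union> I = P" "T \<inter> I = {}" unfolding T_def I_def by auto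
    then show ?thesis using card_Un_disjoint[OF finT] by simp
  qed
  have gE: "g t \<in> E" if "t \<in> P" for t
    unfolding g_def using someI_ex[OF min_crossed_deg1[OF mc n4 that]] .
  have guniq: "{t, z} = g t" if "{t, z} \<in> E" "\<not> branched E t" for t z
  proof -
    have "t \<in> P" using min_crossed_in[OF mc that(1)] by blast
    then have "{t, SOME z. {t, z} \<in> E} \<in> E" using gE unfolding g_def by blast
    then have "(SOME z. {t, z} \<in> E) = z" using that bigI by blast
    then show ?thesis unfolding g_def by simp
  qed
  have nb: "t \<in> T \<longleftrightarrow> t \<in> P \<and> \<not> branched E t" for t unfolding T_def by simp
  have Eg: "E = g ` T"
  proof
    show "g ` T \<subseteq> E" using gE nb by blast
    show "E \<subseteq> g ` T"
    proof
      fix e assume e: "e \<in> E"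
      obtain x y where xy: "e = {x, y}" using min_crossedD_form[OF mc e] by blast
      have "x \<in> P" "y \<in> P" using min_crossed_in[OF mc, of x y] e xy by auto
      moreover have "\<not> branched E x \<or> \<not> branched E y" using star e xy by blast
      moreover have "e = {y, x}" using xy by auto
      ultimately show "e \<in> g ` T" using guniq[of x y] guniq[of y x] e xy nb by (metis image_eqI)
    qed
  qed
  have gg: "g a = {a, b} \<and> g b = {a, b}" if "{a, b} \<in> E" "\<not> branched E a" "\<not> branched E b" for a b
    using guniq[of a b] guniq[of b a] that by (metis insert_commute)
  have ne: "a \<noteq> b" if "{a, b} \<in> E" for a b using min_crossed_in[OF mc that] by blast
  have le: "card E \<le> card T" unfolding Eg using card_image_le[OF finT(1)] .
  consider "3 \<le> card I" | "card I = 2" | "card I = 1" | "card I = 0" by linarith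
  then show ?thesis
  proof cases
    case 1 then show ?thesis using le cT by linarith
  next
    case 2
    then obtain x y where I: "I = {x, y}" "x \<noteq> y" by (auto simp: card_2_iff)
    have bI: "branched E z \<longleftrightarrow> z = x \<or> z = y" for z using I branched_in[OF mc] unfolding I_def by blast
    have xy: "x \<in> P" "y \<in> P" using bI branched_in[OF mc] by auto
    have "interval_shape P E" if "card E + 2 = card P"
    proof -
      have "card (g ` T) = card T" using that cT 2 Eg by simp
      then have inj: "inj_on g T" using eq_card_imp_inj_on[OF finT(1)] by blast
      have no: "branched E a \<or> branched E b" if "{a, b} \<in> E" for a b
      proof (rule ccontr)
        assume n: "\<not> ?thesis"
        then have "a \<in> T" "b \<in> T" using nb min_crossed_in[OF mc that] by auto
        moreover have "g a = g b" using gg that n by simp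
        ultimately show False using inj ne[OF that] by (meson inj_onD)
      qed
      have axy: "adj P x y"
      proof (rule ccontr)
        assume "\<not> ?thesis"
        then have "diagonal P x y" using diagonal_iff[OF xy I(2)] by blast
        then obtain a b where "{a, b} \<in> E" "cross x y a b" using min_crossedD_conn[OF mc] by blast
        then show False using no[of a b] bI[of a] bI[of b] cross_distinct[of x y a b] by blast
      qed
      have short: "{y', z} \<in> E" if "adj P x' y'" "adj P x' z" "y' \<noteq> z" "branched E x'" "branched E y'" for x' y' z
      proof -
        have ne2: "x' \<noteq> z" "x' \<noteq> y'" using adj_in that by blast+
        then have zn: "\<not> branched E z" using bI that by metis
        have zP: "z \<in> P" using adj_in[OF that(2)] by blast
        obtain w where w: "{z, w} \<in> E" using min_crossed_deg1[OF mc n4 zP] by blast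
        then have "branched E w" using no zn by blast
        moreover have "w \<noteq> x'" using w that(2) min_crossed_edge_not_adj[OF mc w] adj_sym by blast
        ultimately have "w = y'" using bI that(4,5) ne2 by metis
        then show ?thesis using w by (simp add: insert_commute)
      qed
      have 2: "short_chords P E" unfolding short_chords_def
      proof (intro allI impI)
        fix x' y' z' assume a: "branched E x'" "adj P x' y'" "adj P x' z'" "y' \<noteq> z'"
        obtain x2 where x2: "adj P x' x2" "branched E x2" using a(1) axy bI adj_sym by metis
        then have "x2 = y' \<or> x2 = z'" using adj3[OF a(2,3)] a(4) by blast
        then show "{y', z'} \<in> E" using short[OF a(2,3,4,1)] short[OF a(3,2) _ a(1)] a(4) x2
          by (metis insert_commute)
      qed
      have 3: "small_inside P E" unfolding small_inside_def using no by blast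
      have 4: "crossing_adj P E" unfolding crossing_adj_def
        using bI axy adj_sym cross_distinct by metis
      have 5: "branched_interval P E" unfolding branched_interval_def
        using bI adjD[OF axy] cross_distinct cross_flip by metis
      show ?thesis unfolding interval_shape_def using 2 3 4 5 bI xy by blast
    qed
    then show ?thesis using le cT 2 by linarith
  next
    case 3
    then obtain h where I: "I = {h}" by (auto simp: card_1_singleton_iff)
    have bI: "branched E z \<longleftrightarrow> z = h" for z using I branched_in[OF mc] unfolding I_def by blast
    have hP: "h \<in> P" using bI branched_in[OF mc] by blast
    obtain y z where yz: "adj P h y" "adj P h z" "y \<noteq> z" using adj_diff[OF mc n4 hP] .
    have nbr: "\<exists>t. {y, t} \<in> E \<and> y \<noteq> h \<and> t \<noteq> h" if "adj P h y" for y
    proof -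
      have y: "y \<in> P" "y \<noteq> h" using adj_in[OF that] by auto
      obtain t where t: "{y, t} \<in> E" using min_crossed_deg1[OF mc n4 y(1)] by blast
      have "t \<noteq> h" using min_crossed_edge_not_adj[OF mc t] that adj_sym by blast
      then show ?thesis using t y by blast
    qed
    obtain t where t: "{y, t} \<in> E" "y \<noteq> h" "t \<noteq> h" using nbr[OF yz(1)] by blast
    have yt: "y \<in> T" "t \<in> T" "y \<noteq> t" using min_crossed_in[OF mc t(1)] nb bI t by auto
    have gyt: "g y = {y, t}" "g t = {y, t}" using gg[OF t(1)] bI t by auto
    have "g ` T = insert (g t) (g ` (T - {t}))" using yt by auto
    moreover have "g t \<in> g ` (T - {t})" using yt gyt by (intro image_eqI[of _ _ y]) auto
    ultimately have "g ` T = g ` (T - {t})" by auto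
    then have Eg': "E = g ` (T - {t})" using Eg by simp
    have le': "card E \<le> card (T - {t})" unfolding Eg' using card_image_le finT by blast
    have cT': "card (T - {t}) = card T - 1" "1 \<le> card T"
      using yt finT by (auto simp: card_gt_0_iff Suc_le_eq)
    have "interval_shape P E" if "card E + 2 = card P"
    proof -
      have "card E = card (T - {t})" using that cT cT' 3 by linarith
      then have "card (g ` (T - {t})) = card (T - {t})" using Eg' by simp
      then have inj: "inj_on g (T - {t})" using eq_card_imp_inj_on finT by blast
      have inside: "{a, b} = {y, t}" if ab: "{a, b} \<in> E" "a \<noteq> h" "b \<noteq> h" for a b
      proof -
        have T: "a \<in> T" "b \<in> T" using min_crossed_in[OF mc ab(1)] nb bI ab by auto
        have gab: "g a = {a, b}" "g b = {a, b}" using gg[OF ab(1)] bI ab by auto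
        have "a = t \<or> b = t"
          using inj T gab ne[OF ab(1)] by (metis DiffI inj_onD singletonD)
        then show ?thesis using gab gyt by metis
      qed
      obtain t' where t': "{z, t'} \<in> E" "z \<noteq> h" "t' \<noteq> h" using nbr[OF yz(2)] by blast
      have "z = t" using inside[OF t'] yz(3) by (auto simp: doubleton_eq_iff)
      then have yzE: "{y, z} \<in> E" using t by simp
      have 2: "short_chords P E" unfolding short_chords_def
      proof (intro allI impI)
        fix x' y' z' assume a: "branched E x'" "adj P x' y'" "adj P x' z'" "y' \<noteq> z'"
        have "x' = h" using a bI by blast
        then have "{y', z'} = {y, z}"
          using adj3[OF yz(1,2), of y'] adj3[OF yz(1,2), of z'] a yz(3) by auto
        then show "{y', z'} \<in> E" using yzE by simp
      qed
      have 3: "small_inside P E" unfolding small_inside_def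
      proof (intro allI impI)
        fix a b assume ab: "{a, b} \<in> E" "\<not> branched E a" "\<not> branched E b"
        then have "{a, b} = {y, z}" using inside bI \<open>z = t\<close> by blast
        then have "adj P h a \<and> adj P h b" using yz by (auto simp: doubleton_eq_iff)
        then show "\<exists>h. (\<forall>z. branched E z \<longleftrightarrow> z = h) \<and> adj P h a \<and> adj P h b" using bI by blast
      qed
      have 4: "crossing_adj P E" unfolding crossing_adj_def using bI cross_distinct by metis
      have 5: "branched_interval P E" unfolding branched_interval_def using bI cross_distinct by metis
      show ?thesis unfolding interval_shape_def using 2 3 4 5 bI hP by blast
    qed
    then show ?thesis using le' cT cT' 3 by linarith
  next
    case 4
    then have bI: "\<not> branched E z" for z using finT branched_in[OF mc] unfolding I_def by auto
    have "card (\<Union>E) = sum card E"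
    proof (rule card_Union_disjoint)
      show "pairwise disjnt E"
      proof (rule pairwiseI)
        fix e f assume ef: "e \<in> E" "f \<in> E" "e \<noteq> f"
        show "disjnt e f"
        proof (rule ccontr)
          assume "\<not> ?thesis"
          then obtain x where x: "x \<in> e" "x \<in> f" unfolding disjnt_def by blast
          obtain a where a: "e = {x, a}" using min_crossedD_form[OF mc ef(1)] x by auto
          obtain b where b: "f = {x, b}" using min_crossedD_form[OF mc ef(2)] x by auto
          show False using ef a b bigI bI by metis
        qed
      qed
      show "\<And>e. e \<in> E \<Longrightarrow> finite e" using min_crossedD_form[OF mc] by blast
    qed
    also have "\<dots> = sum (\<lambda>_. 2) E"
    proof (rule sum.cong[OF refl])
      fix e assume e: "e \<in> E"
      then obtain x y where xy: "e = {x, y}" using min_crossedD_form[OF mc] by blast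
      then show "card e = 2" using ne e by simp
    qed
    also have "\<dots> = 2 * card E" by simp
    also have "\<Union>E = P"
    proof
      show "\<Union>E \<subseteq> P" using min_crossedD_form[OF mc] unfolding diagonal_def by blast
      show "P \<subseteq> \<Union>E"
      proof
        fix r assume "r \<in> P"
        then show "r \<in> \<Union>E" using gE[of r] unfolding g_def by blast
      qed
    qed
    finally show ?thesis using n4 by linarith
  qed
qed

lemma cross_inner: "cross p q u v \<Longrightarrow> cross u p z q \<Longrightarrow> cross p q z v"
  unfolding cross_def by (smt (z3))

text \<open>A second brace at \<open>u\<close> does not cross \<open>pq\<close>. It ends strictly on the side of \<open>u\<close>, or it joins \<open>u\<close> to \<open>p\<close> or \<open>q\<close>, and
then it is a diagonal and cuts off another vertex there.\<close>
lemma branched_nontriv: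
  assumes mc: "min_crossed P E" and p: "p \<in> P" and q: "q \<in> P" and uv: "{u, v} \<in> E" and sep: "cross p q u v"
    and only: "\<And>a b. {a, b} \<in> E \<Longrightarrow> cross p q a b \<Longrightarrow> {a, b} = {u, v}" and b: "branched E u"
  shows "\<exists>a\<in>P. cross p q a v \<and> a \<noteq> u"
proof -
  have end_case: "\<exists>a\<in>P. cross p q a v \<and> a \<noteq> u" if e: "{u, p} \<in> E" "cross p q u v" "q \<in> P" for p q
  proof -
    obtain a b where ab: "a \<in> P" "b \<in> P" "cross u p a b" using min_crossedD_edge[OF mc e(1)] unfolding diagonal_def by blast
    have "q \<noteq> u" "q \<noteq> p" using cross_distinct[OF e(2)] by auto
    then have "cross u p a q \<or> cross u p q b" using cross_step[OF ab(3)] by blast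
    then obtain z where z: "z \<in> P" "cross u p z q" using ab cross_swap by blast
    have "z \<noteq> u" using cross_distinct[OF z(2)] by auto
    then show ?thesis using cross_inner[OF e(2) z(2)] z(1) by blast
  qed
  obtain w where w: "{u, w} \<in> E" "w \<noteq> v" using branched_edge[OF b] by blast
  have wP: "w \<in> P" "w \<noteq> u" using min_crossed_in[OF mc w(1)] by auto
  consider "w = p" | "w = q" | "w \<noteq> p" "w \<noteq> q" by blast
  then show ?thesis
  proof cases
    case 1 then show ?thesis using end_case[of p q] w sep q by blast
  next
    case 2 
    have "cross q p u v" using sep cross_flip by blast
    then show ?thesis using end_case[of q p] w p 2 cross_flip by blast
  next
    case 3
    have "\<not> cross p q u w"
    proof
      assume "cross p q u w"
      then have "{u, w} = {u, v}" using only w(1) by blast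
      then show False using w(2) by (auto simp: doubleton_eq_iff)
    qed
    then have "cross p q w v" using cross_step[OF sep 3] by blast
    then show ?thesis using wP by blast
  qed
qed

theorem extremal:
  assumes "min_crossed P E" "4 \<le> card P"
  shows "card E + 2 \<le> card P \<and> (card E + 2 = card P \<longrightarrow> 5 \<le> card P \<longrightarrow> interval_shape P E)"
  using assms
proof (induction "card P" arbitrary: P E rule: less_induct)
  case less
  note mc = less.prems(1) and n4 = less.prems(2)
  show ?case
  proof (cases "\<exists>u v. {u, v} \<in> E \<and> branched E u \<and> branched E v")
    case False
    then show ?thesis using star_case[OF mc n4] by blast
  next
    case True
    then obtain u v where uv: "{u, v} \<in> E" "branched E u" "branched E v" by blast
    let ?ok = "\<lambda>(p, q). p \<in> P \<and> q \<in> P \<and> cross p q u v \<and> (\<forall>a b. {a, b} \<in> E \<longrightarrow> cross p q a b \<longrightarrow> {a, b} = {u, v})"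
    let ?f = "\<lambda>(p, q). card {x \<in> P. cross p q x v}"
    obtain p0 q0 where "?ok (p0, q0)" using min_crossedD_crit[OF mc uv(1)] by auto
    from ex_has_least_nat[of ?ok, OF this, of ?f]
    obtain pq where pq: "?ok pq" "\<forall>y. ?ok y \<longrightarrow> ?f pq \<le> ?f y" by (elim exE conjE)
    obtain p q where pqe: "pq = (p, q)" by (cases pq)
    have p: "p \<in> P" "q \<in> P" "cross p q u v" 
      and only: "\<And>a b. {a, b} \<in> E \<Longrightarrow> cross p q a b \<Longrightarrow> {a, b} = {u, v}" using pq(1) pqe by auto
    have min: "card {x \<in> P. cross p q x v} \<le> card {x \<in> P. cross p' q' x v}"
      if "p' \<in> P" "q' \<in> P" "cross p' q' u v" "\<forall>a b. {a, b} \<in> E \<longrightarrow> cross p' q' a b \<longrightarrow> {a, b} = {u, v}" for p' q'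
      using pq(2)[rule_format, of "(p', q')"] that pqe by simp
    have comm: "{v, u} = {u, v}" by auto
    have vu: "{v, u} \<in> E" "cross p q v u"
      using uv(1) p(3) comm cross_swap by simp_all
    have only': "{a, b} = {v, u}" if "{a, b} \<in> E" "cross p q a b" for a b
      unfolding comm using only that by blast
    have sp: "critical_split P E p q u v"
      unfolding critical_split_def
      using mc p uv(1) only branched_nontriv[OF mc p(1,2) uv(1) p(3) only uv(2)]
        branched_nontriv[OF mc p(1,2) vu only' uv(3)] by blast
    note sp' = critical_split_swap[OF sp]
    let ?PA = "contraction P p q u v" and ?PB = "contraction P p q v u"
    let ?EA = "kept_edges P E p q u v" and ?EB = "kept_edges P E p q v u"
    have cP: "card ?PA + card ?PB = card P + 4" "5 \<le> card ?PA" "5 \<le> card ?PB"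
      using critical_split.card_parts[OF sp] critical_split.card_PA[OF sp] critical_split.card_PA[OF sp'] by auto
    have cE: "card ?EA + card ?EB = card E + (if {p, q} \<in> E then 2 else 1)"
      using critical_split.card_eparts[OF sp] .
    have IHA: "card F + 2 \<le> card ?PA \<and> (card F + 2 = card ?PA \<longrightarrow> interval_shape ?PA F)" if "min_crossed ?PA F" for F
      using less.hyps[of ?PA F] that cP by linarith
    have IHB: "card F + 2 \<le> card ?PB \<and> (card F + 2 = card ?PB \<longrightarrow> interval_shape ?PB F)" if "min_crossed ?PB F" for F
      using less.hyps[of ?PB F] that cP by linarith
    have jA: "jumped P E p q u v" using critical_split.min_jumped[OF sp min] by blast
    have mcA: "min_crossed ?PA ?EA" using critical_split.min_crossed_part[OF sp jA] .
    note A = IHA[OF mcA]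
    show ?thesis
    proof (cases "jumped P E p q v u")
      case jB: True
      have mcB: "min_crossed ?PB ?EB" using critical_split.min_crossed_part[OF sp' jB] .
      note B = IHB[OF mcB]
      show ?thesis
      proof (cases "{p, q} \<in> E")
        case True
        have "interval_shape P E" if "card E + 2 = card P"
          using interval_shape_glue_pq[OF sp True mcA _ mcB] A B that cE cP True by auto
        then show ?thesis using A B cE cP True by auto
      next
        case False
        have "\<not> interval_shape ?PA ?EA" using critical_split.not_tight[OF sp False jA jB] .
        moreover have "\<not> interval_shape ?PB ?EB" using critical_split.not_tight[OF sp' False jB jA] .
        ultimately show ?thesis using A B cE cP False by auto
      qed
    next
      case jB: False
      have n: "{p, q} \<notin> E" using critical_split.pq_jumped[OF sp'] jB by blast
      let ?F = "insert {p, q} ?EB"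
      have mcB: "min_crossed ?PB ?F" using critical_split.min_crossed_part'[OF sp' jB jA n] .
      note B = IHB[OF mcB]
      have "{p, q} \<notin> ?EB" using n critical_split.EA_E[OF sp'] by blast
      moreover have "finite ?EB" using min_crossed_fin_E[OF mcB] by simp
      ultimately have cF: "card ?F = card ?EB + 1" by simp
      have "interval_shape P E" if "card E + 2 = card P"
        using interval_shape_glue_asym[OF sp n jA _ mcB] A B that cE cP cF n by auto
      then show ?thesis using A B cE cP cF n by auto
    qed
  qed
qed

section \<open>Crossed diagonals and 3-connectivity\<close>

definition rep :: "int \<Rightarrow> int \<Rightarrow> int" where "rep n i = (i - 1) mod n + 1"

lemma rep_in: "1 \<le> n \<Longrightarrow> rep n i \<in> {1..n}"
proof -
  assume "1 \<le> n"
  then have "0 \<le> (i - 1) mod n" "(i - 1) mod n < n" by simp_all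
  then show ?thesis unfolding rep_def by simp
qed

lemma rep_id: "i \<in> {1..n} \<Longrightarrow> rep n i = i"
  unfolding rep_def by (simp add: mod_pos_pos_trivial)

lemma rep_shift: "rep n (i + n * k) = rep n i"
proof -
  have "(i + n * k - 1) = (i - 1) + n * k" by simp
  then show ?thesis unfolding rep_def by (metis mod_mult_self2)
qed

lemma rep_step: assumes "1 \<le> n" "0 < d" "d < n"
  shows "rep n (a + d) = rep n a + d \<or> rep n (a + d) = rep n a + d - n"
proof -
  have r: "rep n (a + d) = rep n (rep n a + d)"
    unfolding rep_def by (simp add: mod_add_left_eq algebra_simps) (metis add.commute mod_add_left_eq add_diff_eq diff_add_eq)
  have a: "1 \<le> rep n a" "rep n a \<le> n" using rep_in[OF assms(1), of a] by auto
  show ?thesis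
  proof (cases "rep n a + d \<le> n")
    case True
    then have "rep n (rep n a + d) = rep n a + d" using rep_id a assms by simp
    then show ?thesis using r by simp
  next
    case False
    have "rep n (rep n a + d) = rep n (rep n a + d - n)"
      using rep_shift[of n "rep n a + d - n" 1] by simp
    moreover have "rep n (rep n a + d - n) = rep n a + d - n" using rep_id False a assms by simp
    ultimately show ?thesis using r by simp
  qed
qed

lemma cross_rep_aux:
  fixes n A B C D :: int
  assumes "1 \<le> A" "A \<le> n" "1 \<le> B" "B \<le> n" "1 \<le> C" "C \<le> n" "1 \<le> D" "D \<le> n"
   "0 < x" "x < y" "y < z" "z < n" "B = A + x \<or> B = A + x - n" "C = A + y \<or> C = A + y - n" "D = A + z \<or> D = A + z - n"
  shows "cross A C B D"
  using assms unfolding cross_def by (smt (z3))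

lemma cross_rep: assumes "a < b" "b < c" "c < d" "d < a + n"
  shows "cross (rep n a) (rep n c) (rep n b) (rep n d)"
proof -
  have n: "1 \<le> n" using assms by linarith
  have s: "rep n t = rep n a + (t - a) \<or> rep n t = rep n a + (t - a) - n" if "a < t" "t < a + n" for t
    using rep_step[OF n, of "t - a" a] that by simp
  have r: "1 \<le> rep n t \<and> rep n t \<le> n" for t using rep_in[OF n, of t] by simp
  show ?thesis
    using cross_rep_aux[of "rep n a" n "rep n b" "rep n c" "rep n d" "b - a" "c - a" "d - a"]
      s[of b] s[of c] s[of d] r assms by simp
qed

lemma adj_interval:
  assumes "3 \<le> n" 
  shows "adj {1..n} i j \<longleftrightarrow> i \<in> {1..n} \<and> j \<in> {1..n} \<and> (j = i + 1 \<or> i = j + 1 \<or> (i = 1 \<and> j = n) \<or> (i = n \<and> j = 1))"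
    (is "?L \<longleftrightarrow> ?R")
proof
  assume ?R
  then show ?L
  proof -
    assume R: ?R
    have "\<not> cross i j a b" if "a \<in> {1..n}" "b \<in> {1..n}" for a b
      using R that assms unfolding cross_def atLeastAtMost_iff by (smt (z3))
    moreover have "i \<noteq> j" using R assms by auto
    ultimately show ?L using R unfolding adj_def by blast
  qed
next
  assume L: ?L
  have in1: "\<not> cross i j a b" if "1 \<le> a" "a \<le> n" "1 \<le> b" "b \<le> n" for a b
    using adjD[OF L, of a b] that by simp
  have ij: "1 \<le> i" "i \<le> n" "1 \<le> j" "j \<le> n" "i \<noteq> j" using adj_in[OF L] by auto
  have "\<not> cross i j (i + 1) 1 \<or> i = n" "\<not> cross i j (i + 1) n \<or> i = n"
    using in1[of "i + 1" 1] in1[of "i + 1" n] ij assms by (cases "i = n"; simp)+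
  moreover have "\<not> cross i j (j + 1) 1 \<or> j = n" "\<not> cross i j (j + 1) n \<or> j = n"
    using in1[of "j + 1" 1] in1[of "j + 1" n] ij assms by (cases "j = n"; simp)+
  ultimately show ?R using ij assms unfolding cross_def atLeastAtMost_iff by (smt (z3))
qed

lemma adj_rep: assumes "3 \<le> n" shows "adj {1..n} (rep n i) (rep n (i + 1))"
proof -
  have n: "1 \<le> n" using assms by simp
  have "rep n (i + 1) = rep n i + 1 \<or> rep n (i + 1) = rep n i + 1 - n"
    using rep_step[OF n, of 1 i] assms by simp
  then show ?thesis unfolding adj_interval[OF assms] using rep_in[OF n, of i] rep_in[OF n, of "i + 1"] by auto
qed

text \<open>Edges are transported to sets of indices, where the cyclic order is that of the integers.\<close>
definition pairs :: "(int \<Rightarrow> 'a) \<Rightarrow> int \<Rightarrow> 'a set set \<Rightarrow> int set set" where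
  "pairs v n F = {e. \<exists>i\<in>{1..n}. \<exists>j\<in>{1..n}. e = {i, j} \<and> {v i, v j} \<in> F}"

lemma pairs_iff: "{i, j} \<in> pairs v n F \<longleftrightarrow> i \<in> {1..n} \<and> j \<in> {1..n} \<and> {v i, v j} \<in> F"
proof
  assume "{i, j} \<in> pairs v n F"
  then obtain a b where ab: "a \<in> {1..n}" "b \<in> {1..n}" "{i, j} = {a, b}" "{v a, v b} \<in> F"
    unfolding pairs_def by blast
  have "{v i, v j} = v ` {i, j}" by simp
  also have "\<dots> = {v a, v b}" unfolding ab(3) by simp
  finally have "{v i, v j} \<in> F" using ab(4) by simp
  moreover have "i \<in> {a, b}" "j \<in> {a, b}" using ab(3) by blast+
  ultimately show "i \<in> {1..n} \<and> j \<in> {1..n} \<and> {v i, v j} \<in> F" using ab(1,2) by auto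
next
  assume "i \<in> {1..n} \<and> j \<in> {1..n} \<and> {v i, v j} \<in> F"
  then show "{i, j} \<in> pairs v n F" unfolding pairs_def by blast
qed

locale labelled =
  fixes V :: "'a set" and H :: "'a set set" and v :: "int \<Rightarrow> 'a" and n :: int
  assumes lab: "cyclic_labelling V H v" and n: "n = int (card V)" and n3: "3 \<le> n"
begin

abbreviation "P \<equiv> {1..n}"

lemma per: "v (i + n) = v i" using lab n unfolding cyclic_labelling_def by simp

lemma bij: "bij_betw v P V" using lab n unfolding cyclic_labelling_def by simp

lemma Hdef: "H = {{v i, v (i + 1)} | i. i \<in> P}" using lab n unfolding cyclic_labelling_def by simp

lemma per_mult: "v (i + n * k) = v i"
proof (induction k rule: int_induct[where k = 0])
  case base then show ?case by simp
next
  case (step1 k) then show ?case using per[of "i + n * k"] by (simp add: algebra_simps)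
next
  case (step2 k) then show ?case using per[of "i + n * (k - 1)"] by (simp add: algebra_simps)
qed

lemma v_rep: "v (rep n i) = v i"
proof -
  have "i = rep n i + n * ((i - 1) div n)" unfolding rep_def
    using mod_mult_div_eq[of "i - 1" n] by linarith
  then show ?thesis using per_mult[of "rep n i" "(i - 1) div n"] by simp
qed

lemma repP: "rep n i \<in> P" using rep_in n3 by simp

lemma inj: "i \<in> P \<Longrightarrow> j \<in> P \<Longrightarrow> v i = v j \<Longrightarrow> i = j"
  using bij unfolding bij_betw_def by (meson inj_onD)

lemma inj_near: "i < j \<Longrightarrow> j < i + n \<Longrightarrow> v i \<noteq> v j"
proof
  assume ij: "i < j" "j < i + n" "v i = v j"
  then have "rep n i = rep n j" using inj repP v_rep by metis
  moreover have "rep n j = rep n i + (j - i) \<or> rep n j = rep n i + (j - i) - n"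
    using rep_step[of n "j - i" i] ij n3 by simp
  ultimately show False using ij by linarith
qed

lemma vV: "v i \<in> V" using bij repP v_rep unfolding bij_betw_def by (metis imageI)

lemma ex_index: "x \<in> V \<Longrightarrow> \<exists>i\<in>P. x = v i" using bij unfolding bij_betw_def by blast

lemma finV: "finite V" using n n3 card.infinite by fastforce

lemma H_rep: "{v i, v (i + 1)} \<in> H"
proof -
  have "v (rep n i + 1) = v (i + 1)"
  proof -
    have "i = rep n i + n * ((i - 1) div n)" unfolding rep_def
      using mod_mult_div_eq[of "i - 1" n] by linarith
    then show ?thesis using per_mult[of "rep n i + 1" "(i - 1) div n"] by (simp add: algebra_simps)
  qed
  then show ?thesis unfolding Hdef using repP[of i] v_rep[of i] by (metis (mono_tags, lifting) mem_Collect_eq)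
qed

lemma doubleton_v: assumes "i \<in> P" "j \<in> P" "a \<in> P" "b \<in> P" "{v i, v j} = {v a, v b}" shows "{i, j} = {a, b}"
proof -
  have "(v i = v a \<and> v j = v b) \<or> (v i = v b \<and> v j = v a)" using assms(5) by (simp add: doubleton_eq_iff)
  then have "(i = a \<and> j = b) \<or> (i = b \<and> j = a)" using inj assms(1-4) by blast
  then show ?thesis by (auto simp: doubleton_eq_iff)
qed

lemma H_iff: assumes "i \<in> P" "j \<in> P" shows "{v i, v j} \<in> H \<longleftrightarrow> adj P i j"
proof
  assume "{v i, v j} \<in> H"
  then obtain t where t: "{v i, v j} = {v t, v (t + 1)}" unfolding Hdef by blast
  then have "{v i, v j} = {v (rep n t), v (rep n (t + 1))}" using v_rep by simp
  then have "{i, j} = {rep n t, rep n (t + 1)}" using doubleton_v[OF assms repP repP] by blast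
  then show "adj P i j" using adj_rep[OF n3, of t] adj_sym by (metis doubleton_eq_iff)
next
  assume "adj P i j"
  then consider "j = i + 1" | "i = j + 1" | "i = 1" "j = n" | "i = n" "j = 1"
    unfolding adj_interval[OF n3] by blast
  then show "{v i, v j} \<in> H"
  proof cases
    case 1 then show ?thesis using H_rep by simp
  next
    case 2 then show ?thesis using H_rep[of j] by (simp add: insert_commute)
  next
    case 3 
    have "v 1 = v (n + 1)" using per[of 1] by (simp add: add.commute)
    then show ?thesis using H_rep[of n] 3 by (simp add: insert_commute)
  next
    case 4
    have "v 1 = v (n + 1)" using per[of 1] by (simp add: add.commute)
    then show ?thesis using H_rep[of n] 4 by simp
  qed
qed

lemma diagonal_iff_H: assumes "i \<in> P" "j \<in> P" "i \<noteq> j" shows "diagonal P i j \<longleftrightarrow> {v i, v j} \<notin> H"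
  using H_iff[OF assms(1,2)] diagonal_iff[OF assms] by blast

text \<open>Without a crossing edge, the open side of \<open>pq\<close> containing \<open>a\<close> is closed under the edges that remain
after the removal of the ends of \<open>pq\<close>.\<close>
lemma three_connected_crossed:
  assumes c: "three_connected V F" and F: "simple_graph V F" and pq: "diagonal P p q"
  shows "\<exists>i\<in>P. \<exists>j\<in>P. {v i, v j} \<in> F \<and> cross p q i j"
proof (rule ccontr)
  assume no: "\<not> ?thesis"
  obtain a b where ab: "p \<in> P" "q \<in> P" "a \<in> P" "b \<in> P" "cross p q a b" using pq unfolding diagonal_def by blast
  let ?S = "{v p, v q}"
  let ?R = "{(x, y). {x, y} \<in> {e \<in> F. e \<subseteq> V - ?S}}"
  define X where "X = {v i | i. i \<in> P \<and> i \<noteq> p \<and> i \<noteq> q \<and> \<not> cross p q a i}"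
  have ne: "a \<noteq> p" "a \<noteq> q" "b \<noteq> p" "b \<noteq> q" using cross_distinct[OF ab(5)] by auto
  have "card ?S < 3" by (simp add: card_insert_if)
  then have con: "connected_graph (V - ?S) {e \<in> F. e \<subseteq> V - ?S}"
    using c vV unfolding three_connected_def by simp
  have "v a \<in> V - ?S" "v b \<in> V - ?S" using inj ab ne vV by blast+
  then have "(v a, v b) \<in> ?R\<^sup>*" using con unfolding connected_graph_def by blast
  moreover have "v a \<in> X" unfolding X_def using ab ne cross_distinct by blast
  ultimately have "v b \<in> X"
  proof (induction rule: rtrancl_induct)
    case (step y z)
    then obtain i where i: "y = v i" "i \<in> P" "i \<noteq> p" "i \<noteq> q" "\<not> cross p q a i" unfolding X_def by blast
    have yz: "{y, z} \<in> F" "z \<in> V" "z \<notin> ?S" using step(2) by auto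
    obtain j where j: "j \<in> P" "z = v j" using ex_index[OF yz(2)] by blast
    have jn: "j \<noteq> p" "j \<noteq> q" using yz(3) j by auto
    have "\<not> cross p q i j" using no i j yz(1) by blast
    then have "\<not> cross p q a j" using cross_step[of p q a j i] i by blast
    then show ?case unfolding X_def using j jn by blast
  qed
  then obtain i where "v b = v i" "i \<in> P" "\<not> cross p q a i" unfolding X_def by blast
  then show False using inj ab by blast
qed

text \<open>Two vertices in different components split the cycle into two arcs, each of which meets
the removed set. So that set consists of one vertex on either arc, the two remaining arcs are connected by boundary
edges, and an edge crossing the diagonal joins them.\<close>
lemma crossed_three_connected:
  assumes n4: "4 \<le> n" and HF: "H \<subseteq> F" and F: "simple_graph V F"
    and cross: "\<And>p q. diagonal P p q \<Longrightarrow> \<exists>i\<in>P. \<exists>j\<in>P. {v i, v j} \<in> F \<and> cross p q i j"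
  shows "three_connected V F"
  unfolding three_connected_def
proof (intro conjI allI impI)
  show "3 < card V" using n n4 by linarith
  fix S assume S: "S \<subseteq> V \<and> card S < 3"
  have finS: "finite S" using S finV finite_subset by blast
  let ?R = "{(x, y). {x, y} \<in> {e \<in> F. e \<subseteq> V - S}}"
  show "connected_graph (V - S) {e \<in> F. e \<subseteq> V - S}"
    unfolding connected_graph_def
  proof (intro conjI ballI)
    show "V - S \<noteq> {}"
    proof
      assume "V - S = {}"
      then have "card V \<le> card S" using card_mono[OF finS, of V] by blast
      then show False using S n n4 by linarith
    qed
    fix x y assume x: "x \<in> V - S" and y: "y \<in> V - S"
    define C where "C = {z. (x, z) \<in> ?R\<^sup>*}"
    show "(x, y) \<in> ?R\<^sup>*"
    proof (rule ccontr)
      assume "\<not> ?thesis"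
      then have yC: "y \<notin> C" unfolding C_def by simp
      have xC: "x \<in> C" unfolding C_def by simp
      have stepC: "z \<in> C" if "w \<in> C" "w \<notin> S" "z \<notin> S" "{w, z} \<in> F" for w z
      proof -
        have "{w, z} \<subseteq> V" using F that(4) unfolding simple_graph_def by blast
        then have "(w, z) \<in> ?R" using that by auto
        then show ?thesis using that(1) unfolding C_def by (simp add: rtrancl.rtrancl_into_rtrancl)
      qed
      have up: "v j \<in> C" if "i \<le> j" "v i \<in> C" "\<And>t. i \<le> t \<Longrightarrow> t \<le> j \<Longrightarrow> v t \<notin> S" for i j
        using that
      proof (induction j rule: int_ge_induct)
        case base then show ?case by simp
      next
        case (step j)
        have "v j \<in> C" using step by simp
        moreover have "{v j, v (j + 1)} \<in> F" using H_rep HF by blast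
        ultimately show ?case using stepC step by simp
      qed
      have down: "v i \<in> C" if "i \<le> j" "v j \<in> C" "\<And>t. i \<le> t \<Longrightarrow> t \<le> j \<Longrightarrow> v t \<notin> S" for i j
        using that
      proof (induction i rule: int_le_induct)
        case base then show ?case by simp
      next
        case (step i)
        have "v i \<in> C" using step by simp
        moreover have "{v i, v (i - 1)} \<in> F" using H_rep[of "i - 1"] HF by (auto simp: insert_commute)
        ultimately show ?case using stepC step by simp
      qed
      obtain c where c: "c \<in> P" "x = v c" using ex_index x by blast
      obtain d0 where d0: "d0 \<in> P" "y = v d0" using ex_index y by blast
      have "c \<noteq> d0" using c d0 xC yC by blast
      have "\<exists>d. c < d \<and> d < c + n \<and> y = v d"
      proof (cases "c < d0")
        case True then show ?thesis using d0 c by (intro exI[of _ d0]) auto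
      next
        case False then show ?thesis using d0 c per[of d0] \<open>c \<noteq> d0\<close> by (intro exI[of _ "d0 + n"]) auto
      qed
      then obtain d where d: "c < d" "d < c + n" "y = v d" by blast
      have vcn: "v (c + n) = x" using per c by simp
      have "\<exists>t. c \<le> t \<and> t \<le> d \<and> v t \<in> S"
        using up[of c d] d c xC yC by force
      then obtain p where "c \<le> p" "p \<le> d" "v p \<in> S" by blast
      moreover from this have "p \<noteq> c" "p \<noteq> d" using x y c d by auto
      ultimately have p: "c < p" "p < d" "v p \<in> S" by auto
      have "\<exists>t. d \<le> t \<and> t \<le> c + n \<and> v t \<in> S"
        using down[of d "c + n"] d vcn xC yC by force
      then obtain q where "d \<le> q" "q \<le> c + n" "v q \<in> S" by blast
      moreover from this have "q \<noteq> c + n" "q \<noteq> d" using x y vcn d by auto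
      ultimately have q: "d < q" "q < c + n" "v q \<in> S" by auto
      have "v p \<noteq> v q" using inj_near[of p q] p q by simp
      then have "card {v p, v q} = 2" by simp
      moreover have "{v p, v q} \<subseteq> S" using p q by blast
      ultimately have Seq: "S = {v p, v q}"
        using card_seteq[OF finS, of "{v p, v q}"] S by simp
      have notS: "v t \<notin> S" if "p < t" "t < p + n" "t \<noteq> q" for t
      proof -
        have "v t \<noteq> v p" using inj_near[of p t] that by metis
        moreover have "v t \<noteq> v q"
          using inj_near[of q t] inj_near[of t q] that p q by (cases "t < q") auto
        ultimately show ?thesis using Seq by simp
      qed
      have crA: "cross (rep n p) (rep n q) (rep n t) (rep n (c + n))" if "p < t" "t < q" for t
        using cross_rep[of p t q "c + n" n] that q p by simp
      have crB: "cross (rep n p) (rep n q) (rep n d) (rep n t)" if "q < t" "t < p + n" for t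
        using cross_rep[of p d q t n] that q p by simp
      have "diagonal P (rep n p) (rep n q)" unfolding diagonal_def using repP crA[of d] p q by blast
      then obtain i j where ij: "i \<in> P" "j \<in> P" "{v i, v j} \<in> F" "cross (rep n p) (rep n q) i j"
        using cross by blast
      have lift: "\<exists>t. p < t \<and> t < p + n \<and> t \<noteq> q \<and> rep n t = i" if "i \<in> P" "i \<noteq> rep n p" "i \<noteq> rep n q" for i
      proof -
        let ?t = "p + (i - p) mod n"
        have "?t = i + n * (- ((i - p) div n))" using mod_mult_div_eq[of "i - p" n] by (simp add: algebra_simps)
        then have r: "rep n ?t = i" using rep_shift rep_id[OF that(1)] by metis
        moreover have "0 \<le> (i - p) mod n" "(i - p) mod n < n" using n3 by simp_all
        ultimately show ?thesis using that by (intro exI[of _ ?t]) (smt (verit))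
      qed
      have main: False if a: "p < s" "s < q" and b: "q < t" "t < p + n" and st: "{v s, v t} \<in> F" for s t
      proof -
        have "v t \<in> C"
        proof (cases "t \<le> c + n")
          case True
          show ?thesis by (rule down[OF True]) (use vcn xC notS b p q in auto)
        next
          case False
          show ?thesis by (rule up[of "c + n"]) (use False vcn xC notS b p q in auto)
        qed
        then have "v s \<in> C" using stepC[of "v t" "v s"] notS a b p q st by (auto simp: insert_commute)
        then have "v d \<in> C"
        proof (cases "s \<le> d")
          case True
          show ?thesis by (rule up[OF True \<open>v s \<in> C\<close>]) (use notS a p q in auto)
        next
          case False
          show ?thesis by (rule down[of d s]) (use False \<open>v s \<in> C\<close> notS a p q in auto)
        qed
        then show False using yC d by simp
      qed
      have ine: "i \<noteq> rep n p" "i \<noteq> rep n q" "j \<noteq> rep n p" "j \<noteq> rep n q" using cross_distinct[OF ij(4)] by auto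
      obtain s where s: "p < s" "s < p + n" "s \<noteq> q" "rep n s = i" using lift[OF ij(1) ine(1,2)] by blast
      obtain t where t: "p < t" "t < p + n" "t \<noteq> q" "rep n t = j" using lift[OF ij(2) ine(3,4)] by blast
      have st: "{v s, v t} \<in> F" "{v t, v s} \<in> F" using ij(3) s(4) t(4) v_rep[of s] v_rep[of t] by (auto simp: insert_commute)
      consider "s < q" "t < q" | "q < s" "q < t" | "s < q" "q < t" | "q < s" "t < q" using s t by linarith
      then show False
      proof cases
        case 1
        have "cross (rep n p) (rep n q) i (rep n (c + n))" "cross (rep n p) (rep n q) j (rep n (c + n))"
          using crA[of s] crA[of t] s t 1 by auto
        then show False using ij(4) cross_not2 cross_swap by blast
      next
        case 2
        have "cross (rep n p) (rep n q) (rep n d) i" "cross (rep n p) (rep n q) (rep n d) j"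
          using crB[of s] crB[of t] s t 2 by auto
        then show False using ij(4) cross_not2 cross_swap by blast
      next
        case 3 then show False using main s t st by blast
      next
        case 4 then show False using main[of t s] s t st by blast
      qed
    qed
  qed
qed

end

section \<open>Minimality implies the unique interval property\<close>

context labelled
begin

lemma rotate: "labelled V H (\<lambda>i. v (i + s)) n"
proof
  show "n = int (card V)" "3 \<le> n" using n n3 .
  let ?w = "\<lambda>i. v (i + s)"
  have idx: "\<exists>i\<in>P. v (i + s) = v t \<and> v (i + 1 + s) = v (t + 1)" for t
  proof -
    have "t - s = rep n (t - s) + n * ((t - s - 1) div n)" unfolding rep_def
      using mod_mult_div_eq[of "t - s - 1" n] by linarith
    then have e: "t = rep n (t - s) + s + n * ((t - s - 1) div n)" by linarith
    have "v t = v (rep n (t - s) + s)" using per_mult e by metis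
    moreover have "v (t + 1) = v (rep n (t - s) + 1 + s)"
      using per_mult[of "rep n (t - s) + 1 + s" "(t - s - 1) div n"] e by (simp add: algebra_simps)
    ultimately show ?thesis using repP by metis
  qed
  show "cyclic_labelling V H ?w"
    unfolding cyclic_labelling_def
  proof (intro conjI allI)
    show "v (i + int (card V) + s) = v (i + s)" for i
      using per[of "i + s"] n by (simp add: algebra_simps)
    have "inj_on ?w P"
    proof (rule inj_onI)
      fix i j assume ij: "i \<in> P" "j \<in> P" "v (i + s) = v (j + s)"
      then show "i = j"
        using inj_near[of "i + s" "j + s"] inj_near[of "j + s" "i + s"] by (cases i j rule: linorder_cases) auto
    qed
    moreover have "?w ` P = V"
    proof
      show "?w ` P \<subseteq> V" using vV by blast
      show "V \<subseteq> ?w ` P"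
      proof
        fix x assume "x \<in> V"
        then obtain t where "x = v t" using ex_index by blast
        then show "x \<in> ?w ` P" using idx[of t] by (metis image_eqI)
      qed
    qed
    ultimately show "bij_betw ?w {1..int (card V)} V" unfolding bij_betw_def using n by simp
    show "H = {{v (i + s), v (i + 1 + s)} | i. i \<in> {1..int (card V)}}"
    proof
      show "H \<subseteq> {{v (i + s), v (i + 1 + s)} | i. i \<in> {1..int (card V)}}"
      proof
        fix h assume "h \<in> H"
        then obtain t where h: "h = {v t, v (t + 1)}" unfolding Hdef by blast
        obtain i where "i \<in> P" "v (i + s) = v t" "v (i + 1 + s) = v (t + 1)" using idx by blast
        then show "h \<in> {{v (i + s), v (i + 1 + s)} | i. i \<in> {1..int (card V)}}"
          using h n by (intro CollectI exI[of _ i]) simp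
      qed
      show "{{v (i + s), v (i + 1 + s)} | i. i \<in> {1..int (card V)}} \<subseteq> H"
      proof
        fix h assume "h \<in> {{v (i + s), v (i + 1 + s)} | i. i \<in> {1..int (card V)}}"
        then obtain i where "h = {v (i + s), v (i + 1 + s)}" by blast
        then show "h \<in> H" using H_rep[of "i + s"] by (simp add: algebra_simps)
      qed
    qed
  qed
qed

end

locale polygon = labelled V H v n for V :: "'a set" and H v n +
  fixes E :: "'a set set"
  assumes E: "simple_graph V E" and HE: "H \<subseteq> E" and cE: "int (card E) = 2 * n - 2"
begin

abbreviation "B \<equiv> pairs v n (E - H)"

lemma B_iff: "{i, j} \<in> B \<longleftrightarrow> i \<in> P \<and> j \<in> P \<and> {v i, v j} \<in> E \<and> {v i, v j} \<notin> H"
  unfolding pairs_iff by blast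

lemma edge_ne: "{x, y} \<in> E \<Longrightarrow> x \<noteq> y \<and> x \<in> V \<and> y \<in> V"
  using E unfolding simple_graph_def by fastforce

lemma B_chord: "{i, j} \<in> B \<Longrightarrow> diagonal P i j"
  using diagonal_iff_H[of i j] edge_ne unfolding B_iff by blast

lemma diagonal_B: "diagonal P i j \<Longrightarrow> {v i, v j} \<in> E \<Longrightarrow> {i, j} \<in> B"
  using diagonal_iff_H[of i j] B_iff unfolding diagonal_def by (metis edge_ne)

lemma B_form: "e \<in> B \<Longrightarrow> \<exists>i j. e = {i, j} \<and> diagonal P i j"
  using B_chord unfolding pairs_def by blast

lemma edge_index: assumes "e \<in> E" shows "\<exists>i\<in>P. \<exists>j\<in>P. e = {v i, v j}"
proof -
  have "card e = 2" "e \<subseteq> V" using E assms unfolding simple_graph_def by auto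
  then obtain x y where "e = {x, y}" "x \<in> V" "y \<in> V" by (auto simp: card_2_iff)
  then show ?thesis using ex_index by metis
qed

lemma finE: "finite E" using E finV unfolding simple_graph_def by (meson Pow_iff finite_Pow_iff finite_subset subsetI)

lemma finB: "finite B"
proof -
  have "B \<subseteq> Pow P" unfolding pairs_def by auto
  then show ?thesis using finite_subset by blast
qed

lemma cH: "int (card H) = n"
proof -
  have H: "H = (\<lambda>i. {v i, v (i + 1)}) ` P" unfolding Hdef by blast
  have key: False if "i < j" "j < i + n" "v i = v (j + 1)" "v j = v (i + 1)" for i j
  proof (cases "j + 1 < i + n")
    case True then show ?thesis using inj_near[of i "j + 1"] that by simp
  next
    case False
    then have "i + 1 < j" "j < i + 1 + n" using that n3 by linarith+
    then show ?thesis using inj_near[of "i + 1" j] that by simp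
  qed
  have "inj_on (\<lambda>i. {v i, v (i + 1)}) P"
  proof (rule inj_onI)
    fix i j assume ij: "i \<in> P" "j \<in> P" "{v i, v (i + 1)} = {v j, v (j + 1)}"
    show "i = j"
    proof (rule ccontr)
      assume ne: "i \<noteq> j"
      then have "v i = v (j + 1)" "v j = v (i + 1)" using ij inj by (auto simp: doubleton_eq_iff)
      then show False using key[of i j] key[of j i] ij ne by force
    qed
  qed
  then have "card H = card P" unfolding H by (rule card_image)
  then show ?thesis using n3 by simp
qed

lemma cB: "int (card B) = n - 2"
proof -
  have "bij_betw (image v) B (E - H)"
    unfolding bij_betw_def
  proof
    show "inj_on (image v) B"
    proof (rule inj_onI)
      fix e f assume "e \<in> B" "f \<in> B" "v ` e = v ` f"
      moreover have "e \<subseteq> P" "f \<subseteq> P" using calculation unfolding pairs_def by auto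
      ultimately show "e = f" using bij unfolding bij_betw_def by (meson inj_on_image_eq_iff)
    qed
    show "image v ` B = E - H"
    proof
      show "image v ` B \<subseteq> E - H" unfolding pairs_def by auto
      show "E - H \<subseteq> image v ` B"
      proof
        fix e assume e: "e \<in> E - H"
        then obtain i j where ij: "i \<in> P" "j \<in> P" "e = {v i, v j}" using edge_index by blast
        then have "{i, j} \<in> B" using e B_iff by blast
        moreover have "e = v ` {i, j}" using ij by simp
        ultimately show "e \<in> image v ` B" by blast
      qed
    qed
  qed
  then have "card B = card (E - H)" by (rule bij_betw_same_card)
  also have "\<dots> = card E - card H" using card_Diff_subset HE finE finite_subset by metis
  finally show ?thesis using cE cH card_mono[OF finE HE] by simp
qed

lemma nbrs_v: assumes i: "i \<in> P" shows "{e \<in> H. v i \<in> e} = {{v i, v (i + 1)}, {v (i - 1), v i}}"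
proof
  show "{{v i, v (i + 1)}, {v (i - 1), v i}} \<subseteq> {e \<in> H. v i \<in> e}"
    using H_rep[of i] H_rep[of "i - 1"] by auto
  show "{e \<in> H. v i \<in> e} \<subseteq> {{v i, v (i + 1)}, {v (i - 1), v i}}"
  proof
    fix e assume e: "e \<in> {e \<in> H. v i \<in> e}"
    then obtain t where t: "t \<in> P" "e = {v t, v (t + 1)}" unfolding Hdef by blast
    then consider "v i = v t" | "v i = v (t + 1)" using e by blast
    then show "e \<in> {{v i, v (i + 1)}, {v (i - 1), v i}}"
    proof cases
      case 1 then show ?thesis using inj i t by blast
    next
      case 2
      have "v t = v (i - 1)"
      proof (cases "t + 1 \<le> n")
        case True
        then have "t + 1 \<in> P" using t(1) by simp
        then have "i = t + 1" using inj[OF i _ 2] by blast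
        then show ?thesis by simp
      next
        case False
        then have "t = n" using t by simp
        then have "v i = v 1" using 2 per[of 1] by (simp add: add.commute)
        then have "i = 1" using inj[of i 1] i n3 by simp
        then show ?thesis using \<open>t = n\<close> per[of 0] by simp
      qed
      then show ?thesis using t 2 by simp
    qed
  qed
qed

lemma finN: "finite {j. {i, j} \<in> B}"
proof -
  have "{j. {i, j} \<in> B} \<subseteq> P" unfolding B_iff by blast
  then show ?thesis using finite_subset by blast
qed

lemma degree_braces: assumes i: "i \<in> P" shows "degree E (v i) = 2 + card {j. {i, j} \<in> B}"
proof -
  have "v (i - 1) \<noteq> v i" "v i \<noteq> v (i + 1)" "v (i - 1) \<noteq> v (i + 1)"
    using inj_near n3 by simp_all
  then have "{v i, v (i + 1)} \<noteq> {v (i - 1), v i}" by (auto simp: doubleton_eq_iff)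
  then have h: "card {e \<in> H. v i \<in> e} = 2" unfolding nbrs_v[OF i] by simp
  have "{e \<in> E - H. v i \<in> e} = (\<lambda>j. {v i, v j}) ` {j. {i, j} \<in> B}"
  proof
    show "(\<lambda>j. {v i, v j}) ` {j. {i, j} \<in> B} \<subseteq> {e \<in> E - H. v i \<in> e}" using B_iff by auto
    show "{e \<in> E - H. v i \<in> e} \<subseteq> (\<lambda>j. {v i, v j}) ` {j. {i, j} \<in> B}"
    proof
      fix e assume e: "e \<in> {e \<in> E - H. v i \<in> e}"
      then obtain a b where ab: "a \<in> P" "b \<in> P" "e = {v a, v b}" using edge_index by blast
      then have "i = a \<or> i = b" using e inj i by blast
      then obtain j where "j \<in> P" "e = {v i, v j}" using ab by (metis insert_commute)
      moreover from this have "{i, j} \<in> B" using e B_iff i by blast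
      ultimately show "e \<in> (\<lambda>j. {v i, v j}) ` {j. {i, j} \<in> B}" by blast
    qed
  qed
  moreover have inj_nb: "inj_on (\<lambda>j. {v i, v j}) {j. {i, j} \<in> B}"
  proof (rule inj_onI)
    fix a b assume "a \<in> {j. {i, j} \<in> B}" "b \<in> {j. {i, j} \<in> B}" "{v i, v a} = {v i, v b}"
    then show "a = b" using inj B_iff by (auto simp: doubleton_eq_iff)
  qed
  ultimately have b: "card {e \<in> E - H. v i \<in> e} = card {j. {i, j} \<in> B}"
    by (simp only: card_image)
  have "{e \<in> E. v i \<in> e} = {e \<in> H. v i \<in> e} \<union> {e \<in> E - H. v i \<in> e}" using HE by blast
  moreover have "card ({e \<in> H. v i \<in> e} \<union> {e \<in> E - H. v i \<in> e}) = card {e \<in> H. v i \<in> e} + card {e \<in> E - H. v i \<in> e}"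
    by (rule card_Un_disjoint) (use finE finite_subset[OF HE finE] in auto)
  ultimately show ?thesis unfolding degree_def using h b by simp
qed

lemma branched_iff: assumes i: "i \<in> P" shows "branched B i \<longleftrightarrow> 4 \<le> degree E (v i)"
proof -
  have "4 \<le> degree E (v i) \<longleftrightarrow> \<not> card {j. {i, j} \<in> B} \<le> Suc 0"
    unfolding degree_braces[OF i] by auto
  also have "\<dots> \<longleftrightarrow> branched B i" unfolding card_le_Suc0_iff_eq[OF finN] branched_def by blast
  finally show ?thesis by simp
qed

lemma cross_chord: assumes "cross p q i j" "p \<in> P" "q \<in> P" "i \<in> P" "j \<in> P" shows "diagonal P i j"
  using assms cross_dual unfolding diagonal_def by blast

lemma minimal_mc:
  assumes m: "minimally_3_connected V E H"
  shows "min_crossed P B"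
proof (rule min_crossedI)
  show "finite P" by simp
  show "\<And>e. e \<in> B \<Longrightarrow> \<exists>x y. e = {x, y} \<and> diagonal P x y" by (rule B_form)
  have c3: "three_connected V E" and crit: "\<And>e. e \<in> E - H \<Longrightarrow> \<not> three_connected V (E - {e})"
    using m unfolding minimally_3_connected_def by auto
  have n4: "4 \<le> n" using c3 n unfolding three_connected_def by linarith
  show conn: "\<exists>x y. {x, y} \<in> B \<and> cross p q x y" if "diagonal P p q" for p q
  proof -
    obtain i j where ij: "i \<in> P" "j \<in> P" "{v i, v j} \<in> E" "cross p q i j"
      using three_connected_crossed[OF c3 E \<open>diagonal P p q\<close>] by blast
    moreover have "diagonal P i j" using cross_chord[OF ij(4)] ij \<open>diagonal P p q\<close> unfolding diagonal_def by blast
    ultimately show ?thesis using diagonal_B by blast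
  qed
  fix x y assume xy: "{x, y} \<in> B"
  let ?e = "{v x, v y}"
  have e: "?e \<in> E - H" "x \<in> P" "y \<in> P" using xy B_iff by blast+
  have "simple_graph V (E - {?e})" "H \<subseteq> E - {?e}" using E HE e unfolding simple_graph_def by auto
  then obtain p q where pq: "diagonal P p q" and no: "\<And>i j. i \<in> P \<Longrightarrow> j \<in> P \<Longrightarrow> {v i, v j} \<in> E - {?e} \<Longrightarrow> \<not> cross p q i j"
    using crossed_three_connected[OF n4, of "E - {?e}"] crit[OF e(1)] by blast
  have only: "{a, b} = {x, y}" if "{a, b} \<in> B" "cross p q a b" for a b
  proof -
    have "a \<in> P" "b \<in> P" "{v a, v b} \<in> E" using that B_iff by blast+
    then have "{v a, v b} = ?e" using no[of a b] that(2) by blast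
    then show ?thesis by (rule doubleton_v[OF \<open>a \<in> P\<close> \<open>b \<in> P\<close> e(2,3)])
  qed
  obtain a b where ab: "{a, b} \<in> B" "cross p q a b" using conn[OF pq] by blast
  have "cross p q x y" using ab(2) cross_doubleton[OF only[OF ab]] by blast
  then show "\<exists>p\<in>P. \<exists>q\<in>P. cross p q x y \<and> (\<forall>a b. {a, b} \<in> B \<longrightarrow> cross p q a b \<longrightarrow> {a, b} = {x, y})"
    using only pq unfolding diagonal_def by blast
qed

lemma minimal_uip:
  assumes m: "minimally_3_connected V E H" and n5: "5 \<le> n"
  shows "interval_shape P B"
proof -
  have "card P = nat n" using n3 by simp
  then show ?thesis using extremal[OF minimal_mc[OF m]] cB n5 by linarith
qed

lemma rotate_polygon: "polygon V H (\<lambda>i. v (i + s)) n E"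
  using rotate E HE cE by (simp add: polygon_def polygon_axioms_def)

text \<open>Starting from a vertex that is not branched, the block consists of the first maximal run of branched ones; any other
branched vertex would alternate with the two ends of the complement of this run.\<close>
lemma branched_block:
  assumes U: "interval_shape P B"
  obtains k s where "1 \<le> k" "k \<le> n" "\<And>i. 1 \<le> i \<Longrightarrow> i \<le> k \<Longrightarrow> 4 \<le> degree E (v (i + s))"
    "\<And>i. k < i \<Longrightarrow> i \<le> n \<Longrightarrow> \<not> 4 \<le> degree E (v (i + s))"
proof -
  define Big where "Big i \<longleftrightarrow> 4 \<le> degree E (v i)" for i
  have B: "Big i \<longleftrightarrow> branched B (rep n i)" for i
    unfolding Big_def using branched_iff[OF repP, of i] v_rep by simp
  have Bper: "Big (i + n * t) = Big i" for i t unfolding Big_def per_mult ..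
  have alt: False if "a < b" "b < c" "c < d" "d < a + n" "Big a" "Big c" "\<not> Big b" "\<not> Big d" for a b c d
    using interval_shape_block[OF U repP repP] cross_rep[OF that(1-4)] that(5-8) unfolding B by blast
  obtain a where a: "a \<in> P" "branched B a" using interval_shape_ex[OF U] by blast
  then have a: "Big a" using B rep_id by simp
  show thesis
  proof (cases "\<forall>i. Big i")
    case True
    then show thesis using that[of n 0] n3 unfolding Big_def by auto
  next
    case False
    then obtain b where b: "\<not> Big b" by blast
    have "Big (b + int (nat ((a - b) mod n)))"
    proof -
      have e: "b + (a - b) mod n = a + n * (- ((a - b) div n))"
        using mod_mult_div_eq[of "a - b" n] by (simp add: algebra_simps)
      have "Big (b + (a - b) mod n)" unfolding e Bper by (rule a)
      then show ?thesis using n3 by simp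
    qed
    then have "\<exists>m. Big (b + int m)" by blast
    then obtain m where m: "Big (b + int m)" "\<And>m'. m' < m \<Longrightarrow> \<not> Big (b + int m')"
      using exists_least_iff[of "\<lambda>m. Big (b + int m)"] by blast
    define f where "f = b + int m"
    have "m \<noteq> 0" using m(1) b by (metis add.right_neutral of_nat_0)
    then have e: "b + int (m - 1) = f - 1" unfolding f_def by (simp add: of_nat_diff)
    have f: "Big f" "\<not> Big (f - 1)"
      using m(1) m(2)[of "m - 1"] \<open>m \<noteq> 0\<close> unfolding e f_def[symmetric] by simp_all
    have last: "\<not> Big (f + n - 1)" using f(2) Bper[of "f - 1" 1] by (simp add: algebra_simps)
    have "\<not> Big (f + int (nat (n - 1)))" using last n3 by (simp add: algebra_simps)
    then obtain k where k: "\<not> Big (f + int k)" "\<And>k'. k' < k \<Longrightarrow> Big (f + int k')"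
      using exists_least_iff[of "\<lambda>k. \<not> Big (f + int k)"] by blast
    have k1: "1 \<le> k" using k(1) f(1) by (cases k) auto
    have kn: "int k \<le> n - 1"
    proof (rule ccontr)
      assume "\<not> ?thesis"
      then have "nat (n - 1) < k" using n3 by linarith
      then show False using k(2)[of "nat (n - 1)"] last n3 by (simp add: algebra_simps)
    qed
    show thesis
    proof (rule that[of "int k" "f - 1"])
      show "1 \<le> int k" "int k \<le> n" using k1 kn by auto
      show "4 \<le> degree E (v (i + (f - 1)))" if "1 \<le> i" "i \<le> int k" for i
      proof -
        have "Big (f + int (nat (i - 1)))" using k(2)[of "nat (i - 1)"] that by simp
        then show ?thesis using that unfolding Big_def by (simp add: algebra_simps)
      qed
      show "\<not> 4 \<le> degree E (v (i + (f - 1)))" if "int k < i" "i \<le> n" for i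
      proof
        assume "4 \<le> degree E (v (i + (f - 1)))"
        then have bi: "Big (f + i - 1)" unfolding Big_def by (simp add: algebra_simps)
        have "i \<noteq> int k + 1" using bi k(1) by (auto simp: algebra_simps)
        moreover have "i \<noteq> n" using bi last by auto
        ultimately show False
          using alt[of f "f + int k" "f + i - 1" "f + n - 1"] that f(1) bi k(1) last k1 by simp
      qed
    qed
  qed
qed

end

lemma minimal_unique_interval:
  assumes "polygon V H v0 n E" and m: "minimally_3_connected V E H" and n5: "5 \<le> n"
  shows "unique_interval_property V E H"
proof -
  interpret p0: polygon V H v0 n E by fact
  show ?thesis
  proof (rule p0.branched_block[OF p0.minimal_uip[OF m n5]])
  fix k s assume k: "1 \<le> k" "k \<le> n" 
    and big0: "\<And>i. 1 \<le> i \<Longrightarrow> i \<le> k \<Longrightarrow> 4 \<le> degree E (v0 (i + s))"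
    and small0: "\<And>i. k < i \<Longrightarrow> i \<le> n \<Longrightarrow> \<not> 4 \<le> degree E (v0 (i + s))"
  define v where "v i = v0 (i + s)" for i
  interpret polygon V H v n E using p0.rotate_polygon[of s] unfolding v_def[symmetric] .
  have mcB: "min_crossed P B" using minimal_mc[OF m] .
  have U: "interval_shape P B" using minimal_uip[OF m n5] .
  have bigI: "branched B i \<longleftrightarrow> i \<le> k" if "i \<in> P" for i
    using branched_iff[OF that] big0[of i] small0[of i] that unfolding v_def[symmetric] by fastforce
  have bigP: "branched B i \<longleftrightarrow> i \<in> {1..k}" for i
  proof (cases "i \<in> P")
    case True then show ?thesis using bigI[OF True] by simp
  next
    case False
    then have "i \<notin> {1..k}" using k(2) unfolding atLeastAtMost_iff by linarith
    then show ?thesis using False branched_in[OF mcB, of i] by blast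
  qed
  let ?I = "v ` {1..k}"
  have inI: "v i \<in> ?I \<longleftrightarrow> i \<in> {1..k}" if "i \<in> P" for i
  proof
    assume "v i \<in> ?I"
    then obtain j where "j \<in> {1..k}" "v i = v j" by blast
    then show "i \<in> {1..k}" using inj[of i j] that k by auto
  qed blast
  have c4: "4 \<le> card P" using n5 by simp
  have adjpm: "adj P i (rep n (i + 1))" "adj P i (rep n (i - 1))" "rep n (i - 1) \<noteq> rep n (i + 1)" if "i \<in> P" for i
  proof -
    show "adj P i (rep n (i + 1))" using adj_rep[OF n3, of i] rep_id[OF that] by simp
    show "adj P i (rep n (i - 1))" using adj_rep[OF n3, of "i - 1"] rep_id[OF that] adj_sym by simp
    have "v (i - 1) \<noteq> v (i + 1)" using inj_near[of "i - 1" "i + 1"] n3 by simp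
    then show "rep n (i - 1) \<noteq> rep n (i + 1)" using v_rep by metis
  qed
  show ?thesis
    unfolding unique_interval_property_def
  proof (intro exI[of _ v] exI[of _ k] exI[of _ ?I] conjI)
    show "cyclic_labelling V H v" using lab .
    show "1 \<le> k" "k \<le> int (card V)" using k n by auto
    show "?I = ?I" ..
    show "\<forall>i\<in>{1..k}. 4 \<le> degree E (v i) \<and> {v (i - 1), v (i + 1)} \<in> E"
    proof
      fix i assume i: "i \<in> {1..k}"
      then have iP: "i \<in> P" using k by auto
      have "{rep n (i - 1), rep n (i + 1)} \<in> B"
        using interval_shape_short[OF U _ adjpm(2,1,3)[OF iP]] i bigP by blast
      then have "{v (i - 1), v (i + 1)} \<in> E" unfolding B_iff v_rep by blast
      then show "4 \<le> degree E (v i) \<and> {v (i - 1), v (i + 1)} \<in> E"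
        using branched_iff[OF iP] bigP i by blast
    qed
    show "\<forall>x \<in> V - ?I. degree E x = 3"
    proof
      fix x assume x: "x \<in> V - ?I"
      then obtain i where i: "i \<in> P" "x = v i" using ex_index by blast
      then have "\<not> branched B i" using x bigP by blast
      then have le: "degree E x \<le> 3" using branched_iff[OF i(1)] i by simp
      obtain j where "{i, j} \<in> B" using min_crossed_deg1[OF mcB c4 i(1)] by blast
      then have "0 < card {j. {i, j} \<in> B}" using finN by (auto simp: card_gt_0_iff)
      then show "degree E x = 3" using le degree_braces[OF i(1)] i by simp
    qed
    show "\<forall>e \<in> E - H. e \<subseteq> V - ?I \<longrightarrow> k = 1 \<and> e = {v (int (card V)), v 2}"
    proof (intro ballI impI)
      fix e assume e: "e \<in> E - H" "e \<subseteq> V - ?I"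
      obtain i j where ij: "i \<in> P" "j \<in> P" "e = {v i, v j}" using edge_index e by blast
      have B: "{i, j} \<in> B" using ij e B_iff by blast
      have nb: "\<not> branched B i" "\<not> branched B j" using ij e bigP by auto
      obtain h where h: "\<And>z. branched B z \<longleftrightarrow> z = h" "adj P h i" "adj P h j" using interval_shape_inside[OF U B nb] by blast
      have "1 = h" using h(1)[of 1] bigP[of 1] k by simp
      moreover have "k = h" using h(1)[of k] bigP[of k] k by simp
      ultimately have k1: "k = 1" "h = 1" by auto
      have "i \<noteq> j" using min_crossed_in[OF mcB B] by blast
      have "i = 2 \<or> i = n" "j = 2 \<or> j = n" using h(2,3) k1 unfolding adj_interval[OF n3] by auto
      then have "{i, j} = {n, 2}" using \<open>i \<noteq> j\<close> by auto
      then have "e = {v n, v 2}" using ij by (auto simp: doubleton_eq_iff)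
      then show "k = 1 \<and> e = {v (int (card V)), v 2}" using k1 n by simp
    qed
    show "\<forall>x\<in>?I. \<forall>y\<in>?I. \<forall>p \<in> V - ?I. \<forall>q \<in> V - ?I.
           intersect_in_interior V E H v {x, p} {y, q} \<longrightarrow> {x, y} \<in> H"
    proof (intro ballI impI)
      fix x y p q assume x: "x \<in> ?I" and y: "y \<in> ?I" and p: "p \<in> V - ?I" and q: "q \<in> V - ?I"
        and ii: "intersect_in_interior V E H v {x, p} {y, q}"
      obtain i j where ij: "i \<in> {1..k}" "j \<in> {1..k}" "x = v i" "y = v j" using x y by blast
      obtain s t where st: "s \<in> P" "t \<in> P" "p = v s" "q = v t" using ex_index p q by (metis DiffD1)
      have ijP: "i \<in> P" "j \<in> P" using ij k by auto
      obtain a b c d where abcd: "a < b" "b < c" "c < d" "d < a + n"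
        "{x, p} = {v a, v c}" "{y, q} = {v b, v d}" "{x, p} \<in> E - H" "{y, q} \<in> E - H"
        using ii n unfolding intersect_in_interior_def by blast
      have e1: "{i, s} = {rep n a, rep n c}" 
        using doubleton_v[OF ijP(1) st(1) repP repP] abcd(5) ij st v_rep by simp
      have e2: "{j, t} = {rep n b, rep n d}" 
        using doubleton_v[OF ijP(2) st(2) repP repP] abcd(6) ij st v_rep by simp
      have "cross (rep n a) (rep n c) (rep n b) (rep n d)" using cross_rep[OF abcd(1-4)] .
      then have "cross (rep n a) (rep n c) j t" using cross_doubleton[OF e2] by blast
      then have "cross j t i s" using cross_doubleton[OF e1] cross_dual by blast
      then have k: "cross i s j t" using cross_dual by blast
      have "{i, s} \<in> B" "{j, t} \<in> B" using abcd(7,8) ij st ijP B_iff by auto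
      moreover have "branched B i" "branched B j" "\<not> branched B s" "\<not> branched B t" using bigP ij st p q by auto
      ultimately have "adj P i j" using interval_shape_crossing[OF U _ _ k] by blast
      then show "{x, y} \<in> H" using H_iff[OF ijP] ij by blast
    qed
  qed
qed
qed

section \<open>The unique interval property implies minimality\<close>

locale interval_shape_polygon = polygon V H v n E for V :: "'a set" and H v n E +
  fixes k :: int
  assumes k1: "1 \<le> k" and kn0: "k \<le> n"
    and deg4: "\<And>i. i \<in> {1..k} \<Longrightarrow> 4 \<le> degree E (v i)"
    and short: "\<And>i. i \<in> {1..k} \<Longrightarrow> {v (i - 1), v (i + 1)} \<in> E"
    and deg3: "\<And>x. x \<in> V - v ` {1..k} \<Longrightarrow> degree E x = 3"
    and inside: "\<And>e. e \<in> E - H \<Longrightarrow> e \<subseteq> V - v ` {1..k} \<Longrightarrow> k = 1 \<and> e = {v n, v 2}"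
    and crossing: "\<And>x y p q. x \<in> v ` {1..k} \<Longrightarrow> y \<in> v ` {1..k} \<Longrightarrow> p \<in> V - v ` {1..k} \<Longrightarrow> q \<in> V - v ` {1..k} \<Longrightarrow>
       intersect_in_interior V E H v {x, p} {y, q} \<Longrightarrow> {x, y} \<in> H"
begin

lemma outside: assumes "i \<in> {k + 1..n}" shows "v i \<in> V - v ` {1..k}"
proof -
  have "v i \<notin> v ` {1..k}"
  proof
    assume "v i \<in> v ` {1..k}"
    then obtain j where "j \<in> {1..k}" "v i = v j" by blast
    then show False using inj[of i j] assms kn0 k1 by auto
  qed
  then show ?thesis using vV by blast
qed

lemma bigk: assumes "i \<in> P" shows "branched B i \<longleftrightarrow> i \<le> k"
  using branched_iff[OF assms] deg4[of i] deg3[OF outside, of i] assms by fastforce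

lemma brace_ex: assumes "i \<in> P" shows "\<exists>j. {i, j} \<in> B"
proof -
  have "3 \<le> degree E (v i)" using deg4[of i] deg3[OF outside, of i] assms by fastforce
  then have "card {j. {i, j} \<in> B} \<noteq> 0" using degree_braces[OF assms] by simp
  then show ?thesis using finN by (auto simp: card_eq_0_iff)
qed

lemma no_outer: assumes "{i, j} \<in> B" "k < i" "k < j" shows "k = 1 \<and> {i, j} = {n, 2}"
proof -
  have ij: "i \<in> P" "j \<in> P" "{v i, v j} \<in> E - H" using assms(1) B_iff by blast+
  then have "v i \<in> V - v ` {1..k}" "v j \<in> V - v ` {1..k}" using outside assms by auto
  then have "k = 1" "{v i, v j} = {v n, v 2}" using inside[OF ij(3)] by auto
  then show ?thesis using doubleton_v[OF ij(1,2), of n 2] n3 by auto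
qed

lemma n5: "5 \<le> n"
proof -
  have 1: "1 \<in> P" using n3 by simp
  have "{j. {1, j} \<in> B} \<subseteq> {3..n - 1}"
  proof
    fix j assume "j \<in> {j. {1, j} \<in> B}"
    then have "diagonal P 1 j" using B_chord by blast
    then have "\<not> adj P 1 j" "j \<in> P" "j \<noteq> 1" unfolding adj_def diagonal_def by (auto simp: cross_def)
    then show "j \<in> {3..n - 1}" unfolding adj_interval[OF n3] using n3 by auto
  qed
  then have "card {j. {1, j} \<in> B} \<le> card {3..n - 1}" by (intro card_mono) auto
  moreover have "2 \<le> card {j. {1, j} \<in> B}" using degree_braces[OF 1] deg4[of 1] k1 by simp
  ultimately show ?thesis by simp
qed

lemma cardP: "4 \<le> card P" using n5 by simp

lemma nbrs: assumes "i \<in> P"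
  shows "adj P i (rep n (i + 1))" "adj P i (rep n (i - 1))" "rep n (i - 1) \<noteq> rep n (i + 1)"
proof -
  show "adj P i (rep n (i + 1))" using adj_rep[OF n3, of i] rep_id[OF assms] by simp
  show "adj P i (rep n (i - 1))" using adj_rep[OF n3, of "i - 1"] rep_id[OF assms] adj_sym by simp
  have "v (i - 1) \<noteq> v (i + 1)" using inj_near[of "i - 1" "i + 1"] n3 by simp
  then show "rep n (i - 1) \<noteq> rep n (i + 1)" using v_rep by metis
qed

lemma nbr_brace: assumes i: "i \<in> {1..k}" and a: "adj P i y" "adj P i z" "y \<noteq> z" shows "{y, z} \<in> B"
proof -
  have iP: "i \<in> P" using i kn0 by auto
  note N = nbrs[OF iP]
  have "diagonal P (rep n (i - 1)) (rep n (i + 1))"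
    using nbrs_chord(1)[OF _ cardP N(2,1,3)] by simp
  moreover have "{v (rep n (i - 1)), v (rep n (i + 1))} \<in> E" using short[OF i] v_rep by simp
  ultimately have "{rep n (i - 1), rep n (i + 1)} \<in> B" by (rule diagonal_B)
  moreover have "{y, z} = {rep n (i - 1), rep n (i + 1)}"
    using adj3[OF N(2,1), of y] adj3[OF N(2,1), of z] a N(3) by auto
  ultimately show ?thesis by simp
qed

lemma short_brace: assumes "2 \<le> t" "t \<le> k" "t < n" shows "{t - 1, t + 1} \<in> B"
  by (rule nbr_brace[of t]) (use assms n3 in \<open>auto simp: adj_interval\<close>)

lemma inj_short: "inj_on (\<lambda>t::int. {t - 1, t + 1}) A"
proof (rule inj_onI)
  fix s t :: int assume "{s - 1, s + 1} = {t - 1, t + 1}"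
  then show "s = t" by (auto simp: doubleton_eq_iff)
qed

text \<open>If all vertices were in the interval, each of them would have a short chord, which makes more than \<open>n - 2\<close> braces.\<close>
lemma kn: "k < n"
proof (rule ccontr)
  assume "\<not> ?thesis"
  then have k: "k = n" using kn0 by simp
  let ?S = "(\<lambda>t. {t - 1, t + 1}) ` {2..n - 1}"
  have "?S \<subseteq> B" using short_brace k by auto
  moreover have "{n, 2} \<in> B" by (rule nbr_brace[of 1]) (use n5 k1 in \<open>auto simp: adj_interval\<close>)
  moreover have "{n, 2} \<notin> ?S"
  proof
    assume "{n, 2} \<in> ?S"
    then obtain t where "{n, 2} = {t - 1, t + 1}" by blast
    then show False using n5 by (auto simp: doubleton_eq_iff)
  qed
  moreover have "card ?S = card {2..n - 1}" using inj_short by (rule card_image)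
  ultimately have "card (insert {n, 2} ?S) = Suc (card {2..n - 1})" "insert {n, 2} ?S \<subseteq> B" by auto
  then have "Suc (card {2..n - 1}) \<le> card B" using card_mono[OF finB] by metis
  then show False using cB n5 by simp
qed

text \<open>The \<open>n - k\<close> outer vertices have distinct braces, and \<open>k - 2\<close> short chords lie inside the interval.
Together these are all \<open>n - 2\<close> braces.\<close>
lemma inner_brace:
  assumes ab: "{a, b} \<in> B" "a \<le> k" "b \<le> k"
  shows "\<exists>t. 2 \<le> t \<and> t \<le> k - 1 \<and> {a, b} = {t - 1, t + 1}"
proof -
  have abP: "1 \<le> a" "1 \<le> b" "a \<noteq> b" using B_chord[OF ab(1)] unfolding diagonal_def by (auto simp: cross_def)
  then have k2: "2 \<le> k" using ab by linarith
  let ?S = "(\<lambda>t. {t - 1, t + 1}) ` {2..k - 1}"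
  define g where "g i = {i, SOME j. {i, j} \<in> B}" for i
  let ?T = "g ` {k + 1..n}"
  have g: "g i \<in> B" if "i \<in> {k + 1..n}" for i
    unfolding g_def using someI_ex[OF brace_ex[of i]] that k1 by simp
  have "inj_on g {k + 1..n}"
  proof (rule inj_onI, rule ccontr)
    fix i j assume ij: "i \<in> {k + 1..n}" "j \<in> {k + 1..n}" "g i = g j" "i \<noteq> j"
    have "i \<in> g i" "j \<in> g i" using ij(3) unfolding g_def by auto
    then have "g i = {i, j}" using ij(4) unfolding g_def by auto
    then have "{i, j} \<in> B" using g[OF ij(1)] by simp
    then show False using no_outer[of i j] ij k2 by auto
  qed
  then have cT: "int (card ?T) = n - k" using card_image kn by fastforce
  have cS: "int (card ?S) = k - 2" using card_image[OF inj_short] k2 by simp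
  have disj: "?S \<inter> ?T = {}"
  proof -
    have "g i \<noteq> {t - 1, t + 1}" if "i \<in> {k + 1..n}" "t \<in> {2..k - 1}" for i t
    proof -
      have "i \<in> g i" unfolding g_def by blast
      then show ?thesis using that by auto
    qed
    then show ?thesis by blast
  qed
  have sub: "?S \<union> ?T \<subseteq> B" using g short_brace kn by auto
  have "card (?S \<union> ?T) = card ?S + card ?T" by (rule card_Un_disjoint) (use disj in auto)
  then have "card (?S \<union> ?T) = card B" using cS cT cB by linarith
  then have "?S \<union> ?T = B" using card_subset_eq[OF finB sub] by blast
  moreover have "{a, b} \<notin> ?T"
  proof
    assume "{a, b} \<in> ?T"
    then obtain i where "i \<in> {k + 1..n}" "g i = {a, b}" by auto
    moreover have "i \<in> g i" unfolding g_def by blast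
    ultimately show False using ab by auto
  qed
  ultimately have "{a, b} \<in> ?S" using ab(1) by blast
  then show ?thesis by auto
qed

text \<open>A diagonal at a vertex of the interval is crossed by the short chord of that vertex. For \<open>p < q\<close> outside the interval,
the brace at \<open>p + 1\<close> leads to the interval; it is not the exceptional brace of a wheel because \<open>2 < p + 1 < n\<close>.\<close>
lemma crossed: assumes c: "diagonal P p q" shows "\<exists>x y. {x, y} \<in> B \<and> cross p q x y"
proof -
  have one: "\<exists>x y. {x, y} \<in> B \<and> cross p q x y" if "diagonal P p q" "p \<le> k" for p q
  proof -
    have "p \<in> {1..k}" using that unfolding diagonal_def by simp
    then show ?thesis using two_nbrs[OF _ that(1)] nbr_brace cross_distinct by (metis finite_atLeastAtMost_int)
  qed
  have two: "\<exists>x y. {x, y} \<in> B \<and> cross p q x y" if pq: "diagonal P p q" "k < p" "k < q" "p < q" for p q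
  proof -
    have in_P: "p \<in> P" "q \<in> P" "\<not> adj P p q" using pq(1) unfolding diagonal_def adj_def by auto
    then have "p + 1 < q" unfolding adj_interval[OF n3] using pq(4) by auto
    moreover have t: "p + 1 \<in> P" using in_P pq(4) by auto
    obtain z where z: "{p + 1, z} \<in> B" using brace_ex[OF t] by blast
    have "z \<in> P" using z B_iff by blast
    have "z \<le> k"
    proof (rule ccontr)
      assume "\<not> ?thesis"
      then have "{p + 1, z} = {n, 2}" using no_outer[OF z] pq by simp
      then have "p + 1 = n \<or> p + 1 = 2" by (auto simp: doubleton_eq_iff)
      then show False using \<open>p + 1 < q\<close> in_P pq k1 by auto
    qed
    then have "cross p q (p + 1) z" using pq \<open>p + 1 < q\<close> unfolding cross_def by simp
    then show ?thesis using z by blast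
  qed
  have pq: "p \<noteq> q" using c unfolding diagonal_def by (auto simp: cross_def)
  consider "p \<le> k" | "q \<le> k" | "k < p" "k < q" "p < q" | "k < p" "k < q" "q < p" using pq by linarith
  then show ?thesis
  proof cases
    case 1 then show ?thesis using one c by blast
  next
    case 2 then show ?thesis using one[of q p] c diagonal_sym cross_flip by blast
  next
    case 3 then show ?thesis using two c by blast
  next
    case 4 then show ?thesis using two[of q p] c diagonal_sym cross_flip by blast
  qed
qed

lemma connected: "three_connected V E"
proof (rule crossed_three_connected)
  show "4 \<le> n" using n5 by simp
  show "H \<subseteq> E" "simple_graph V E" using HE E .
  fix p q assume "diagonal P p q"
  then show "\<exists>i\<in>P. \<exists>j\<in>P. {v i, v j} \<in> E \<and> cross p q i j" using crossed B_iff by metis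
qed

lemma critical_chord:
  assumes t: "2 \<le> t" "t \<le> k - 1"
  shows "\<exists>q. diagonal P t q \<and> (\<forall>a b. {a, b} \<in> B \<longrightarrow> cross t q a b \<longrightarrow> {a, b} = {t - 1, t + 1})"
proof -
  let ?M = "{j \<in> {k + 1..n}. j = k + 1 \<or> (\<exists>y\<in>{t + 1..k}. {y, j} \<in> B)}"
  have finM: "finite ?M" by (rule finite_subset[of _ "{k + 1..n}"]) auto
  have "k + 1 \<in> ?M" using kn by simp
  then have ne: "?M \<noteq> {}" by blast
  \<comment> \<open>The last outer vertex joined to \<open>t + 1, \<dots>, k\<close>. The vertex \<open>k + 1\<close> is admitted because it follows \<open>k\<close> on the boundary.\<close>
  define q where "q = Max ?M"
  have qM: "q \<in> ?M" unfolding q_def using Max_in[OF finM ne] .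
  have qmax: "j \<le> q" if "j \<in> ?M" for j unfolding q_def using Max_ge[OF finM that] .
  have q: "k + 1 \<le> q" "q \<le> n" using qM by auto
  have key: "{a, b} = {t - 1, t + 1}" if ab: "{a, b} \<in> B" and a: "t < a" "a < q" and b: "b < t \<or> q < b" for a b
  proof -
    have abP: "a \<in> P" "b \<in> P" "{v a, v b} \<in> E - H" using ab B_iff by blast+
    consider "a \<le> k" "b < t" | "a \<le> k" "q < b" | "k < a" "q < b" | "k < a" "b < t" using b by linarith
    then show ?thesis
    proof cases
      case 1
      then obtain s where s: "{a, b} = {s - 1, s + 1}" using inner_brace[OF ab] t by auto
      then have "a = s + 1" "b = s - 1" using 1 a by (auto simp: doubleton_eq_iff)
      then have "s = t" using 1 a by linarith
      then show ?thesis using s by simp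
    next
      case 2
      then have "b \<in> ?M" using abP ab a q by auto
      then show ?thesis using qmax[of b] 2 by simp
    next
      case 3 then show ?thesis using no_outer[OF ab] q t by simp
    next
      case 4
      then have "q \<noteq> k + 1" using a by simp
      then obtain y where y: "y \<in> {t + 1..k}" "{y, q} \<in> B" using qM by blast
      have yP: "{v y, v q} \<in> E - H" using y(2) B_iff by blast
      have ord: "b < y" "y < a" "a < q" "q < b + int (card V)" using 4 y a q abP n by auto
      have "{v a, v b} = {v b, v a}" by blast
      then have "intersect_in_interior V E H v {v b, v a} {v y, v q}"
        unfolding intersect_in_interior_def using abP(3) yP ord by metis
      moreover have "v b \<in> v ` {1..k}" "v y \<in> v ` {1..k}" using abP 4 y t by auto
      moreover have "v a \<in> V - v ` {1..k}" "v q \<in> V - v ` {1..k}" using outside abP 4 q by auto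
      ultimately have "{v b, v y} \<in> H" using crossing by blast
      moreover have "y \<in> P" using y kn t by auto
      ultimately have "adj P b y" using H_iff[OF abP(2)] by blast
      then show ?thesis using 4 y kn t abP unfolding adj_interval[OF n3] by auto
    qed
  qed
  have "diagonal P t q"
  proof -
    have "cross t q (t + 1) (t - 1)" using t q unfolding cross_def by simp
    moreover have "t \<in> P" "q \<in> P" "t + 1 \<in> P" "t - 1 \<in> P" using t q kn by auto
    ultimately show ?thesis unfolding diagonal_def by blast
  qed
  moreover have "{a, b} = {t - 1, t + 1}" if ab: "{a, b} \<in> B" "cross t q a b" for a b
  proof -
    have "t < q" using t q by simp
    then have "(t < a \<and> a < q \<and> (b < t \<or> q < b)) \<or> (t < b \<and> b < q \<and> (a < t \<or> q < a))"
      using ab(2) unfolding cross_def by (smt (z3))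
    moreover have "{b, a} \<in> B" "{b, a} = {a, b}" using ab(1) by (simp_all add: insert_commute)
    ultimately show ?thesis using key[OF ab(1)] key[of b a] by metis
  qed
  ultimately show ?thesis by blast
qed

text \<open>Removing a brace at a vertex of degree three leaves the diagonal between its neighbours uncrossed.
A brace with both ends in the interval is a short chord.\<close>
lemma removal: assumes e: "e \<in> E - H" shows "\<not> three_connected V (E - {e})"
proof
  assume c: "three_connected V (E - {e})"
  obtain i j where ij: "i \<in> P" "j \<in> P" "e = {v i, v j}" using edge_index e by blast
  have B: "{i, j} \<in> B" "{j, i} \<in> B" using ij e B_iff by (auto simp: insert_commute)
  have simple: "simple_graph V (E - {e})" using E unfolding simple_graph_def by blast
  have other: "\<exists>a b. {a, b} \<in> B \<and> {a, b} \<noteq> {i, j} \<and> cross p q a b" if pq: "diagonal P p q" for p q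
  proof -
    obtain a b where ab: "a \<in> P" "b \<in> P" "{v a, v b} \<in> E - {e}" "cross p q a b"
      using three_connected_crossed[OF c simple pq] by blast
    have "diagonal P a b" using cross_chord[OF ab(4)] ab pq unfolding diagonal_def by blast
    then have "{a, b} \<in> B" using diagonal_B ab by blast
    moreover have "{a, b} \<noteq> {i, j}"
    proof
      assume "{a, b} = {i, j}"
      then have "{v a, v b} = {v i, v j}" by (auto simp: doubleton_eq_iff)
      then show False using ab(3) ij(3) by simp
    qed
    ultimately show ?thesis using ab(4) by blast
  qed
  have branched_end: "branched B x" if xy: "{x, y} = {i, j}" for x y
  proof -
    have xB: "{x, y} \<in> B" using B xy by simp
    then have xP: "x \<in> P" using B_iff by blast
    note N = nbrs[OF xP]
    have fin: "finite P" by simp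
    obtain a b where ab: "{a, b} \<in> B" "{a, b} \<noteq> {i, j}" "cross (rep n (x - 1)) (rep n (x + 1)) a b"
      using other[OF nbrs_chord(1)[OF fin cardP N(2,1,3)]] by blast
    have "a \<in> P" "b \<in> P" using ab(1) B_iff by blast+
    then have "a = x \<or> b = x" using nbrs_chord(2)[OF fin cardP N(2,1,3) _ _ ab(3)] by blast
    then obtain z where z: "{a, b} = {x, z}" by blast
    then have "{x, z} \<in> B" "z \<noteq> y" using ab xy by auto
    then show ?thesis using bigI[OF _ xB] by blast
  qed
  have "i \<le> k" "j \<le> k" using branched_end[of i j] branched_end[of j i] bigk ij by (auto simp: insert_commute)
  then obtain t where t: "2 \<le> t" "t \<le> k - 1" "{i, j} = {t - 1, t + 1}" using inner_brace[OF B(1)] by blast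
  obtain q where q: "diagonal P t q" "\<And>a b. {a, b} \<in> B \<Longrightarrow> cross t q a b \<Longrightarrow> {a, b} = {t - 1, t + 1}"
    using critical_chord[OF t(1,2)] by blast
  then show False using other[OF q(1)] q(2) t(3) by metis
qed

lemma minimal: "minimally_3_connected V E H"
  unfolding minimally_3_connected_def using connected removal by blast

end

lemma unique_interval_minimal:
  assumes E: "simple_graph V E" and HE: "H \<subseteq> E" and c: "int (card E) = 2 * int (card V) - 2"
    and V3: "3 \<le> card V" and U: "unique_interval_property V E H"
  shows "minimally_3_connected V E H"
proof -
  obtain v k I where U: "cyclic_labelling V H v" "1 \<le> k" "k \<le> int (card V)" "I = v ` {1..k}"
        "\<forall>i\<in>{1..k}. 4 \<le> degree E (v i) \<and> {v (i - 1), v (i + 1)} \<in> E"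
        "\<forall>x \<in> V - I. degree E x = 3"
        "\<forall>e \<in> E - H. e \<subseteq> V - I \<longrightarrow> k = 1 \<and> e = {v (int (card V)), v 2}"
        "\<forall>x\<in>I. \<forall>y\<in>I. \<forall>p \<in> V - I. \<forall>q \<in> V - I.
           intersect_in_interior V E H v {x, p} {y, q} \<longrightarrow> {x, y} \<in> H"
    using U unfolding unique_interval_property_def by (elim exE conjE)
  interpret interval_shape_polygon V H v "int (card V)" E k
  proof
    show "cyclic_labelling V H v" by (rule U)
    show "int (card V) = int (card V)" ..
    show "3 \<le> int (card V)" using V3 by simp
    show "simple_graph V E" "H \<subseteq> E" "int (card E) = 2 * int (card V) - 2" by (fact E HE c)+
    show "1 \<le> k" "k \<le> int (card V)" by (fact U)+
    show "\<And>i. i \<in> {1..k} \<Longrightarrow> 4 \<le> degree E (v i)" using U(5) by blast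
    show "\<And>i. i \<in> {1..k} \<Longrightarrow> {v (i - 1), v (i + 1)} \<in> E" using U(5) by blast
    show "\<And>x. x \<in> V - v ` {1..k} \<Longrightarrow> degree E x = 3" using U(4,6) by blast
    show "\<And>e. e \<in> E - H \<Longrightarrow> e \<subseteq> V - v ` {1..k} \<Longrightarrow> k = 1 \<and> e = {v (int (card V)), v 2}"
      using U(7) unfolding U(4) by simp
    show "\<And>x y p q. x \<in> v ` {1..k} \<Longrightarrow> y \<in> v ` {1..k} \<Longrightarrow> p \<in> V - v ` {1..k} \<Longrightarrow> q \<in> V - v ` {1..k} \<Longrightarrow>
       intersect_in_interior V E H v {x, p} {y, q} \<Longrightarrow> {x, y} \<in> H"
      by (rule U(8)[unfolded U(4), rule_format])
  qed
  show ?thesis by (rule minimal)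
qed

theorem theoremA1:
  fixes V :: "'a set" and E H :: "'a set set"
  assumes "braced_polygonal_circuit V E H"
    and "card V \<noteq> 4"
  shows "minimally_3_connected V E H \<longleftrightarrow> unique_interval_property V E H"
proof
  have g: "simple_graph V E" "3 \<le> card V" "H \<subseteq> E" "\<exists>v. cyclic_labelling V H v"
    "int (card E) = 2 * int (card V) - 2"
    using assms(1) unfolding braced_polygonal_circuit_def braced_polygon_graph_def hamilton_cycle_def
      generic_rigidity_circuit_def by auto
  show "unique_interval_property V E H" if m: "minimally_3_connected V E H"
  proof -
    obtain v where v: "cyclic_labelling V H v" using g(4) by blast
    have "polygon V H v (int (card V)) E"
      by unfold_locales (use v g in auto)
    moreover have "3 < card V" using m unfolding minimally_3_connected_def three_connected_def by blast
    then have "5 \<le> int (card V)" using assms(2) by linarith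
    ultimately show ?thesis using minimal_unique_interval m by blast
  qed
  show "minimally_3_connected V E H" if "unique_interval_property V E H"
    using unique_interval_minimal[OF g(1,3,5,2) that] .
qed

end
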